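(* Let $(\mathcal D_n)_{n\ge1}$ be a sequence of feasible degree sequences such that there exist $\delta,\delta'>0$, $d_1=d_1(n)$ and $d_2=d_2(n)$ with $1\le d_2<d_1$ and $d_1/d_2\ge c$ for some constant $c>1$, and such that (i) $|S_n(d_2)\setminus S_n(d_1)|\ge\delta n$, and (ii) for some $d=d(n)\gg d_1$, $|S_n(d)|\ge\delta' n$. Let $p_1=\frac1{d_1}$ and $p_2=\frac1{d_2}$. Then there is a positive real number $C=C(\delta,\delta',c)>0$ such that $$\mathbb P\left[L_1(\mathbf G(\mathcal D_n)_{p_2})-L_1(\mathbf G(\mathcal D_n)_{p_1})\ge Cn\right]=1-o(1).$$
   Context: For each $n$, $\mathcal D_n$ is a sequence of $n$ integers, each $\ge1$, that is feasible, i.e. there is a simple graph on $[n]$ in which each vertex $i$ has the $i$-th entry of $\mathcal D_n$ as its degree. $\mathbf G(\mathcal D_n)$ is a uniformly random simple graph among those. For a graph $G$ and $p\in[0,1]$, $G_p$ is the random subgraph on the same vertex set in which each edge of $G$ is kept independently with probability $p$. For $p_1\le p_2$ the two percolations of the same graph are coupled as a two-stage process: first each edge is kept with probability $p_1$ (giving $G_{p_1}$), then each edge not kept gets a second independent chance with probability $(p_2-p_1)/(1-p_1)$ (giving $G_{p_2}\supseteq G_{p_1}$). $L_1(G)$ is the number of vertices of a largest component of $G$. $S_n(x)$ is the set of vertices in $[n]$ whose prescribed degree is at least $x$. Asymptotics are as $n\to\infty$; $f\gg g$ means $g(n)/f(n)\to0$. *)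

theory Defs
  imports "HOL-Probability.Probability" "HOL-Probability.Product_PMF"
begin

text \<open>A simple graph on the vertex set \<open>[n] = {1..n}\<close> is represented by its set of edges,
  each edge being a two-element subset of \<open>{1..n}\<close>.\<close>

definition simple_graphs :: "nat \<Rightarrow> nat set set set" where
  "simple_graphs n = Pow {e. e \<subseteq> {1..n} \<and> card e = 2}"

definition vertex_degree :: "nat set set \<Rightarrow> nat \<Rightarrow> nat" where
  "vertex_degree E v = card {e \<in> E. v \<in> e}"

text \<open>A degree sequence on \<open>[n]\<close> is a function \<open>D\<close> of which only the values
  \<open>D 1, \<dots>, D n\<close> matter.\<close>

definition graphs_with_degrees :: "nat \<Rightarrow> (nat \<Rightarrow> nat) \<Rightarrow> nat set set set" where
  "graphs_with_degrees n D = {E \<in> simple_graphs n. \<forall>i\<in>{1..n}. vertex_degree E i = D i}"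

definition feasible :: "nat \<Rightarrow> (nat \<Rightarrow> nat) \<Rightarrow> bool" where
  "feasible n D \<longleftrightarrow> graphs_with_degrees n D \<noteq> {}"

definition high_degree :: "nat \<Rightarrow> (nat \<Rightarrow> nat) \<Rightarrow> real \<Rightarrow> nat set" where
  "high_degree n D x = {i \<in> {1..n}. real (D i) \<ge> x}"

definition component :: "nat \<Rightarrow> nat set set \<Rightarrow> nat \<Rightarrow> nat set" where
  "component n E v = {w \<in> {1..n}. (v, w) \<in> {(a, b). {a, b} \<in> E}\<^sup>*}"

definition L1 :: "nat \<Rightarrow> nat set set \<Rightarrow> nat" where
  "L1 n E = Max ((\<lambda>v. card (component n E v)) ` {1..n})"

text \<open>Only meaningful for feasible \<open>D\<close>, since \<open>pmf_of_set\<close> is unspecified on the empty set.\<close>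

definition random_graph :: "nat \<Rightarrow> (nat \<Rightarrow> nat) \<Rightarrow> nat set set pmf" where
  "random_graph n D = pmf_of_set (graphs_with_degrees n D)"

definition percolate :: "real \<Rightarrow> nat set set \<Rightarrow> nat set set pmf" where
  "percolate p E = map_pmf (\<lambda>keep. {e \<in> E. keep e}) (Pi_pmf E False (\<lambda>_. bernoulli_pmf p))"

text \<open>The joint law of \<open>(G\<^bsub>p1\<^esub>, G\<^bsub>p2\<^esub>)\<close> under the two-stage coupling, for
  \<open>0 \<le> p1 \<le> p2 \<le> 1\<close> and \<open>p1 < 1\<close>, where \<open>G\<close> is the random graph with degree sequence \<open>D\<close>.\<close>

definition coupled_percolation ::
  "nat \<Rightarrow> (nat \<Rightarrow> nat) \<Rightarrow> real \<Rightarrow> real \<Rightarrow> (nat set set \<times> nat set set) pmf" where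
  "coupled_percolation n D p1 p2 =
     bind_pmf (random_graph n D) (\<lambda>G.
     bind_pmf (percolate p1 G) (\<lambda>H.
     map_pmf (\<lambda>K. (H, H \<union> K)) (percolate ((p2 - p1) / (1 - p1)) (G - H))))"

end

theory Submission
  imports Defs
begin

text \<open>
  Let \<open>H\<close> be the graph after the first stage and \<open>R = G - H\<close> the edges that get a second chance.
  The claim holds because \<open>H\<close> has one giant component, which contains all but a small fraction of the
  vertices that are not isolated in \<open>H\<close>, whereas a positive fraction of the vertices with degree
  between \<open>d2\<close> and \<open>d1\<close> is isolated in \<open>H\<close>. For most of these isolated vertices at least half of the
  edges, hence at least \<open>d2 / 2\<close>, lead into the giant component, so each of them is attached to it in the
  second stage with probability bounded below. The randomness of \<open>G\<close> is
  used only through switchings, which replace two edges \<open>ab, xy\<close> by \<open>ay, bx\<close> and keep all degrees.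

  \<^bold>\<open>The giant component.\<close> Take \<open>d0 = sqrt (d1 * d)\<close>, so that \<open>d0\<close> is much larger than \<open>d1\<close> and much
  smaller than \<open>d\<close>, and let \<open>B\<close> be the set of vertices of degree at least \<open>d0\<close>. Fix a vertex set
  \<open>S\<close> that splits \<open>B\<close> into two parts of linear size. If only \<open>k\<close> edges cross the cut, then for most
  pairs \<open>u\<close>, \<open>x\<close> of vertices of \<open>B\<close> on different sides, most choices of edges \<open>uv\<close> and \<open>xy\<close> within
  the sides can be switched to \<open>uy, vx\<close>. This gives order \<open>(n * d0)\<^sup>2\<close> ways to obtain a graph with
  \<open>k + 2\<close> crossing edges, and such a graph is obtained in at most \<open>(k + 2)\<^sup>2\<close> ways
  (\<open>cut_switching_ratio\<close>). Hence the probability that fewer than a small multiple of \<open>n * d0\<close> edges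
  cross is exponentially small in \<open>n * d0\<close>. Since \<open>d0\<close> is much larger than \<open>d1\<close>, this survives a
  union bound over all \<open>2 ^ n\<close> cuts and the percolation (\<open>balanced_cuts_survive\<close>), so one component
  \<open>\<Gamma>\<close> of \<open>H\<close> contains all but a small fraction of \<open>B\<close> (\<open>majority_covers\<close>). The same union bound
  shows that only \<open>O(n * d1)\<close> edges of \<open>G\<close> leave \<open>\<Gamma>\<close> (\<open>large_cuts_survive\<close>).

  \<^bold>\<open>Single vertices.\<close> Order \<open>n * d\<close> edges of \<open>R\<close> have both ends in \<open>\<Gamma>\<close>. Let \<open>a\<close> be a vertex outside
  \<open>\<Gamma>\<close> of degree below \<open>d0\<close> and \<open>ab\<close> an edge with \<open>b\<close> outside \<open>\<Gamma>\<close>. Switch \<open>ab\<close> and an edge \<open>xy\<close> of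
  \<open>R\<close> inside \<open>\<Gamma>\<close> to \<open>ay, bx\<close>, and let \<open>ay\<close> belong to \<open>H\<close> or to \<open>R\<close> as \<open>ab\<close> did. This changes
  \<open>H\<close> only at \<open>a\<close>, so \<open>\<Gamma>\<close> can be recovered from the result, and \<open>bx\<close> is one of the \<open>O(n * d1)\<close> edges
  that leave \<open>\<Gamma>\<close>. If \<open>ab\<close> was in \<open>H\<close>, then \<open>y\<close> is determined as well, so a vertex of low degree
  outside \<open>\<Gamma>\<close> is isolated in \<open>H\<close> up to probability \<open>O(d1 / d)\<close>
  (\<open>vertex_outside_majority_isolated\<close>). If \<open>ab\<close> was in \<open>R\<close>, there are at most as many choices of
  \<open>y\<close> as the degree of \<open>a\<close>, so few edges at an isolated \<open>a\<close> avoid \<open>\<Gamma>\<close>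
  (\<open>isolated_vertex_sees_majority\<close>). The switching is impossible when \<open>b\<close> is already adjacent to
  too much of \<open>\<Gamma>\<close>. But a vertex with linearly many neighbours in \<open>\<Gamma>\<close> stays outside \<open>\<Gamma>\<close> only if
  none of these edges is kept, which is unlikely because \<open>d1\<close> is much smaller than \<open>n\<close>
  (\<open>stranded_unlikely\<close>).

  \<^bold>\<open>Counting.\<close> The number of isolated vertices of degree between \<open>d2\<close> and \<open>d1\<close> and the number of
  those attached in the second stage are concentrated by Chebyshev's inequality. All error
  probabilities together are at most a constant times \<open>d1 / d\<close> plus a constant times \<open>1 / n\<close> plus
  \<open>3 / 2 ^ n\<close> (\<open>gap_failure_prob\<close>).
\<close>

section \<open>Probability estimates\<close>

lemma prob_bind_le_except:
  assumes "\<And>x. x \<in> set_pmf M \<Longrightarrow> x \<in> T \<Longrightarrow> measure_pmf.prob (f x) A \<le> c" "0 \<le> c"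
  shows "measure_pmf.prob (bind_pmf M f) A \<le> measure_pmf.prob M (- T) + c"
proof -
  have "emeasure (bind_pmf M f) A = (\<integral>\<^sup>+x. emeasure (f x) A \<partial>M)" by simp
  also have "\<dots> \<le> (\<integral>\<^sup>+x. indicator (- T) x + ennreal c \<partial>M)"
  proof (intro nn_integral_mono_AE, simp add: AE_measure_pmf_iff, intro ballI)
    fix x assume x: "x \<in> set_pmf M"
    show "emeasure (f x) A \<le> indicator (- T) x + ennreal c"
    proof (cases "x \<in> T")
      case True
      then show ?thesis using assms(1)[OF x True] by (simp add: measure_pmf.emeasure_eq_measure ennreal_leI)
    next
      case False
      have "emeasure (f x) A \<le> 1" by (simp add: measure_pmf.emeasure_eq_measure)
      also have "\<dots> \<le> indicator (- T) x + ennreal c" using False by (simp add: add_increasing2)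
      finally show ?thesis .
    qed
  qed
  also have "\<dots> = emeasure M (- T) + ennreal c" by (simp add: nn_integral_add)
  also have "\<dots> = ennreal (measure_pmf.prob M (- T) + c)"
    using assms(2) by (simp add: measure_pmf.emeasure_eq_measure)
  finally have "ennreal (measure_pmf.prob (bind_pmf M f) A) \<le> ennreal (measure_pmf.prob M (- T) + c)"
    by (simp only: measure_pmf.emeasure_eq_measure)
  then show ?thesis using assms(2) by (simp only: ennreal_le_iff add_nonneg_nonneg measure_nonneg)
qed

lemma prob_bind_le:
  assumes "\<And>x. x \<in> set_pmf M \<Longrightarrow> measure_pmf.prob (f x) A \<le> c"
  shows "measure_pmf.prob (bind_pmf M f) A \<le> c"
proof -
  obtain x where "x \<in> set_pmf M" using set_pmf_not_empty[of M] by blast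
  then have "0 \<le> c" using assms measure_nonneg order_trans by blast
  then show ?thesis using prob_bind_le_except[of M UNIV f A c] assms by simp
qed

lemma prob_Un_le:
  "measure_pmf.prob M (A \<union> B) \<le> measure_pmf.prob M A + measure_pmf.prob M B"
  by (rule measure_Un_le) auto

lemma prob_le_on_support:
  assumes "\<And>x. x \<in> set_pmf M \<Longrightarrow> x \<in> A \<Longrightarrow> x \<in> C"
  shows "measure_pmf.prob M A \<le> measure_pmf.prob M C"
proof -
  have "measure_pmf.prob M A = measure_pmf.prob M (A \<inter> set_pmf M)" by (simp add: measure_Int_set_pmf)
  also have "\<dots> \<le> measure_pmf.prob M C" by (rule measure_pmf.finite_measure_mono) (use assms in auto)
  finally show ?thesis .
qed

lemma prob_count_ge_le:
  fixes t c :: real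
  assumes "finite I" "t > 0" "\<And>i. i \<in> I \<Longrightarrow> measure_pmf.prob M {x. Q i x} \<le> c"
  shows "measure_pmf.prob M {x. t \<le> card {i\<in>I. Q i x}} \<le> card I * c / t"
proof -
  let ?X = "\<lambda>x. real (card {i\<in>I. Q i x})"
  have Xsum: "?X x = (\<Sum>i\<in>I. indicat_real {x. Q i x} x)" for x
  proof -
    have "{i\<in>I. Q i x} = I \<inter> {i. Q i x}" by auto
    then show ?thesis using assms(1) by (simp add: indicator_def sum.If_cases)
  qed
  have int: "integrable M (\<lambda>x. indicat_real {x. Q i x} x)" for i
    by (intro measure_pmf.integrable_const_bound[where B=1]) auto
  have "measure_pmf.prob M {x \<in> space M. t \<le> ?X x} \<le> measure_pmf.expectation M ?X / t"
    by (rule integral_Markov_inequality_measure[where A="{}"])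
       (use assms in \<open>auto simp: Xsum intro!: Bochner_Integration.integrable_sum int sum_nonneg\<close>)
  also have "measure_pmf.expectation M ?X = (\<Sum>i\<in>I. measure_pmf.prob M {x. Q i x})"
    unfolding Xsum by (subst Bochner_Integration.integral_sum) (auto intro: int)
  also have "\<dots> \<le> (\<Sum>i\<in>I. c)" by (rule sum_mono) (use assms in auto)
  finally show ?thesis using assms by (simp add: divide_right_mono)
qed

lemma prob_union_subsets_le:
  assumes "\<And>S. S \<subseteq> {1..n} \<Longrightarrow> measure_pmf.prob M {x. Q S x} \<le> c"
  shows "measure_pmf.prob M {x. \<exists>S\<subseteq>{1..n}. Q S x} \<le> 2 ^ n * c"
proof -
  have "{x. \<exists>S\<subseteq>{1..n}. Q S x} = (\<Union>S\<in>Pow {1..n}. {x. Q S x})" by auto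
  also have "measure_pmf.prob M \<dots> \<le> (\<Sum>S\<in>Pow {1..n}. measure_pmf.prob M {x. Q S x})"
    by (rule measure_pmf.finite_measure_subadditive_finite) auto
  also have "\<dots> \<le> (\<Sum>S\<in>Pow {1..n}. c)" by (rule sum_mono) (use assms in auto)
  finally show ?thesis by (simp add: card_Pow)
qed

lemma one_minus_power_le_exp: "0 \<le> p \<Longrightarrow> p \<le> 1 \<Longrightarrow> (1 - p) ^ k \<le> exp (- (p * real k))" for p :: real
proof -
  assume "0 \<le> p" "p \<le> 1"
  then have "(1 - p) ^ k \<le> exp (- p) ^ k" using exp_ge_add_one_self[of "- p"] by (intro power_mono) auto
  then show ?thesis by (simp add: exp_of_nat_mult[symmetric] mult.commute)
qed

lemma exp_minus_le_inverse: "y > 0 \<Longrightarrow> exp (- y) \<le> 1 / y" for y :: real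
  using exp_ge_add_one_self[of y] by (simp add: exp_minus field_simps del: exp_ge_add_one_self)

lemma exp_minus_le_inverse_square: "y > 0 \<Longrightarrow> exp (- y) \<le> 2 / y\<^sup>2" for y :: real
  using exp_lower_Taylor_quadratic[of y] by (simp add: exp_minus field_simps)

lemma exp_minus_two_power: "2 ^ n * exp (- (2 * real n)) \<le> 1 / 2 ^ n"
proof -
  have e: "exp (- 2) \<le> (1 / 4 :: real)"
    using exp_lower_Taylor_quadratic[of 2] by (simp add: exp_minus field_simps)
  have "exp (- (2 * real n)) = exp (- 2) ^ n" by (simp add: exp_of_nat_mult[symmetric] mult.commute)
  also have "\<dots> \<le> (1 / 4) ^ n" using e by (intro power_mono) auto
  finally have "2 ^ n * exp (- (2 * real n)) \<le> 2 ^ n * (1 / 4) ^ n" by (intro mult_left_mono) auto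
  also have "\<dots> = 1 / 2 ^ n" by (simp add: power_mult_distrib[symmetric] power_one_over[symmetric])
  finally show ?thesis .
qed

section \<open>Bernoulli percolation of a finite edge set\<close>

lemma finite_simple_graph: 
  assumes "E \<in> simple_graphs n"
  shows "finite E"
proof (rule finite_subset)
  show "E \<subseteq> Pow {1..n}" using assms unfolding simple_graphs_def by blast
qed simp

lemma finite_simple_graphs: "finite (simple_graphs n)"
  unfolding simple_graphs_def by (auto intro!: finite_subset[of _ "Pow {1..n}"])

lemma finite_graphs_with_degrees: "finite (graphs_with_degrees n D)"
  unfolding graphs_with_degrees_def using finite_simple_graphs by auto

lemma pmf_percolate:
  assumes "finite E" "0 \<le> p" "p \<le> 1"
  shows "pmf (percolate p E) H = (if H \<subseteq> E then p ^ card H * (1 - p) ^ card (E - H) else 0)"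
proof (cases "H \<subseteq> E")
  case True
  let ?P = "Pi_pmf E False (\<lambda>_. bernoulli_pmf p)"
  have "pmf (percolate p E) H = measure_pmf.prob ?P {keep. {e \<in> E. keep e} = H}"
    unfolding percolate_def pmf_map by (simp add: vimage_def)
  also have "\<dots> = measure_pmf.prob ?P {\<lambda>e. e \<in> H}"
  proof (intro measure_prob_cong_0)
    fix f assume f: "f \<in> {keep. {e \<in> E. keep e} = H} - {\<lambda>e. e \<in> H}"
    then have "\<exists>x. x \<notin> E \<and> f x" by auto
    then show "pmf ?P f = 0" using assms by (auto intro: pmf_Pi_outside)
  qed (use True in auto)
  also have "\<dots> = (\<Prod>e\<in>E. if e \<in> H then p else 1 - p)"
    using assms True by (auto simp: measure_pmf_single pmf_Pi intro!: prod.cong)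
  also have "\<dots> = p ^ card H * (1 - p) ^ card (E - H)"
  proof -
    have "E \<inter> {e. e \<in> H} = H" "E \<inter> - {e. e \<in> H} = E - H" using True by auto
    then show ?thesis using assms by (simp add: prod.If_cases)
  qed
  finally show ?thesis using True by simp
next
  case False
  then have "H \<notin> set_pmf (percolate p E)" unfolding percolate_def by auto
  then show ?thesis using False by (simp add: set_pmf_iff)
qed

lemma set_percolate: "H \<in> set_pmf (percolate p E) \<Longrightarrow> H \<subseteq> E"
  unfolding percolate_def by auto

lemma prob_percolate_avoid:
  assumes "finite E" "F \<subseteq> E" "0 \<le> p" "p \<le> 1"
  shows "measure_pmf.prob (percolate p E) {H. H \<inter> F = {}} = (1 - p) ^ card F"
proof -
  let ?P = "Pi_pmf E False (\<lambda>_. bernoulli_pmf p)"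
  have eq: "{keep. {e \<in> E. keep e} \<inter> F = {}} = Pi E (\<lambda>e. if e \<in> F then {False} else UNIV)"
    using assms by (auto simp: Pi_def)
  have "measure_pmf.prob (percolate p E) {H. H \<inter> F = {}} = measure_pmf.prob ?P {keep. {e \<in> E. keep e} \<inter> F = {}}"
    unfolding percolate_def by (simp add: vimage_def)
  also have "\<dots> = (\<Prod>e\<in>E. measure_pmf.prob (bernoulli_pmf p) (if e \<in> F then {False} else UNIV))"
    unfolding eq using assms by (subst measure_Pi_pmf_Pi) auto
  also have "\<dots> = (\<Prod>e\<in>E. if e \<in> F then 1 - p else 1)"
    using assms by (intro prod.cong) (auto simp: measure_pmf_single)
  also have "\<dots> = (1 - p) ^ card F"
    using assms by (subst prod.If_cases) (auto simp: Int_absorb1)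
  finally show ?thesis .
qed

lemma percolate_disjoint_union:
  assumes "finite A" "finite B" "A \<inter> B = {}"
  shows "percolate p (A \<union> B) = map_pmf (\<lambda>(H, K). H \<union> K) (pair_pmf (percolate p A) (percolate p B))"
  unfolding percolate_def Pi_pmf_union[OF assms] map_pmf_comp map_pair[symmetric]
  by (rule map_pmf_cong) (use assms in \<open>auto split: if_splits\<close>)

text \<open>
  The event that all of \<open>F\<close> is lost splits according to whether \<open>e\<close> is kept or lost, and
  losing \<open>insert e F\<close> is again an event of the same kind.
\<close>

lemma prob_percolate_keep_avoid:
  assumes "finite E" "F \<subseteq> E" "e \<in> E" "e \<notin> F" "0 \<le> p" "p \<le> 1"
  shows "measure_pmf.prob (percolate p E) {H. e \<in> H \<and> H \<inter> F = {}} = p * (1 - p) ^ card F"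
proof -
  have "finite F" using assms finite_subset by auto
  have insF: "insert e F \<subseteq> E" using assms by auto
  have "{H. H \<inter> F = {}} = {H. e \<in> H \<and> H \<inter> F = {}} \<union> {H. H \<inter> insert e F = {}}" by auto
  then have "measure_pmf.prob (percolate p E) {H. H \<inter> F = {}}
     = measure_pmf.prob (percolate p E) {H. e \<in> H \<and> H \<inter> F = {}}
       + measure_pmf.prob (percolate p E) {H. H \<inter> insert e F = {}}"
    by (simp only:) (intro measure_pmf.finite_measure_Union; auto)
  then have "measure_pmf.prob (percolate p E) {H. e \<in> H \<and> H \<inter> F = {}} = (1 - p) ^ card F - (1 - p) ^ card (insert e F)"
    using prob_percolate_avoid[of E F p, OF assms(1,2,5,6)]
      prob_percolate_avoid[of E "insert e F" p, OF assms(1) insF assms(5,6)]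
    by linarith
  then show ?thesis using assms \<open>finite F\<close> by (simp add: algebra_simps)
qed

text \<open>
  Chebyshev's inequality: the events that \<open>F i\<close> and that \<open>F j\<close> are lost completely are independent
  when \<open>F i\<close> and \<open>F j\<close> are disjoint, so only the intersecting pairs contribute to the variance, each
  at most 1.
\<close>

lemma percolate_avoiding_count_concentrated:
  assumes "finite E" "0 \<le> p" "p \<le> 1" "finite I" "\<And>i. i \<in> I \<Longrightarrow> F i \<subseteq> E" "t > 0"
  shows "measure_pmf.prob (percolate p E)
           {H. \<bar>real (card {i\<in>I. H \<inter> F i = {}}) - (\<Sum>i\<in>I. (1 - p) ^ card (F i))\<bar> \<ge> t}
         \<le> real (card {(i, j) \<in> I \<times> I. F i \<inter> F j \<noteq> {}}) / t\<^sup>2"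
proof -
  let ?M = "percolate p E"
  define a where "a i = (1 - p) ^ card (F i)" for i
  define \<mu> where "\<mu> = (\<Sum>i\<in>I. a i)"
  define X where "X H = (\<Sum>i\<in>I. indicat_real {H. H \<inter> F i = {}} H)" for H
  have finF: "finite (F i)" if "i \<in> I" for i using assms that finite_subset by blast
  have Xcard: "real (card {i\<in>I. H \<inter> F i = {}}) = X H" for H
  proof -
    have "{i\<in>I. H \<inter> F i = {}} = I \<inter> {i. H \<inter> F i = {}}" by auto
    then show ?thesis using assms by (simp add: X_def indicator_def sum.If_cases)
  qed
  have Xb: "0 \<le> X H \<and> X H \<le> card I" for H
    unfolding Xcard[symmetric] using assms by (auto intro!: card_mono)
  have int: "integrable ?M f" if "\<And>H. \<bar>f H\<bar> \<le> B" for f :: "_ \<Rightarrow> real" and B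
    using that by (intro measure_pmf.integrable_const_bound[where B=B]) auto
  have EX: "measure_pmf.expectation ?M X = \<mu>"
    unfolding X_def \<mu>_def a_def using assms
    by (subst Bochner_Integration.integral_sum) (auto simp: prob_percolate_avoid intro!: int[where B=1])
  \<comment> \<open>The joint probability factorises when the two sets are disjoint.\<close>
  have both: "measure_pmf.prob ?M {H. H \<inter> F i = {} \<and> H \<inter> F j = {}} = (1 - p) ^ card (F i \<union> F j)" if "i \<in> I" "j \<in> I" for i j
  proof -
    have "{H. H \<inter> F i = {} \<and> H \<inter> F j = {}} = {H. H \<inter> (F i \<union> F j) = {}}" by auto
    then show ?thesis using assms that by (simp only:) (intro prob_percolate_avoid; auto)
  qed
  have X2: "(X H)\<^sup>2 = (\<Sum>i\<in>I. \<Sum>j\<in>I. indicat_real {H. H \<inter> F i = {} \<and> H \<inter> F j = {}} H)" for H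
    unfolding X_def power2_eq_square sum_product by (intro sum.cong refl) (auto simp: indicator_def)
  have "measure_pmf.expectation ?M (\<lambda>H. (X H)\<^sup>2) = (\<Sum>i\<in>I. \<Sum>j\<in>I. (1 - p) ^ card (F i \<union> F j))"
    unfolding X2
    by (subst Bochner_Integration.integral_sum, (intro Bochner_Integration.integrable_sum int[where B=1]; simp),
        intro sum.cong refl, subst Bochner_Integration.integral_sum, (intro int[where B=1]; simp), simp add: both)
  also have "\<dots> - \<mu>\<^sup>2 = (\<Sum>i\<in>I. \<Sum>j\<in>I. (1 - p) ^ card (F i \<union> F j) - a i * a j)"
    unfolding \<mu>_def power2_eq_square sum_product by (simp add: sum_subtractf)
  also have "\<dots> \<le> (\<Sum>i\<in>I. \<Sum>j\<in>I. if F i \<inter> F j \<noteq> {} then 1 else 0)"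
  proof (intro sum_mono)
    fix i j assume ij: "i \<in> I" "j \<in> I"
    have "(1 - p) ^ card (F i \<union> F j) \<le> 1" "0 \<le> a i * a j"
      using assms by (auto intro!: power_le_one simp: a_def)
    moreover have "(1 - p) ^ card (F i \<union> F j) = a i * a j" if "F i \<inter> F j = {}"
      using card_Un_disjoint[OF finF finF that] ij by (simp add: a_def power_add)
    ultimately show "(1 - p) ^ card (F i \<union> F j) - a i * a j \<le> (if F i \<inter> F j \<noteq> {} then 1 else 0)" by auto
  qed
  also have "\<dots> = real (card {(i, j) \<in> I \<times> I. F i \<inter> F j \<noteq> {}})"
  proof -
    have "(\<Sum>i\<in>I. \<Sum>j\<in>I. if F i \<inter> F j \<noteq> {} then 1 else (0::real)) = (\<Sum>z\<in>I \<times> I. if F (fst z) \<inter> F (snd z) \<noteq> {} then 1 else 0)"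
      by (simp add: sum.cartesian_product case_prod_beta)
    also have "\<dots> = card ((I \<times> I) \<inter> {z. F (fst z) \<inter> F (snd z) \<noteq> {}})"
      using assms by (subst sum.If_cases) auto
    also have "(I \<times> I) \<inter> {z. F (fst z) \<inter> F (snd z) \<noteq> {}} = {(i, j) \<in> I \<times> I. F i \<inter> F j \<noteq> {}}" by auto
    finally show ?thesis .
  qed
  finally have V: "measure_pmf.expectation ?M (\<lambda>H. (X H)\<^sup>2) - \<mu>\<^sup>2 \<le> real (card {(i, j) \<in> I \<times> I. F i \<inter> F j \<noteq> {}})" .
  have b2: "\<bar>(X H)\<^sup>2\<bar> \<le> (real (card I))\<^sup>2" for H using Xb[of H] by (auto intro!: power_mono)
  have "integrable ?M X" "integrable ?M (\<lambda>H. (X H)\<^sup>2)"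
    using Xb by (intro int[where B="card I"]; simp) (intro int[where B="(real (card I))\<^sup>2"] b2)
  then have "measure_pmf.variance ?M X = measure_pmf.expectation ?M (\<lambda>H. (X H)\<^sup>2) - \<mu>\<^sup>2"
    using EX by (subst measure_pmf.variance_eq) auto
  moreover have "measure_pmf.prob ?M {H \<in> space ?M. t \<le> \<bar>X H - measure_pmf.expectation ?M X\<bar>} \<le> measure_pmf.variance ?M X / t\<^sup>2"
    using assms \<open>integrable ?M (\<lambda>H. (X H)\<^sup>2)\<close> by (intro measure_pmf.Chebyshev_inequality) auto
  ultimately show ?thesis
    using divide_right_mono[OF V, of "t\<^sup>2"] unfolding EX \<mu>_def a_def Xcard by auto
qed

section \<open>Switchings and edge cuts\<close>

text \<open>
  Each configuration \<open>s\<close> can be modified by any move in \<open>L s\<close>. A modified configuration \<open>r\<close> keeps the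
  weight, and together with the move, which lies in \<open>R r\<close>, it determines \<open>s\<close>. Bounding the two numbers
  of moves therefore compares the total weights of \<open>A\<close> and \<open>B\<close>.
\<close>

lemma weighted_double_counting:
  fixes w :: "'s \<Rightarrow> real" and w' :: "'t \<Rightarrow> real"
  assumes "finite A" "finite B"
    and finL: "\<And>s. s \<in> A \<Longrightarrow> finite (L s)" and finR: "\<And>r. r \<in> B \<Longrightarrow> finite (R r)"
    and pos: "\<And>r. r \<in> B \<Longrightarrow> 0 \<le> w' r"
    and f: "\<And>s t. s \<in> A \<Longrightarrow> t \<in> L s \<Longrightarrow> f s t \<in> B \<and> t \<in> R (f s t) \<and> w' (f s t) = w s"
    and inj: "\<And>s s' t. s \<in> A \<Longrightarrow> s' \<in> A \<Longrightarrow> t \<in> L s \<Longrightarrow> t \<in> L s' \<Longrightarrow> f s t = f s' t \<Longrightarrow> s = s'"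
  shows "(\<Sum>s\<in>A. w s * card (L s)) \<le> (\<Sum>r\<in>B. w' r * card (R r))"
proof -
  have "(\<Sum>s\<in>A. w s * card (L s)) = (\<Sum>s\<in>A. \<Sum>t\<in>L s. w s)" by (simp add: mult.commute)
  also have "\<dots> = (\<Sum>(s, t)\<in>Sigma A L. w s)"
    using assms by (subst sum.Sigma) auto
  also have "\<dots> = (\<Sum>(s, t)\<in>Sigma A L. w' (f s t))"
    by (rule sum.cong) (use f in auto)
  also have "\<dots> = (\<Sum>(r, t)\<in>(\<lambda>(s, t). (f s t, t)) ` Sigma A L. w' r)"
    by (subst sum.reindex) (use inj in \<open>auto simp: inj_on_def o_def case_prod_beta\<close>)
  also have "\<dots> \<le> (\<Sum>(r, t)\<in>Sigma B R. w' r)"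
    by (rule sum_mono2) (use f assms in \<open>auto intro: finite_SigmaI\<close>)
  also have "\<dots> = (\<Sum>r\<in>B. \<Sum>t\<in>R r. w' r)"
    using assms by (subst sum.Sigma) auto
  also have "\<dots> = (\<Sum>r\<in>B. w' r * card (R r))" by (simp add: mult.commute)
  finally show ?thesis .
qed

definition neighbours :: "nat set set \<Rightarrow> nat \<Rightarrow> nat set" where
  "neighbours E v = {w. {v, w} \<in> E}"

text \<open>
  A crossing edge is recorded as the pair of its ends, with the end in \<open>S\<close> first, so that counting
  edges and counting oriented choices agree.
\<close>

definition cut :: "nat set set \<Rightarrow> nat set \<Rightarrow> (nat \<times> nat) set" where
  "cut E S = {(u, w). u \<in> S \<and> w \<notin> S \<and> {u, w} \<in> E}"

definition switch :: "nat set set \<Rightarrow> nat \<Rightarrow> nat \<Rightarrow> nat \<Rightarrow> nat \<Rightarrow> nat set set" where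
  "switch E a b x y = (E - {{a, b}, {x, y}}) \<union> {{a, y}, {b, x}}"

lemma simple_graph_edgeD:
  assumes "E \<in> simple_graphs n" "{u, w} \<in> E"
  shows "u \<in> {1..n}" "w \<in> {1..n}" "u \<noteq> w"
proof -
  have "{u, w} \<subseteq> {1..n} \<and> card {u, w} = 2" using assms unfolding simple_graphs_def by blast
  then show "u \<in> {1..n}" "w \<in> {1..n}" "u \<noteq> w" by (auto simp: card_insert_if split: if_splits)
qed

lemma simple_graph_edge_ex:
  assumes "E \<in> simple_graphs n" "e \<in> E"
  shows "\<exists>u w. e = {u, w} \<and> u \<noteq> w"
proof -
  have "card e = 2" using assms unfolding simple_graphs_def by blast
  then show ?thesis by (auto simp: card_2_iff)
qed

lemma neighbours_subset: "E \<in> simple_graphs n \<Longrightarrow> neighbours E v \<subseteq> {1..n}"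
  unfolding neighbours_def by (auto dest: simple_graph_edgeD(2))

lemma finite_neighbours: "E \<in> simple_graphs n \<Longrightarrow> finite (neighbours E v)"
  by (rule finite_subset[OF neighbours_subset]) auto

lemma star_eq_image_neighbours:
  assumes "E \<in> simple_graphs n"
  shows "{e \<in> E. v \<in> e} = (\<lambda>w. {v, w}) ` neighbours E v"
proof -
  have "e \<in> (\<lambda>w. {v, w}) ` neighbours E v" if e: "e \<in> E" "v \<in> e" for e
  proof -
    obtain u w where uw: "e = {u, w}" using simple_graph_edge_ex[OF assms e(1)] by blast
    then consider "e = {v, u}" | "e = {v, w}" using e(2) by blast
    then show ?thesis
      by cases (use e(1) in \<open>auto simp: neighbours_def\<close>)
  qed
  moreover have "(\<lambda>w. {v, w}) ` neighbours E v \<subseteq> {e \<in> E. v \<in> e}"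
    by (auto simp: neighbours_def)
  ultimately show ?thesis by blast
qed

lemma inj_on_pair: "inj_on (\<lambda>w. {v, w}) A"
  by (auto simp: inj_on_def doubleton_eq_iff)

lemma vertex_degree_eq: "E \<in> simple_graphs n \<Longrightarrow> vertex_degree E v = card (neighbours E v)"
  unfolding vertex_degree_def by (simp add: star_eq_image_neighbours card_image inj_on_pair)

lemma simple_graphs_subset: "H \<subseteq> E \<Longrightarrow> E \<in> simple_graphs n \<Longrightarrow> H \<in> simple_graphs n"
  unfolding simple_graphs_def by auto

lemma graphs_with_degreesD:
  assumes "E \<in> graphs_with_degrees n D"
  shows "E \<in> simple_graphs n" "v \<in> {1..n} \<Longrightarrow> card (neighbours E v) = D v"
  using assms vertex_degree_eq unfolding graphs_with_degrees_def by auto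

lemma cut_subset: "E \<in> simple_graphs n \<Longrightarrow> cut E S \<subseteq> {1..n} \<times> {1..n}"
  unfolding cut_def by (auto dest: simple_graph_edgeD(1,2))

lemma finite_cut: "E \<in> simple_graphs n \<Longrightarrow> finite (cut E S)"
  by (rule finite_subset[OF cut_subset]) auto

lemma card_cut_edges: "card ((\<lambda>(u, w). {u, w}) ` cut E S) = card (cut E S)"
  by (rule card_image) (auto simp: inj_on_def cut_def doubleton_eq_iff)

lemma switch_inverse:
  assumes "{a, b} \<in> E" "{x, y} \<in> E" "{a, y} \<notin> E" "{b, x} \<notin> E"
  shows "switch (switch E a b x y) a y x b = E"
  using assms unfolding switch_def by (auto simp: insert_commute)

lemma card_insert_swap:
  assumes "finite X" "e \<in> X" "f \<notin> X"
  shows "card (insert f (X - {e})) = card X"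
proof -
  have "card (insert f (X - {e})) = Suc (card (X - {e}))" using assms by (intro card_insert_disjoint) auto
  also have "\<dots> = card X" using assms by (intro card_Suc_Diff1) auto
  finally show ?thesis .
qed

lemma vertex_degree_switch:
  assumes fin: "finite E" and e: "{a, b} \<in> E" "{a, y} \<notin> E" and ne: "a \<noteq> b" "a \<noteq> x" "a \<noteq> y"
  shows "vertex_degree (switch E a b x y) a = vertex_degree E a"
proof -
  let ?X = "{e \<in> E. a \<in> e}"
  have "a \<notin> {x, y}" "a \<notin> {b, x}" using ne by auto
  then have "{e \<in> switch E a b x y. a \<in> e} = insert {a, y} (?X - {{a, b}})"
    unfolding switch_def by blast
  moreover have "card (insert {a, y} (?X - {{a, b}})) = card ?X"
    by (rule card_insert_swap) (use e fin in auto)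
  ultimately show ?thesis unfolding vertex_degree_def by simp
qed

lemma switch_graphs_with_degrees:
  assumes E: "E \<in> graphs_with_degrees n D" and e: "{a, b} \<in> E" "{x, y} \<in> E" "{a, y} \<notin> E" "{b, x} \<notin> E"
    and ne: "a \<noteq> x" "a \<noteq> y" "b \<noteq> x" "b \<noteq> y"
  shows "switch E a b x y \<in> graphs_with_degrees n D"
proof -
  have S: "E \<in> simple_graphs n" using E graphs_with_degreesD by auto
  have fin: "finite E" using finite_simple_graph S by auto
  note V = simple_graph_edgeD[OF S e(1)] simple_graph_edgeD[OF S e(2)]
  have "{a, y} \<subseteq> {1..n} \<and> card {a, y} = 2" "{b, x} \<subseteq> {1..n} \<and> card {b, x} = 2"
    using V ne by auto
  then have S': "switch E a b x y \<in> simple_graphs n"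
    using S unfolding switch_def simple_graphs_def by blast
  \<comment> \<open>The switching looks the same from each of its four vertices, so one of them suffices.\<close>
  have sym: "switch E b a y x = switch E a b x y" "switch E x y a b = switch E a b x y"
    "switch E y x b a = switch E a b x y"
    unfolding switch_def by (simp_all add: insert_commute)
  have "vertex_degree (switch E a b x y) z = vertex_degree E z" for z
  proof (cases "z \<in> {a, b, x, y}")
    case True
    have "{b, a} \<in> E" "{y, x} \<in> E" "{y, a} \<notin> E" "{x, b} \<notin> E" using e by (simp_all add: insert_commute)
    then have "vertex_degree (switch E a b x y) a = vertex_degree E a"
      "vertex_degree (switch E b a y x) b = vertex_degree E b"
      "vertex_degree (switch E x y a b) x = vertex_degree E x"
      "vertex_degree (switch E y x b a) y = vertex_degree E y"
      using ne V e by (auto intro!: vertex_degree_switch[OF fin])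
    then show ?thesis using True unfolding sym by auto
  next
    case False
    then have "{e \<in> switch E a b x y. z \<in> e} = {e \<in> E. z \<in> e}" unfolding switch_def by auto
    then show ?thesis unfolding vertex_degree_def by simp
  qed
  then show ?thesis using S' E unfolding graphs_with_degrees_def by auto
qed

lemma cut_switch:
  assumes "u \<in> S" "v \<in> S" "x \<notin> S" "y \<notin> S"
  shows "cut (switch E u v x y) S = cut E S \<union> {(u, y), (v, x)}"
  using assms unfolding cut_def switch_def by (auto simp: doubleton_eq_iff)

lemma threshold_times_card_le_sum:
  assumes "finite U" "\<And>u. u \<in> U \<Longrightarrow> finite (N u)" "\<And>u. u \<in> U \<Longrightarrow> r < real (card (N u))"
    "(\<Sum>u\<in>U. card (N u)) \<le> k"
  shows "r * card U \<le> k"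
proof -
  have "r * card U = (\<Sum>u\<in>U. r)" by simp
  also have "\<dots> \<le> (\<Sum>u\<in>U. real (card (N u)))" by (rule sum_mono) (use assms in force)
  also have "\<dots> \<le> k" using assms(4) by (metis of_nat_le_iff of_nat_sum)
  finally show ?thesis .
qed

text \<open>
  Every crossing edge is seen once from each of its two sides.
\<close>

lemma sum_card_crossing_le:
  assumes E: "E \<in> simple_graphs n" and U: "finite U"
  shows "U \<subseteq> S \<Longrightarrow> (\<Sum>u\<in>U. card (neighbours E u - S)) \<le> card (cut E S)"
    and "U \<inter> S = {} \<Longrightarrow> (\<Sum>u\<in>U. card (neighbours E u \<inter> S)) \<le> card (cut E S)"
proof -
  note fN = finite_neighbours[OF E]
  assume "U \<subseteq> S"
  have "(\<Sum>u\<in>U. card (neighbours E u - S)) = card (Sigma U (\<lambda>u. neighbours E u - S))"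
    using U fN by (subst card_SigmaI) auto
  also have "\<dots> \<le> card (cut E S)"
    by (rule card_mono[OF finite_cut[OF E]]) (use \<open>U \<subseteq> S\<close> in \<open>auto simp: cut_def neighbours_def\<close>)
  finally show "(\<Sum>u\<in>U. card (neighbours E u - S)) \<le> card (cut E S)" .
next
  note fN = finite_neighbours[OF E]
  assume "U \<inter> S = {}"
  have "(\<Sum>u\<in>U. card (neighbours E u \<inter> S)) = card (Sigma U (\<lambda>u. neighbours E u \<inter> S))"
    using U fN by (subst card_SigmaI) auto
  also have "\<dots> \<le> card (prod.swap ` cut E S)"
    by (rule card_mono) (use \<open>U \<inter> S = {}\<close> finite_cut[OF E] in \<open>auto simp: cut_def neighbours_def insert_commute image_iff\<close>)
  also have "\<dots> = card (cut E S)" by (rule card_image) auto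
  finally show "(\<Sum>u\<in>U. card (neighbours E u \<inter> S)) \<le> card (cut E S)" .
qed

lemma card_le_three_cover:
  assumes "A \<subseteq> X \<union> Y \<union> Z" "finite X" "finite Y" "finite Z"
  shows "card A \<le> card X + card Y + card Z"
proof -
  have "card A \<le> card (X \<union> Y \<union> Z)" using assms by (intro card_mono) auto
  also have "\<dots> \<le> card (X \<union> Y) + card Z" by (rule card_Un_le)
  also have "card (X \<union> Y) \<le> card X + card Y" by (rule card_Un_le)
  finally show ?thesis by simp
qed

text \<open>
  If few edges cross the cut \<open>S\<close>, at least half of the vertices \<open>u\<close> of \<open>B\<close> inside \<open>S\<close> and at least
  half of the vertices \<open>x\<close> of \<open>B\<close> outside \<open>S\<close> have at most \<open>d0 / 4\<close> crossing edges. For such a pair,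
  at least \<open>d0 / 2\<close> neighbours \<open>v\<close> of \<open>u\<close> lie in \<open>S\<close> and are not adjacent to \<open>x\<close>, and symmetrically
  for the neighbours \<open>y\<close> of \<open>x\<close>. Each choice allows a switching \<open>uv, xy\<close> to \<open>uy, vx\<close>, which makes
  at least \<open>(s * d0 / 4)\<^sup>2\<close> switchings; undoing one means to point at two of the \<open>k + 2\<close> crossing edges.
  Choosing \<open>u\<close> and \<open>x\<close> first keeps vertices of very large degree from spoiling the count.
\<close>

lemma cut_switching_ratio:
  fixes s d0 :: real and n k :: nat and D :: "nat \<Rightarrow> nat" and S :: "nat set"
  defines "C \<equiv> \<lambda>k. {E \<in> graphs_with_degrees n D. card (cut E S) = k}"
  assumes B: "B \<subseteq> {1..n}" "\<And>v. v \<in> B \<Longrightarrow> d0 \<le> real (D v)"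
    and s: "s > 0" "d0 > 0" "s \<le> card (B \<inter> S)" "s \<le> card (B - S)"
    and k: "real (k + 2) \<le> s * d0 / 8"
  shows "4 * card (C k) \<le> card (C (k + 2))"
proof -
  define U where "U E = {u \<in> B \<inter> S. real (card (neighbours E u - S)) \<le> d0 / 4}" for E
  define X where "X E = {x \<in> B - S. real (card (neighbours E x \<inter> S)) \<le> d0 / 4}" for E
  define L where "L E = Sigma (U E \<times> X E) (\<lambda>(u, x). ((neighbours E u \<inter> S) - neighbours E x) \<times> (neighbours E x - S - neighbours E u))" for E
  define R where "R E = {((u, x), (v, y)). (u, y) \<in> cut E S \<and> (v, x) \<in> cut E S}" for E
  define f where "f = (\<lambda>E ((u, x), (v, y)). switch E u v x y)"
  have finB: "finite B" using B finite_subset by auto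
  have finC: "finite (C k)" for k unfolding C_def using finite_graphs_with_degrees by auto
  have simple: "E \<in> simple_graphs n" if "E \<in> C k" for E k
    using that graphs_with_degreesD unfolding C_def by auto
  have cardR: "card (R E) = (k + 2)\<^sup>2 \<and> finite (R E)" if "E \<in> C (k + 2)" for E
  proof -
    have "R E = (\<lambda>((u, y), (v, x)). ((u, x), (v, y))) ` (cut E S \<times> cut E S)"
      unfolding R_def by force
    moreover have "inj_on (\<lambda>((u, y), (v, x)). ((u, x), (v, y))) (cut E S \<times> cut E S)"
      by (auto simp: inj_on_def)
    ultimately show ?thesis
      using that finite_cut[OF simple[OF that]] unfolding C_def
      by (simp add: card_image card_cartesian_product power2_eq_square)
  qed
  have cardL: "4 * real ((k + 2)\<^sup>2) \<le> real (card (L E)) \<and> finite (L E)" if E: "E \<in> C k" for E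
  proof -
    note sE = simple[OF E] and fN = finite_neighbours[OF simple[OF E]]
    have ck: "card (cut E S) = k" using E unfolding C_def by auto
    have "d0 / 4 * card (B \<inter> S - U E) \<le> k"
      using sum_card_crossing_le(1)[OF sE, of "B \<inter> S - U E" S] finB ck
      by (intro threshold_times_card_le_sum[where N="\<lambda>u. neighbours E u - S"]) (auto simp: U_def fN)
    also have "\<dots> \<le> d0 / 4 * (s / 2)" using k by (simp add: mult.commute)
    finally have "real (card (B \<inter> S - U E)) \<le> s / 2" using s by simp
    moreover have "real (card (B \<inter> S)) = card (U E) + card (B \<inter> S - U E)"
    proof -
      have "B \<inter> S = U E \<union> (B \<inter> S - U E)" unfolding U_def by auto
      moreover have "card (U E \<union> (B \<inter> S - U E)) = card (U E) + card (B \<inter> S - U E)"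
        using finB by (intro card_Un_disjoint) (auto simp: U_def)
      ultimately show ?thesis by simp
    qed
    ultimately have cU: "s / 2 \<le> card (U E)" using s by linarith
    have "d0 / 4 * card (B - S - X E) \<le> k"
      using sum_card_crossing_le(2)[OF sE, of "B - S - X E" S] finB ck
      by (intro threshold_times_card_le_sum[where N="\<lambda>u. neighbours E u \<inter> S"]) (auto simp: X_def fN)
    also have "\<dots> \<le> d0 / 4 * (s / 2)" using k by (simp add: mult.commute)
    finally have "real (card (B - S - X E)) \<le> s / 2" using s by simp
    moreover have "real (card (B - S)) = card (X E) + card (B - S - X E)"
    proof -
      have "B - S = X E \<union> (B - S - X E)" unfolding X_def by auto
      moreover have "card (X E \<union> (B - S - X E)) = card (X E) + card (B - S - X E)"
        using finB by (intro card_Un_disjoint) (auto simp: X_def)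
      ultimately show ?thesis by simp
    qed
    ultimately have cX: "s / 2 \<le> card (X E)" using s by linarith
    have half: "(d0 / 2)\<^sup>2 \<le> real (card (((neighbours E u \<inter> S) - neighbours E x) \<times> (neighbours E x - S - neighbours E u)))"
      if "u \<in> U E" "x \<in> X E" for u x
    proof -
      have "d0 \<le> card (neighbours E u)" "d0 \<le> card (neighbours E x)"
        using that B E graphs_with_degreesD(2) unfolding U_def X_def C_def by (auto simp: subset_iff)
      moreover have "card (neighbours E u) \<le> card ((neighbours E u \<inter> S) - neighbours E x) + card (neighbours E u - S) + card (neighbours E x \<inter> S)"
        by (rule card_le_three_cover) (auto simp: fN)
      moreover have "card (neighbours E x) \<le> card (neighbours E x - S - neighbours E u) + card (neighbours E x \<inter> S) + card (neighbours E u - S)"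
        by (rule card_le_three_cover) (auto simp: fN)
      ultimately have "d0 / 2 \<le> card ((neighbours E u \<inter> S) - neighbours E x)" "d0 / 2 \<le> card (neighbours E x - S - neighbours E u)"
        using that unfolding U_def X_def by auto
      then have "d0 / 2 * (d0 / 2) \<le> real (card ((neighbours E u \<inter> S) - neighbours E x)) * real (card (neighbours E x - S - neighbours E u))"
        using s by (intro mult_mono) auto
      then show ?thesis by (simp add: power2_eq_square card_cartesian_product)
    qed
    have fUX: "finite (U E \<times> X E)" using finB unfolding U_def X_def by auto
    have "real (card (L E)) = (\<Sum>(u, x)\<in>U E \<times> X E. real (card (((neighbours E u \<inter> S) - neighbours E x) \<times> (neighbours E x - S - neighbours E u))))"
      unfolding L_def using fN fUX by (subst card_SigmaI) (auto simp: case_prod_beta)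
    also have "\<dots> \<ge> (\<Sum>(u, x)\<in>U E \<times> X E. (d0 / 2)\<^sup>2)"
      by (rule sum_mono) (use half in auto)
    finally have "real (card (L E)) \<ge> real (card (U E)) * real (card (X E)) * (d0 / 2)\<^sup>2"
      by (simp add: case_prod_beta card_cartesian_product)
    moreover have "s / 2 * (s / 2) * (d0 / 2)\<^sup>2 \<le> real (card (U E)) * real (card (X E)) * (d0 / 2)\<^sup>2"
      using cU cX s by (intro mult_mono) auto
    moreover have "4 * (real (k + 2))\<^sup>2 \<le> 4 * (s * d0 / 8)\<^sup>2"
      using k by (intro mult_left_mono power_mono) auto
    ultimately have "4 * real ((k + 2)\<^sup>2) \<le> real (card (L E))"
      by (simp add: power2_eq_square field_simps)
    moreover have "finite (L E)" unfolding L_def using fUX fN by auto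
    ultimately show ?thesis by simp
  qed
  have "(\<Sum>E\<in>C k. 1 * real (card (L E))) \<le> (\<Sum>E\<in>C (k + 2). 1 * real (card (R E)))"
  proof (rule weighted_double_counting[where f=f])
    fix E t assume E: "E \<in> C k" and t: "t \<in> L E"
    obtain u x v y where txy: "t = ((u, x), (v, y))" by (metis surj_pair)
    have i: "u \<in> S" "v \<in> S" "x \<notin> S" "y \<notin> S" "{u, v} \<in> E" "{x, y} \<in> E" "{u, y} \<notin> E" "{v, x} \<notin> E"
      using t unfolding txy L_def U_def X_def neighbours_def by (auto simp: insert_commute)
    have E': "E \<in> graphs_with_degrees n D" using E unfolding C_def by auto
    have "switch E u v x y \<in> graphs_with_degrees n D"
      by (rule switch_graphs_with_degrees[OF E']) (use i in auto)
    moreover have "u \<noteq> v" using simple_graph_edgeD(3)[OF simple[OF E] i(5)] .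
    then have "card (cut (switch E u v x y) S) = k + 2"
      using E i finite_cut[OF simple[OF E], of S] unfolding cut_switch[OF i(1-4)] C_def
      by (auto simp: cut_def)
    ultimately show "f E t \<in> C (k + 2) \<and> t \<in> R (f E t) \<and> (1::real) = 1"
      unfolding f_def txy R_def C_def by (simp add: cut_switch[OF i(1-4)])
  next
    fix E E' t assume E: "E \<in> C k" "E' \<in> C k" and t: "t \<in> L E" "t \<in> L E'" and eq: "f E t = f E' t"
    obtain u x v y where txy: "t = ((u, x), (v, y))" by (metis surj_pair)
    have "{u, v} \<in> E" "{x, y} \<in> E" "{u, y} \<notin> E" "{v, x} \<notin> E"
         "{u, v} \<in> E'" "{x, y} \<in> E'" "{u, y} \<notin> E'" "{v, x} \<notin> E'"
      using t unfolding txy L_def U_def X_def neighbours_def by (auto simp: insert_commute)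
    note i = this
    have "switch E u v x y = switch E' u v x y" using eq unfolding f_def txy by simp
    then show "E = E'"
      using switch_inverse[OF i(1-4)] switch_inverse[OF i(5-8)] by metis
  qed (use finC cardL cardR in auto)
  also have "\<dots> = real ((k + 2)\<^sup>2) * real (card (C (k + 2)))" using cardR by simp
  finally have le: "(\<Sum>E\<in>C k. real (card (L E))) \<le> real ((k + 2)\<^sup>2) * real (card (C (k + 2)))" by simp
  have "real ((k + 2)\<^sup>2) * (4 * real (card (C k))) = (\<Sum>E\<in>C k. 4 * real ((k + 2)\<^sup>2))" by simp
  also have "\<dots> \<le> (\<Sum>E\<in>C k. real (card (L E)))"
    by (rule sum_mono) (use cardL in auto)
  finally have "real ((k + 2)\<^sup>2) * (4 * real (card (C k))) \<le> real ((k + 2)\<^sup>2) * real (card (C (k + 2)))"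
    using le by linarith
  then have "4 * real (card (C k)) \<le> real (card (C (k + 2)))"
    by (rule mult_left_le_imp_le) simp
  then show ?thesis by linarith
qed

section \<open>Cuts of the percolated random graph\<close>

text \<open>
  The joint law of the random graph and its first-stage percolation. Switchings act on this pair,
  because the component structure of the percolated graph has to be preserved.
\<close>

definition percolated_graph :: "nat \<Rightarrow> (nat \<Rightarrow> nat) \<Rightarrow> real \<Rightarrow> (nat set set \<times> nat set set) pmf" where
  "percolated_graph n D p = bind_pmf (random_graph n D) (\<lambda>G. map_pmf (Pair G) (percolate p G))"

lemma set_random_graph: "feasible n D \<Longrightarrow> set_pmf (random_graph n D) = graphs_with_degrees n D"
  unfolding random_graph_def feasible_def using finite_graphs_with_degrees by simp

lemma prob_percolated_graph_le:
  assumes "feasible n D" "\<And>G. G \<in> graphs_with_degrees n D \<Longrightarrow> measure_pmf.prob (percolate p G) {H. Q G H} \<le> c"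
  shows "measure_pmf.prob (percolated_graph n D p) {(G, H). Q G H} \<le> c"
  unfolding percolated_graph_def
  by (rule prob_bind_le) (use assms in \<open>auto simp: set_random_graph vimage_def\<close>)

lemma prob_percolated_graph_fst:
  "measure_pmf.prob (percolated_graph n D p) {(G, H). Q G} = measure_pmf.prob (random_graph n D) {G. Q G}"
proof -
  have "map_pmf fst (percolated_graph n D p) = random_graph n D"
    unfolding percolated_graph_def by (simp add: map_bind_pmf map_pmf_comp bind_return_pmf')
  then have "measure_pmf.prob (random_graph n D) {G. Q G} = measure_pmf.prob (percolated_graph n D p) (fst -` {G. Q G})"
    by (metis measure_map_pmf)
  then show ?thesis by (simp add: vimage_def case_prod_beta')
qed

lemma prob_no_cut_edge_kept:
  assumes G: "G \<in> simple_graphs n" and p: "0 \<le> p" "p \<le> 1"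
  shows "measure_pmf.prob (percolate p G) {H. cut H S = {}} \<le> (1 - p) ^ card (cut G S)"
proof -
  let ?F = "(\<lambda>(u, w). {u, w}) ` cut G S"
  have "measure_pmf.prob (percolate p G) {H. cut H S = {}} \<le> measure_pmf.prob (percolate p G) {H. H \<inter> ?F = {}}"
    by (rule measure_pmf.finite_measure_mono) (auto simp: cut_def)
  also have "\<dots> = (1 - p) ^ card ?F"
    by (rule prob_percolate_avoid) (use assms finite_simple_graph in \<open>auto simp: cut_def\<close>)
  finally show ?thesis by (simp add: card_cut_edges)
qed

text \<open>
  Iterate the ratio \<open>j\<close> times: going from \<open>k\<close> to \<open>k + 2 * j\<close> crossing edges multiplies the number
  of graphs by at least \<open>4 ^ j\<close>.
\<close>

lemma few_cut_edges_unlikely: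
  fixes s d0 :: real and n j :: nat and D :: "nat \<Rightarrow> nat" and S :: "nat set"
  assumes feas: "feasible n D" and B: "B \<subseteq> {1..n}" "\<And>v. v \<in> B \<Longrightarrow> d0 \<le> real (D v)"
    and s: "s > 0" "d0 > 0" "s \<le> card (B \<inter> S)" "s \<le> card (B - S)"
    and j: "real (4 * j) \<le> s * d0 / 8"
  shows "measure_pmf.prob (random_graph n D) {G. card (cut G S) \<le> 2 * j} \<le> (1 / 4) ^ j"
proof -
  let ?G = "graphs_with_degrees n D"
  define C where "C k = {E \<in> ?G. card (cut E S) = k}" for k
  have finG: "finite ?G" and neG: "?G \<noteq> {}" using finite_graphs_with_degrees feas unfolding feasible_def by auto
  have chain: "4 ^ i * card (C k) \<le> card (C (k + 2 * i))" if "k \<le> 2 * j" "i \<le> j" for i k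
    using that
  proof (induction i)
    case (Suc i)
    have "k + 2 * i + 2 \<le> 4 * j" using Suc.prems by simp
    then have "real (k + 2 * i + 2) \<le> s * d0 / 8" using j by linarith
    then have "4 * card (C (k + 2 * i)) \<le> card (C (k + 2 * i + 2))"
      unfolding C_def by (intro cut_switching_ratio[where B=B]) (use B s in auto)
    then show ?case using Suc by simp
  qed simp
  have "4 ^ j * card (\<Union>k\<le>2 * j. C k) = 4 ^ j * (\<Sum>k\<le>2 * j. card (C k))"
    using finG by (subst card_UN_disjoint) (auto simp: C_def)
  also have "\<dots> \<le> (\<Sum>k\<le>2 * j. card (C (k + 2 * j)))"
    unfolding sum_distrib_left by (rule sum_mono) (use chain in auto)
  also have "\<dots> = card (\<Union>k\<le>2 * j. C (k + 2 * j))"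
    using finG by (subst card_UN_disjoint) (auto simp: C_def)
  also have "\<dots> \<le> card ?G" using finG by (intro card_mono) (auto simp: C_def)
  also have "(\<Union>k\<le>2 * j. C k) = ?G \<inter> {G. card (cut G S) \<le> 2 * j}" by (auto simp: C_def)
  finally have "4 ^ j * card (?G \<inter> {G. card (cut G S) \<le> 2 * j}) \<le> card ?G" .
  then have "real (4 ^ j * card (?G \<inter> {G. card (cut G S) \<le> 2 * j})) \<le> real (card ?G)"
    by (rule of_nat_mono)
  then show ?thesis unfolding random_graph_def using neG finG
    by (simp add: measure_pmf_of_set power_divide field_simps card_gt_0_iff)
qed

text \<open>
  A cut that splits \<open>B\<close> evenly either has at most \<open>2 * j\<close> edges in \<open>G\<close>, which is unlikely by
  switching, or loses more than \<open>2 * j\<close> edges by percolation. Both probabilities can be made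
  much smaller than \<open>2 ^ (- n)\<close> when the degrees in \<open>B\<close> are much larger than \<open>1 / p\<close>.
\<close>

lemma balanced_cuts_survive:
  fixes s d0 :: real
  assumes feas: "feasible n D" and B: "B \<subseteq> {1..n}" "\<And>v. v \<in> B \<Longrightarrow> d0 \<le> real (D v)"
    and s: "s > 0" "d0 > 0" and j: "real (4 * j) \<le> s * d0 / 8" and p: "0 \<le> p" "p \<le> 1"
  shows "measure_pmf.prob (percolated_graph n D p)
           {(G, H). \<exists>S\<subseteq>{1..n}. s \<le> card (B \<inter> S) \<and> s \<le> card (B - S) \<and> cut H S = {}}
         \<le> 2 ^ n * ((1 / 4) ^ j + (1 - p) ^ (2 * j))"
proof -
  let ?M = "percolated_graph n D p"
  have "measure_pmf.prob ?M {z. s \<le> card (B \<inter> S) \<and> s \<le> card (B - S) \<and> cut (snd z) S = {}}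
          \<le> (1 / 4) ^ j + (1 - p) ^ (2 * j)" for S
  proof (cases "s \<le> card (B \<inter> S) \<and> s \<le> card (B - S)")
    case True
    have "measure_pmf.prob ?M {z. s \<le> card (B \<inter> S) \<and> s \<le> card (B - S) \<and> cut (snd z) S = {}}
      \<le> measure_pmf.prob ?M ({(G, H). card (cut G S) \<le> 2 * j} \<union> {(G, H). 2 * j \<le> card (cut G S) \<and> cut H S = {}})"
      by (rule measure_pmf.finite_measure_mono) auto
    also have "\<dots> \<le> measure_pmf.prob ?M {(G, H). card (cut G S) \<le> 2 * j} + measure_pmf.prob ?M {(G, H). 2 * j \<le> card (cut G S) \<and> cut H S = {}}"
      by (rule prob_Un_le)
    also have "measure_pmf.prob ?M {(G, H). card (cut G S) \<le> 2 * j} \<le> (1 / 4) ^ j"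
      unfolding prob_percolated_graph_fst by (rule few_cut_edges_unlikely[OF feas B s]) (use True j in auto)
    also have "measure_pmf.prob ?M {(G, H). 2 * j \<le> card (cut G S) \<and> cut H S = {}} \<le> (1 - p) ^ (2 * j)"
    proof (rule prob_percolated_graph_le[OF feas])
      fix G assume "G \<in> graphs_with_degrees n D"
      then have "measure_pmf.prob (percolate p G) {H. cut H S = {}} \<le> (1 - p) ^ card (cut G S)"
        using p graphs_with_degreesD(1) by (intro prob_no_cut_edge_kept) auto
      also have "(1 - p) ^ card (cut G S) \<le> (1 - p) ^ (2 * j)" if "2 * j \<le> card (cut G S)"
        using that p by (intro power_decreasing) auto
      finally show "measure_pmf.prob (percolate p G) {H. 2 * j \<le> card (cut G S) \<and> cut H S = {}} \<le> (1 - p) ^ (2 * j)"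
        using p by (cases "2 * j \<le> card (cut G S)") auto
    qed
    finally show ?thesis by simp
  next
    case False
    then have "{z. s \<le> card (B \<inter> S) \<and> s \<le> card (B - S) \<and> cut (snd z) S = {}} = ({} :: (nat set set \<times> nat set set) set)" by auto
    then show ?thesis using p by (simp only: measure_empty) auto
  qed
  then have "measure_pmf.prob ?M {z. \<exists>S\<subseteq>{1..n}. s \<le> card (B \<inter> S) \<and> s \<le> card (B - S) \<and> cut (snd z) S = {}}
    \<le> 2 ^ n * ((1 / 4) ^ j + (1 - p) ^ (2 * j))" by (intro prob_union_subsets_le)
  then show ?thesis by (simp add: case_prod_beta')
qed

text \<open>
  Applied to a union \<open>S\<close> of components of \<open>H\<close>, this bounds the number of edges of \<open>G\<close> that leave \<open>S\<close>.
\<close>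

lemma large_cuts_survive:
  assumes feas: "feasible n D" and p: "0 \<le> p" "p \<le> 1"
  shows "measure_pmf.prob (percolated_graph n D p) {(G, H). \<exists>S\<subseteq>{1..n}. m \<le> card (cut G S) \<and> cut H S = {}}
         \<le> 2 ^ n * (1 - p) ^ m"
proof -
  have "measure_pmf.prob (percolated_graph n D p) {(G, H). m \<le> card (cut G S) \<and> cut H S = {}} \<le> (1 - p) ^ m" for S
  proof (rule prob_percolated_graph_le[OF feas])
    fix G assume "G \<in> graphs_with_degrees n D"
    then have "measure_pmf.prob (percolate p G) {H. cut H S = {}} \<le> (1 - p) ^ card (cut G S)"
      using p graphs_with_degreesD(1) by (intro prob_no_cut_edge_kept) auto
    also have "(1 - p) ^ card (cut G S) \<le> (1 - p) ^ m" if "m \<le> card (cut G S)"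
      using that p by (intro power_decreasing) auto
    finally show "measure_pmf.prob (percolate p G) {H. m \<le> card (cut G S) \<and> cut H S = {}} \<le> (1 - p) ^ m"
      using p by (cases "m \<le> card (cut G S)") auto
  qed
  then have "measure_pmf.prob (percolated_graph n D p) {z. \<exists>S\<subseteq>{1..n}. m \<le> card (cut (fst z) S) \<and> cut (snd z) S = {}}
    \<le> 2 ^ n * (1 - p) ^ m" by (intro prob_union_subsets_le) (simp only: case_prod_beta')
  then show ?thesis by (simp add: case_prod_beta')
qed

section \<open>The majority component\<close>

lemma self_in_component: "v \<in> {1..n} \<Longrightarrow> v \<in> component n E v"
  unfolding component_def by simp

lemma component_subset: "component n E v \<subseteq> {1..n}"
  unfolding component_def by auto

lemma finite_component: "finite (component n E v)"
  by (rule finite_subset[OF component_subset]) simp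

lemma component_sym:
  assumes "w \<in> component n E v" "v \<in> {1..n}"
  shows "v \<in> component n E w"
proof -
  have "sym {(a, b). {a, b} \<in> E}" by (rule symI) (simp add: insert_commute)
  then have "sym ({(a, b). {a, b} \<in> E}\<^sup>*)" by (rule sym_rtrancl)
  then show ?thesis using assms unfolding component_def by (auto dest: symD)
qed

lemma component_trans: "w \<in> component n E v \<Longrightarrow> u \<in> component n E w \<Longrightarrow> u \<in> component n E v"
  unfolding component_def by auto

lemma component_eq:
  assumes "w \<in> component n E v" "v \<in> {1..n}"
  shows "component n E w = component n E v"
  using component_sym[OF assms] assms component_trans by blast

lemma component_edge:
  assumes "E \<in> simple_graphs n" "u \<in> component n E v" "{u, w} \<in> E"
  shows "w \<in> component n E v"
  using simple_graph_edgeD(2)[OF assms(1,3)] assms(2,3) unfolding component_def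
  by (auto intro: rtrancl_into_rtrancl)

lemma component_mono: "E \<subseteq> E' \<Longrightarrow> component n E v \<subseteq> component n E' v"
  unfolding component_def using rtrancl_mono[of "{(a, b). {a, b} \<in> E}" "{(a, b). {a, b} \<in> E'}"] by blast

text \<open>
  A vertex set without outgoing edges absorbs the component of each of its vertices.
\<close>

lemma component_subset_closed:
  assumes "v \<in> S" "cut E S = {}"
  shows "component n E v \<subseteq> S"
proof
  fix w assume "w \<in> component n E v"
  then have "(v, w) \<in> {(a, b). {a, b} \<in> E}\<^sup>*" unfolding component_def by simp
  then show "w \<in> S"
    by (induction rule: rtrancl_induct) (use assms in \<open>auto simp: cut_def\<close>)
qed

lemma component_isolated: "v \<in> {1..n} \<Longrightarrow> neighbours E v = {} \<Longrightarrow> component n E v = {v}"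
  using component_subset_closed[of v "{v}" E n] self_in_component[of v n E]
  by (auto simp: cut_def neighbours_def)

text \<open>
  The part of the graph that does not change when edges are moved at \<open>a\<close>.
\<close>

definition away :: "nat set set \<Rightarrow> nat \<Rightarrow> nat set set" where
  "away E a = {e \<in> E. a \<notin> e}"

text \<open>
  The component containing more than half of \<open>B\<close>, or the empty set if there is none. This form of
  the definition needs no choice of a component and is monotone in the graph.
\<close>

definition majority :: "nat \<Rightarrow> nat set \<Rightarrow> nat set set \<Rightarrow> nat set" where
  "majority n B E = {v \<in> {1..n}. card B < 2 * card (component n E v \<inter> B)}"

lemma majority_subset: "majority n B E \<subseteq> {1..n}"
  unfolding majority_def by auto

lemma majority_eq_component:
  assumes "finite B" "v \<in> majority n B E"
  shows "majority n B E = component n E v"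
proof -
  have v: "v \<in> {1..n}" using assms majority_subset by blast
  have "w \<in> component n E v" if w: "w \<in> majority n B E" for w
  proof (rule ccontr)
    assume nw: "w \<notin> component n E v"
    have w': "w \<in> {1..n}" using w majority_subset by blast
    have "component n E v \<inter> component n E w = {}"
      using nw component_eq[of _ n E v] component_eq[of _ n E w] v w' self_in_component[OF w'] by blast
    then have "card ((component n E v \<inter> B) \<union> (component n E w \<inter> B)) = card (component n E v \<inter> B) + card (component n E w \<inter> B)"
      using assms by (intro card_Un_disjoint) auto
    moreover have "card ((component n E v \<inter> B) \<union> (component n E w \<inter> B)) \<le> card B"
      using assms by (intro card_mono) auto
    ultimately show False using assms w unfolding majority_def by auto
  qed
  moreover have "w \<in> majority n B E" if w: "w \<in> component n E v" for w
    using component_eq[OF w v] assms(2) w component_subset[of n E v] unfolding majority_def by auto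
  ultimately show ?thesis by blast
qed

lemma majority_closed:
  assumes "E \<in> simple_graphs n" "u \<in> majority n B E" "{u, w} \<in> E"
  shows "w \<in> majority n B E"
proof -
  have u: "u \<in> {1..n}" using assms majority_subset by blast
  have w: "w \<in> component n E u" using component_edge[OF assms(1) self_in_component[OF u] assms(3)] .
  then have "w \<in> {1..n}" using component_subset by blast
  then show ?thesis using component_eq[OF w u] assms(2) unfolding majority_def by auto
qed

lemma cut_majority: "E \<in> simple_graphs n \<Longrightarrow> cut E (majority n B E) = {}"
  unfolding cut_def using majority_closed by blast

text \<open>
  Edges at a vertex outside the majority component do not influence it. Hence the component can be
  read off from the rest of the graph, independently of the edges at \<open>a\<close>.
\<close>

lemma majority_away:
  assumes E: "E \<in> simple_graphs n" and B: "finite B" and a: "a \<notin> majority n B E"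
  shows "majority n B (away E a) = majority n B E"
proof
  have sub: "away E a \<subseteq> E" unfolding away_def by auto
  have le: "card (component n (away E a) v \<inter> B) \<le> card (component n E v \<inter> B)" for v
    using component_mono[OF sub] B by (intro card_mono) auto
  then show "majority n B (away E a) \<subseteq> majority n B E"
    unfolding majority_def by (auto intro: less_le_trans[OF _ mult_le_mono2[OF le]])
  show "majority n B E \<subseteq> majority n B (away E a)"
  proof
    fix v assume v: "v \<in> majority n B E"
    then have C: "majority n B E = component n E v" using majority_eq_component B by blast
    have vn: "v \<in> {1..n}" using v majority_subset by blast
    have "cut E (component n (away E a) v) = {}"
    proof -
      have "w \<in> component n (away E a) v" if u: "u \<in> component n (away E a) v" and e: "{u, w} \<in> E" for u w
      proof -
        have uC: "u \<in> majority n B E" using u component_mono[OF sub] C by blast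
        then have "w \<in> majority n B E" using majority_closed E e by blast
        then have "{u, w} \<in> away E a" using uC a e unfolding away_def by auto
        then show ?thesis using component_edge u simple_graphs_subset[OF sub E] by blast
      qed
      then show ?thesis unfolding cut_def by blast
    qed
    then have "component n E v \<subseteq> component n (away E a) v"
      by (intro component_subset_closed self_in_component vn)
    then have "component n (away E a) v = component n E v" using component_mono[OF sub] by blast
    then show "v \<in> majority n B (away E a)" using v unfolding majority_def by simp
  qed
qed

text \<open>
  If every cut splitting \<open>B\<close> into two parts of size at least \<open>s\<close> is crossed, take a smallest union
  \<open>S\<close> of components with at least \<open>s\<close> elements of \<open>B\<close>. Its complement contains fewer than \<open>s\<close>
  elements of \<open>B\<close>, and so does \<open>S\<close> without any one component that meets \<open>B\<close>, by minimality. So each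
  such component contains more than \<open>card B - 2 * s\<close> elements of \<open>B\<close>, which is at least half.
\<close>

lemma majority_covers:
  fixes s :: real
  assumes E: "E \<in> simple_graphs n" and B: "B \<subseteq> {1..n}" and s: "s > 0" "4 * s \<le> card B"
    and cuts: "\<And>S. S \<subseteq> {1..n} \<Longrightarrow> s \<le> card (B \<inter> S) \<Longrightarrow> s \<le> card (B - S) \<Longrightarrow> cut E S \<noteq> {}"
  shows "card (B - majority n B E) < s"
proof -
  have finB: "finite B" using B finite_subset by auto
  let ?P = "\<lambda>S. S \<subseteq> {1..n} \<and> cut E S = {} \<and> s \<le> card (B \<inter> S)"
  have "?P {1..n}"
    using B s E by (auto simp: cut_def Int_absorb2 dest: simple_graph_edgeD)
  then obtain S where S: "?P S" and min: "\<And>S'. ?P S' \<Longrightarrow> card S \<le> card S'"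
    using ex_has_least_nat[of ?P "{1..n}" card] by blast
  have finS: "finite S" using S finite_subset by auto
  have split: "real (card B) = card (B \<inter> S) + card (B - S)"
    using card_Un_disjoint[of "B \<inter> S" "B - S"] finB
    by (metis Int_Diff_Un Int_Diff_disjoint finite_Diff finite_Int of_nat_add)
  have small: "card (B - S) < s" using cuts[of S] S by force
  have "B \<inter> S \<subseteq> majority n B E"
  proof
    fix v assume v: "v \<in> B \<inter> S"
    let ?C = "component n E v"
    have vn: "v \<in> {1..n}" using v B by auto
    have CS: "?C \<subseteq> S" using component_subset_closed v S by blast
    have "cut E (S - ?C) = {}"
    proof -
      have "w \<in> S - ?C" if u: "u \<in> S - ?C" and e: "{u, w} \<in> E" for u w
      proof -
        have "w \<in> S" using S u e unfolding cut_def by blast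
        moreover have "w \<notin> ?C"
          using component_edge[OF E, of w v u] e u by (auto simp: insert_commute)
        ultimately show ?thesis by blast
      qed
      then show ?thesis unfolding cut_def by blast
    qed
    moreover have "card (S - ?C) < card S"
      using CS v self_in_component[OF vn] finS by (intro psubset_card_mono) auto
    ultimately have "real (card (B \<inter> (S - ?C))) < s" using min[of "S - ?C"] S by force
    moreover have "card (B \<inter> S) = card (B \<inter> ?C) + card (B \<inter> (S - ?C))"
    proof -
      have "B \<inter> S = (B \<inter> ?C) \<union> (B \<inter> (S - ?C))" using CS by auto
      moreover have "card ((B \<inter> ?C) \<union> (B \<inter> (S - ?C))) = card (B \<inter> ?C) + card (B \<inter> (S - ?C))"
        using finB by (intro card_Un_disjoint) auto
      ultimately show ?thesis by simp
    qed
    ultimately have "real (card B) < 2 * card (?C \<inter> B)"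
      using split small s by (simp add: Int_commute)
    then show "v \<in> majority n B E" using vn unfolding majority_def by auto
  qed
  then have "card (B - majority n B E) \<le> card (B - S)" using finB by (intro card_mono) auto
  then show ?thesis using small by linarith
qed

text \<open>
  A component other than the majority component is a single isolated vertex or consists of
  non-isolated vertices outside the majority component.
\<close>

lemma L1_eq_majority:
  assumes E: "E \<in> simple_graphs n" and B: "finite B"
    and ne: "majority n B E \<noteq> {}"
    and rest: "card {v \<in> {1..n}. v \<notin> majority n B E \<and> neighbours E v \<noteq> {}} \<le> card (majority n B E)"
  shows "L1 n E = card (majority n B E)"
proof -
  let ?M = "majority n B E"
  obtain v where v: "v \<in> ?M" using ne by blast
  have C: "?M = component n E v" using majority_eq_component[OF B v] .
  have vn: "v \<in> {1..n}" using v majority_subset by blast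
  show ?thesis unfolding L1_def
  proof (rule Max_eqI)
    show "card ?M \<in> (\<lambda>v. card (component n E v)) ` {1..n}" using C vn by auto
    fix y assume "y \<in> (\<lambda>v. card (component n E v)) ` {1..n}"
    then obtain w where w: "w \<in> {1..n}" "y = card (component n E w)" by auto
    show "y \<le> card ?M"
    proof (cases "w \<in> ?M")
      case True
      then show ?thesis using majority_eq_component[OF B True] w by simp
    next
      case False
      show ?thesis
      proof (cases "neighbours E w = {}")
        case True
        have "card ?M > 0" using v finite_subset[OF majority_subset] by (auto simp: card_gt_0_iff)
        then show ?thesis using component_isolated[OF w(1) True] w by simp
      next
        case ne: False
        have "component n E w \<subseteq> {v \<in> {1..n}. v \<notin> ?M \<and> neighbours E v \<noteq> {}}"
        proof
          fix u assume u: "u \<in> component n E w"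
          have un: "u \<in> {1..n}" using u component_subset by blast
          have "neighbours E u \<noteq> {}"
          proof
            assume "neighbours E u = {}"
            then have "component n E w = {u}" using component_isolated un component_eq[OF u w(1)] by simp
            then show False using ne \<open>neighbours E u = {}\<close> self_in_component[OF w(1), of E] by auto
          qed
          moreover have "u \<notin> ?M" using component_eq[OF u w(1)] False w un unfolding majority_def by auto
          ultimately show "u \<in> {v \<in> {1..n}. v \<notin> ?M \<and> neighbours E v \<noteq> {}}" using un by simp
        qed
        then have "card (component n E w) \<le> card {v \<in> {1..n}. v \<notin> ?M \<and> neighbours E v \<noteq> {}}"
          by (intro card_mono) auto
        then show ?thesis using rest w by simp
      qed
    qed
  qed simp
qed

lemma L1_ge_attached:
  assumes E: "E \<union> K \<in> simple_graphs n" and B: "finite B" and ne: "majority n B E \<noteq> {}"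
    and U: "U \<inter> majority n B E = {}" "\<And>u. u \<in> U \<Longrightarrow> \<exists>w\<in>majority n B E. {u, w} \<in> K"
  shows "card (majority n B E) + card U \<le> L1 n (E \<union> K)"
proof -
  let ?M = "majority n B E"
  obtain v where v: "v \<in> ?M" using ne by blast
  have C: "?M = component n E v" using majority_eq_component[OF B v] .
  have vn: "v \<in> {1..n}" using v majority_subset by blast
  have M: "?M \<subseteq> component n (E \<union> K) v" unfolding C by (rule component_mono) simp
  moreover have "U \<subseteq> component n (E \<union> K) v"
  proof
    fix u assume "u \<in> U"
    then obtain w where "w \<in> ?M" "{u, w} \<in> K" using U(2) by blast
    then have "w \<in> ?M" "{w, u} \<in> E \<union> K" by (auto simp: insert_commute)
    then show "u \<in> component n (E \<union> K) v" using component_edge[OF E] M by blast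
  qed
  ultimately have sub: "?M \<union> U \<subseteq> component n (E \<union> K) v" by blast
  have "card ?M + card U = card (?M \<union> U)"
    using sub finite_subset[OF _ finite_component[of n "E \<union> K" v]] U(1)
    by (intro card_Un_disjoint[symmetric]) auto
  also have "\<dots> \<le> card (component n (E \<union> K) v)" using sub finite_component by (intro card_mono)
  also have "\<dots> \<le> L1 n (E \<union> K)" unfolding L1_def using vn by (intro Max_ge) auto
  finally show ?thesis .
qed

section \<open>Moving edges to the majority component\<close>

lemma pmf_percolated_graph:
  assumes feas: "feasible n D" and p: "0 \<le> p" "p \<le> 1" and G: "G \<in> graphs_with_degrees n D" and H: "H \<subseteq> G"
  shows "pmf (percolated_graph n D p) (G, H)
    = p ^ card H * (1 - p) ^ card (G - H) / card (graphs_with_degrees n D)"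
proof -
  let ?G = "graphs_with_degrees n D"
  have fin: "finite ?G" "?G \<noteq> {}" using finite_graphs_with_degrees feas unfolding feasible_def by auto
  have "pmf (percolated_graph n D p) (G, H) = (\<Sum>G'\<in>?G. pmf (map_pmf (Pair G') (percolate p G')) (G, H) / card ?G)"
    unfolding percolated_graph_def random_graph_def using fin
    by (simp add: pmf_bind integral_pmf_of_set sum_divide_distrib)
  also have "\<dots> = (\<Sum>G'\<in>?G. if G' = G then pmf (percolate p G) H / card ?G else 0)"
  proof (rule sum.cong[OF refl])
    fix G'
    have "pmf (map_pmf (Pair G') (percolate p G')) (G, H) = 0" if "G' \<noteq> G"
      using that by (subst pmf_eq_0_set_pmf) auto
    moreover have "pmf (map_pmf (Pair G) (percolate p G)) (G, H) = pmf (percolate p G) H"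
      by (rule pmf_map_inj') (auto simp: inj_on_def)
    ultimately show "pmf (map_pmf (Pair G') (percolate p G')) (G, H) / card ?G = (if G' = G then pmf (percolate p G) H / card ?G else 0)"
      by auto
  qed
  also have "\<dots> = pmf (percolate p G) H / card ?G" using fin G by simp
  also have "pmf (percolate p G) H = p ^ card H * (1 - p) ^ card (G - H)"
    using finite_simple_graph[OF graphs_with_degreesD(1)[OF G]] p H by (simp add: pmf_percolate)
  finally show ?thesis .
qed

lemma set_percolated_graph:
  assumes "feasible n D" "(G, H) \<in> set_pmf (percolated_graph n D p)"
  shows "G \<in> graphs_with_degrees n D" "H \<subseteq> G"
  using assms set_percolate unfolding percolated_graph_def by (auto simp: set_random_graph)

text \<open>
  The edges at \<open>b\<close> are percolated independently of the others, so one may condition on the others.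
\<close>

lemma prob_percolate_star_le:
  assumes G: "finite G" 
    and star: "\<And>H0. H0 \<subseteq> away G b \<Longrightarrow> measure_pmf.prob (percolate p {e \<in> G. b \<in> e}) {K. K \<subseteq> {e \<in> G. b \<in> e} \<and> Q (H0 \<union> K)} \<le> c"
  shows "measure_pmf.prob (percolate p G) {H. Q H} \<le> c"
proof -
  let ?S = "{e \<in> G. b \<in> e}"
  have "G = away G b \<union> ?S" "away G b \<inter> ?S = {}" "finite (away G b)" "finite ?S"
    using G unfolding away_def by auto
  then have "percolate p G = map_pmf (\<lambda>(H, K). H \<union> K) (pair_pmf (percolate p (away G b)) (percolate p ?S))"
    using percolate_disjoint_union[of "away G b" ?S p] by simp
  also have "\<dots> = bind_pmf (percolate p (away G b)) (\<lambda>H0. map_pmf (\<lambda>K. H0 \<union> K) (percolate p ?S))"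
    by (simp add: pair_pmf_def map_bind_pmf map_pmf_def[symmetric] map_pmf_comp bind_return_pmf)
  finally have eq: "percolate p G = bind_pmf (percolate p (away G b)) (\<lambda>H0. map_pmf (\<lambda>K. H0 \<union> K) (percolate p ?S))" .
  show ?thesis unfolding eq
  proof (rule prob_bind_le)
    fix H0 assume "H0 \<in> set_pmf (percolate p (away G b))"
    then have "H0 \<subseteq> away G b" by (rule set_percolate)
    then have "measure_pmf.prob (percolate p ?S) {K. K \<subseteq> ?S \<and> Q (H0 \<union> K)} \<le> c" by (rule star)
    moreover have "measure_pmf.prob (percolate p ?S) {K. Q (H0 \<union> K)} = measure_pmf.prob (percolate p ?S) {K. K \<subseteq> ?S \<and> Q (H0 \<union> K)}"
      by (intro measure_prob_cong_0) (auto simp: pmf_eq_0_set_pmf dest: set_percolate)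
    ultimately show "measure_pmf.prob (map_pmf (\<lambda>K. H0 \<union> K) (percolate p ?S)) {H. Q H} \<le> c"
      by (simp add: vimage_def)
  qed
qed

text \<open>
  The vertex \<open>b\<close> has many neighbours in the majority component of the graph without the edges at
  \<open>b\<close>, but all edges to them are lost. These are the vertices to which the switching below may not
  apply. Removing the edges at \<open>b\<close> makes the component independent of the edges at \<open>b\<close>.
\<close>

definition stranded :: "nat \<Rightarrow> nat set \<Rightarrow> nat \<Rightarrow> nat set set \<Rightarrow> nat set set \<Rightarrow> nat \<Rightarrow> bool" where
  "stranded n B h G H b \<longleftrightarrow> h \<le> card (neighbours G b \<inter> majority n B (away H b))
     \<and> (\<forall>z\<in>majority n B (away H b). {b, z} \<notin> H)"

lemma away_Un_star: "H0 \<subseteq> away G b \<Longrightarrow> K \<subseteq> {e \<in> G. b \<in> e} \<Longrightarrow> away (H0 \<union> K) b = H0"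
  unfolding away_def by auto

lemma stranded_unlikely:
  assumes G: "G \<in> simple_graphs n" and p: "0 \<le> p" "p \<le> 1"
  shows "measure_pmf.prob (percolate p G) {H. stranded n B h G H b} \<le> (1 - p) ^ h"
    and "{a, b} \<in> G \<Longrightarrow> measure_pmf.prob (percolate p G) {H. {a, b} \<in> H \<and> stranded n B h G H b} \<le> p * (1 - p) ^ h"
proof -
  let ?S = "{e \<in> G. b \<in> e}"
  have fin: "finite G" by (rule finite_simple_graph[OF G])
  define F where "F H0 = (\<lambda>z. {b, z}) ` (neighbours G b \<inter> majority n B H0)" for H0
  have F: "F H0 \<subseteq> ?S" "card (F H0) = card (neighbours G b \<inter> majority n B H0)" for H0
    unfolding F_def by (auto simp: neighbours_def card_image inj_on_pair)
  have pow: "(1 - p) ^ card (F H0) \<le> (1 - p) ^ h" if "h \<le> card (F H0)" for H0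
    using that p by (intro power_decreasing) auto
  have avoid: "h \<le> card (F H0) \<and> K \<inter> F H0 = {}"
    if "H0 \<subseteq> away G b" "K \<subseteq> ?S" "stranded n B h G (H0 \<union> K) b" for H0 K
    using that(3) F(2)[of H0] unfolding stranded_def away_Un_star[OF that(1,2)] F_def by auto
  show "measure_pmf.prob (percolate p G) {H. stranded n B h G H b} \<le> (1 - p) ^ h"
  proof (rule prob_percolate_star_le[OF fin])
    fix H0 assume H0: "H0 \<subseteq> away G b"
    show "measure_pmf.prob (percolate p ?S) {K. K \<subseteq> ?S \<and> stranded n B h G (H0 \<union> K) b} \<le> (1 - p) ^ h"
    proof (cases "h \<le> card (F H0)")
      case True
      have "measure_pmf.prob (percolate p ?S) {K. K \<subseteq> ?S \<and> stranded n B h G (H0 \<union> K) b}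
        \<le> measure_pmf.prob (percolate p ?S) {K. K \<inter> F H0 = {}}"
        by (rule measure_pmf.finite_measure_mono) (use avoid H0 in auto)
      also have "\<dots> = (1 - p) ^ card (F H0)" using fin F p by (intro prob_percolate_avoid) auto
      finally show ?thesis using pow[OF True] by linarith
    next
      case False
      then have "{K. K \<subseteq> ?S \<and> stranded n B h G (H0 \<union> K) b} = {}" using avoid H0 by blast
      then show ?thesis using p by (simp only: measure_empty) simp
    qed
  qed
  assume ab: "{a, b} \<in> G"
  show "measure_pmf.prob (percolate p G) {H. {a, b} \<in> H \<and> stranded n B h G H b} \<le> p * (1 - p) ^ h"
  proof (rule prob_percolate_star_le[OF fin])
    fix H0 assume H0: "H0 \<subseteq> away G b"
    then have nH0: "{a, b} \<notin> H0" unfolding away_def by auto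
    show "measure_pmf.prob (percolate p ?S) {K. K \<subseteq> ?S \<and> {a, b} \<in> H0 \<union> K \<and> stranded n B h G (H0 \<union> K) b} \<le> p * (1 - p) ^ h"
    proof (cases "h \<le> card (F H0) \<and> {a, b} \<notin> F H0")
      case True
      have "measure_pmf.prob (percolate p ?S) {K. K \<subseteq> ?S \<and> {a, b} \<in> H0 \<union> K \<and> stranded n B h G (H0 \<union> K) b}
        \<le> measure_pmf.prob (percolate p ?S) {K. {a, b} \<in> K \<and> K \<inter> F H0 = {}}"
        by (rule measure_pmf.finite_measure_mono) (use avoid H0 nH0 in auto)
      also have "\<dots> = p * (1 - p) ^ card (F H0)"
        using fin F p True ab by (intro prob_percolate_keep_avoid) auto
      also have "\<dots> \<le> p * (1 - p) ^ h" using pow True p by (intro mult_left_mono) auto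
      finally show ?thesis .
    next
      case False
      then have "{K. K \<subseteq> ?S \<and> {a, b} \<in> H0 \<union> K \<and> stranded n B h G (H0 \<union> K) b} = {}"
        using avoid H0 nH0 by blast
      then show ?thesis using p by (simp only: measure_empty) simp
    qed
  qed
qed

text \<open>
  The switching at a vertex \<open>a\<close> outside the majority component: \<open>ab\<close> moves to \<open>ay\<close>, with \<open>y\<close> in the
  component, and \<open>xy\<close> moves to \<open>bx\<close>. The new edge \<open>ay\<close> inherits from \<open>ab\<close> whether it is kept, and \<open>bx\<close>
  is not kept. Both graphs keep their numbers of edges, so the probability of the pair does not change.
\<close>

definition transfer :: "bool \<Rightarrow> nat \<Rightarrow> nat set set \<times> nat set set \<Rightarrow> nat \<times> nat \<times> nat \<Rightarrow> nat set set \<times> nat set set" where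
  "transfer kept a = (\<lambda>(G, H) (b, x, y).
     (switch G a b x y, if kept then insert {a, y} (H - {{a, b}}) else H))"

definition transfers :: "bool \<Rightarrow> nat \<Rightarrow> nat \<Rightarrow> nat set \<Rightarrow> nat set set \<times> nat set set \<Rightarrow> (nat \<times> nat \<times> nat) set" where
  "transfers kept a n B = (\<lambda>(G, H). {(b, x, y).
      b \<notin> majority n B (away H a) \<and> x \<in> majority n B (away H a) \<and> y \<in> majority n B (away H a) \<and>
      {a, b} \<in> G \<and> ({a, b} \<in> H \<longleftrightarrow> kept) \<and> {x, y} \<in> G - H \<and> {a, y} \<notin> G \<and> {b, x} \<notin> G})"

text \<open>
  True of every vertex \<open>a\<close> outside the majority component, but expressed through the part of the
  graph that a transfer at \<open>a\<close> leaves unchanged.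
\<close>

definition detached :: "nat \<Rightarrow> nat \<Rightarrow> nat set \<Rightarrow> nat set set \<Rightarrow> bool" where
  "detached a n B H \<longleftrightarrow> a \<notin> majority n B (away H a) \<and> (\<forall>y\<in>majority n B (away H a). {a, y} \<notin> H)"

lemma card_switch:
  assumes "finite E" "{a, b} \<in> E" "{x, y} \<in> E" "{a, y} \<notin> E" "{b, x} \<notin> E" "a \<noteq> x" "a \<noteq> y" "a \<noteq> b"
  shows "card (switch E a b x y) = card E"
proof -
  have ne: "{a, b} \<noteq> {x, y}" "{a, y} \<noteq> {b, x}" using assms by (auto simp: doubleton_eq_iff)
  have "switch E a b x y = insert {b, x} (insert {a, y} (E - {{a, b}}) - {{x, y}})"
    using assms unfolding switch_def by auto
  also have "card \<dots> = card (insert {a, y} (E - {{a, b}}))"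
    using assms ne by (intro card_insert_swap) auto
  also have "\<dots> = card E" using assms by (intro card_insert_swap) auto
  finally show ?thesis .
qed

text \<open>
  To undo a transfer at \<open>a\<close> one has to know \<open>b\<close>, \<open>x\<close> and \<open>y\<close>. The edge \<open>bx\<close> is one of the at most
  \<open>Z + 2\<close> edges that leave the component, since a transfer adds exactly two of them. If the moved edge
  is kept, \<open>y\<close> is the only neighbour of \<open>a\<close> in the component, because \<open>a\<close> had none before; otherwise
  \<open>y\<close> is one of the neighbours of \<open>a\<close> in \<open>G\<close>.
\<close>

lemma transfers_bound:
  fixes n a Z :: nat and D :: "nat \<Rightarrow> nat" and B :: "nat set"
  assumes feas: "feasible n D" and p: "0 \<le> p" "p \<le> 1" and a: "a \<in> {1..n}"
  defines "A \<equiv> {(G, H). G \<in> graphs_with_degrees n D \<and> H \<subseteq> G \<and> detached a n B H \<and> card (cut G (majority n B (away H a))) \<le> Z}"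
  shows "(\<Sum>s\<in>A. pmf (percolated_graph n D p) s * card (transfers kept a n B s)) \<le> (if kept then 1 else D a) * (Z + 2)"
proof -
  let ?G = "graphs_with_degrees n D" and ?\<Gamma> = "\<lambda>H. majority n B (away H a)"
  define C where "C = {(G, H). G \<in> ?G \<and> H \<subseteq> G}"
  define R where "R = (\<lambda>(G, H). {(b, x, y). card (cut G (?\<Gamma> H)) \<le> Z + 2 \<and> (x, b) \<in> cut G (?\<Gamma> H) \<and>
      {a, y} \<in> G \<and> (kept \<longrightarrow> {z \<in> ?\<Gamma> H. {a, z} \<in> H} = {y})})"
  have simple: "G \<in> simple_graphs n" if "G \<in> ?G" for G using that graphs_with_degreesD by auto
  have finC: "finite C"
  proof (rule finite_subset)
    show "C \<subseteq> ?G \<times> simple_graphs n" unfolding C_def using simple simple_graphs_subset by auto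
    show "finite (?G \<times> simple_graphs n)" using finite_graphs_with_degrees finite_simple_graphs by auto
  qed
  have AC: "A \<subseteq> C" unfolding A_def C_def by auto
  have finL: "finite (transfers kept a n B s)" if "s \<in> C" for s
  proof -
    obtain G H where s: "s = (G, H)" by force
    have G: "G \<in> simple_graphs n" using that simple unfolding s C_def by auto
    have "transfers kept a n B s \<subseteq> neighbours G a \<times> ?\<Gamma> H \<times> ?\<Gamma> H"
      unfolding s transfers_def neighbours_def by auto
    also have "\<dots> \<subseteq> {1..n} \<times> {1..n} \<times> {1..n}"
      using neighbours_subset[OF G] majority_subset by (intro Sigma_mono)
    finally have "transfers kept a n B s \<subseteq> {1..n} \<times> {1..n} \<times> {1..n}" .
    then show ?thesis by (rule finite_subset) simp
  qed
  have R: "finite (R r) \<and> card (R r) \<le> (if kept then 1 else D a) * (Z + 2)" if r: "r \<in> C" for r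
  proof -
    obtain G H where s: "r = (G, H)" by force
    have G: "G \<in> ?G" using r unfolding s C_def by auto
    define Y where "Y = (if kept then {y. {z \<in> ?\<Gamma> H. {a, z} \<in> H} = {y}} else neighbours G a)"
    have Y1: "finite Y \<and> card Y \<le> (if kept then 1 else D a)"
    proof (cases kept)
      case True
      have "Y \<subseteq> {the_elem {z \<in> ?\<Gamma> H. {a, z} \<in> H}}" unfolding Y_def using True by auto
      then have "finite Y \<and> card Y \<le> card {the_elem {z \<in> ?\<Gamma> H. {a, z} \<in> H}}"
        by (intro conjI card_mono) (auto intro: finite_subset)
      then show ?thesis using True by simp
    next
      case False
      then show ?thesis using graphs_with_degreesD(2)[OF G a] finite_neighbours[OF simple[OF G]] unfolding Y_def by simp
    qed
    show ?thesis
    proof (cases "card (cut G (?\<Gamma> H)) \<le> Z + 2")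
      case True
      have sub: "R r \<subseteq> (\<lambda>(y, x, b). (b, x, y)) ` (Y \<times> cut G (?\<Gamma> H))"
      proof
        fix t assume t: "t \<in> R r"
        obtain b x y where tt: "t = (b, x, y)" by (metis surj_pair)
        have "(y, x, b) \<in> Y \<times> cut G (?\<Gamma> H)"
          using t unfolding tt R_def s Y_def by (auto simp: neighbours_def)
        then show "t \<in> (\<lambda>(y, x, b). (b, x, y)) ` (Y \<times> cut G (?\<Gamma> H))"
          unfolding tt by (intro image_eqI[where x="(y, x, b)"]) auto
      qed
      have fin: "finite (Y \<times> cut G (?\<Gamma> H))" using Y1 finite_cut[OF simple[OF G]] by auto
      have "card (R r) \<le> card (Y \<times> cut G (?\<Gamma> H))"
        using surj_card_le[OF fin sub] .
      also have "\<dots> \<le> (if kept then 1 else D a) * (Z + 2)"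
        unfolding card_cartesian_product using Y1 True by (intro mult_mono) auto
      finally show ?thesis using finite_subset[OF sub] fin by auto
    next
      case False
      then have "R r = {}" unfolding R_def s by auto
      then show ?thesis by simp
    qed
  qed
  have main: "(\<Sum>s\<in>A. pmf (percolated_graph n D p) s * card (transfers kept a n B s))
        \<le> (\<Sum>r\<in>C. pmf (percolated_graph n D p) r * card (R r))"
  proof (rule weighted_double_counting[where f="transfer kept a"])
    fix s t assume s: "s \<in> A" and t: "t \<in> transfers kept a n B s"
    obtain G H where sGH: "s = (G, H)" by force
    obtain b x y where tt: "t = (b, x, y)" by (metis surj_pair)
    let ?G' = "switch G a b x y" and ?H' = "if kept then insert {a, y} (H - {{a, b}}) else H"
    have G: "G \<in> ?G" and H: "H \<subseteq> G" and det: "a \<notin> ?\<Gamma> H" "\<And>y. y \<in> ?\<Gamma> H \<Longrightarrow> {a, y} \<notin> H" and Z: "card (cut G (?\<Gamma> H)) \<le> Z"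
      using s unfolding sGH A_def detached_def by auto
    have b: "b \<notin> ?\<Gamma> H" and xy: "x \<in> ?\<Gamma> H" "y \<in> ?\<Gamma> H" and e: "{a, b} \<in> G" "{x, y} \<in> G" "{a, y} \<notin> G" "{b, x} \<notin> G"
      and kept: "{a, b} \<in> H \<longleftrightarrow> kept" and xyH: "{x, y} \<notin> H"
      using t unfolding sGH tt transfers_def by auto
    have ne: "a \<noteq> x" "a \<noteq> y" "b \<noteq> x" "b \<noteq> y" using det b xy by auto
    have ab: "a \<noteq> b" using simple_graph_edgeD(3)[OF simple[OF G] e(1)] .
    have finG: "finite G" using finite_simple_graph simple G by auto
    have finH: "finite H" using finG H finite_subset by auto
    have G': "?G' \<in> ?G" by (rule switch_graphs_with_degrees[OF G e ne])
    have H': "?H' \<subseteq> ?G'" using H kept xyH unfolding switch_def by auto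
    \<comment> \<open>Only edges at \<open>a\<close> change in \<open>H\<close>, so removing the edges at \<open>a\<close> leaves the same graph and the same majority component.\<close>
    have aw: "away ?H' a = away H a" "away (insert {a, y} (H - {{a, b}})) a = away H a"
      unfolding away_def by auto
    have cutG': "cut ?G' (?\<Gamma> H) = cut G (?\<Gamma> H) \<union> {(x, b), (y, a)}"
    proof -
      have "?G' = switch G x y a b" unfolding switch_def by (auto simp: insert_commute)
      then show ?thesis using cut_switch[OF xy b det(1), of G] cut_switch[of x "?\<Gamma> H" y a b G] xy b det(1) by simp
    qed
    have "card (cut ?G' (?\<Gamma> H)) \<le> card (cut G (?\<Gamma> H)) + card {(x, b), (y, a)}"
      unfolding cutG' by (rule card_Un_le)
    also have "card {(x, b), (y, a)} \<le> 2" by (simp add: card_insert_if)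
    finally have Z': "card (cut ?G' (?\<Gamma> H)) \<le> Z + 2" using Z by simp
    have cH: "card ?H' = card H"
    proof (cases kept)
      case True
      have "card (insert {a, y} (H - {{a, b}})) = card H"
        by (rule card_insert_swap) (use kept True finH det(2)[OF xy(2)] in auto)
      then show ?thesis unfolding if_P[OF True] .
    qed simp
    have cG: "card ?G' = card G" by (rule card_switch[OF finG e ne(1,2) ab])
    have "card (?G' - ?H') = card ?G' - card ?H'" 
      using H' finH by (intro card_Diff_subset) auto
    also have "\<dots> = card (G - H)" using H finH cH cG by (simp add: card_Diff_subset)
    finally have "pmf (percolated_graph n D p) (?G', ?H') = pmf (percolated_graph n D p) (G, H)"
      using pmf_percolated_graph[OF feas p G H] pmf_percolated_graph[OF feas p G' H'] cH by simp
    moreover have "t \<in> R (?G', ?H')"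
    proof -
      have "{z \<in> ?\<Gamma> H. {a, z} \<in> ?H'} = {y}" if kept
        using that det(2) xy ab by (auto simp: doubleton_eq_iff)
      moreover have "{a, y} \<in> ?G'" unfolding switch_def by auto
      ultimately show ?thesis using Z' cutG' unfolding R_def tt by (simp add: aw)
    qed
    ultimately show "transfer kept a s t \<in> C \<and> t \<in> R (transfer kept a s t) \<and>
      pmf (percolated_graph n D p) (transfer kept a s t) = pmf (percolated_graph n D p) s"
      using G' H' unfolding transfer_def sGH tt C_def by simp
  next
    fix s s' t assume s: "s \<in> A" "s' \<in> A" and t: "t \<in> transfers kept a n B s" "t \<in> transfers kept a n B s'"
      and eq: "transfer kept a s t = transfer kept a s' t"
    obtain G H where sGH: "s = (G, H)" by force
    obtain G' H' where sGH': "s' = (G', H')" by force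
    obtain b x y where tt: "t = (b, x, y)" by (metis surj_pair)
    have i: "{a, b} \<in> G" "{x, y} \<in> G" "{a, y} \<notin> G" "{b, x} \<notin> G" 
      "{a, b} \<in> G'" "{x, y} \<in> G'" "{a, y} \<notin> G'" "{b, x} \<notin> G'"
      and k: "{a, b} \<in> H \<longleftrightarrow> kept" "{a, b} \<in> H' \<longleftrightarrow> kept"
      using t unfolding sGH sGH' tt transfers_def by auto
    have "H \<subseteq> G" "H' \<subseteq> G'" using s unfolding sGH sGH' A_def by auto
    then have n: "{a, y} \<notin> H" "{a, y} \<notin> H'" using i by auto
    have "switch G a b x y = switch G' a b x y" using eq unfolding transfer_def sGH sGH' tt by simp
    then have "G = G'" using switch_inverse[OF i(1-4)] switch_inverse[OF i(5-8)] by metis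
    moreover have "H = H'"
    proof (cases kept)
      case True
      then have ins: "insert {a, y} (H - {{a, b}}) = insert {a, y} (H' - {{a, b}})"
        using eq unfolding transfer_def sGH sGH' tt by simp
      \<comment> \<open>The new edge \<open>ay\<close> was not in \<open>H\<close>, so removing it again restores \<open>H\<close>.\<close>
      have "H = insert {a, b} (insert {a, y} (H - {{a, b}}) - {{a, y}})" using n k True by auto
      also have "\<dots> = H'" unfolding ins using n k True by auto
      finally show ?thesis .
    next
      case False
      then show ?thesis using eq unfolding transfer_def sGH sGH' tt by simp
    qed
    ultimately show "s = s'" unfolding sGH sGH' by simp
  qed (use finC AC finL R in \<open>auto intro: finite_subset\<close>)
  also have "\<dots> \<le> (\<Sum>r\<in>C. pmf (percolated_graph n D p) r * real ((if kept then 1 else D a) * (Z + 2)))"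
  proof (rule sum_mono)
    fix r assume "r \<in> C"
    then have "real (card (R r)) \<le> real ((if kept then 1 else D a) * (Z + 2))"
      using R by (intro of_nat_mono) blast
    then show "pmf (percolated_graph n D p) r * card (R r) \<le> pmf (percolated_graph n D p) r * real ((if kept then 1 else D a) * (Z + 2))"
      by (rule mult_left_mono) simp
  qed
  also have "\<dots> = measure_pmf.prob (percolated_graph n D p) C * real ((if kept then 1 else D a) * (Z + 2))"
    using finC by (simp add: sum_distrib_right[symmetric] measure_measure_pmf_finite)
  also have "\<dots> \<le> 1 * real ((if kept then 1 else D a) * (Z + 2))"
    by (rule mult_right_mono) auto
  finally show ?thesis by simp
qed

text \<open>
  Few edges leave the majority component, and it contains many vertices of \<open>S\<close> that have at least \<open>r\<close>
  edges left for the second stage. Together these guarantee many edges \<open>xy\<close> available for transfers.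
\<close>

definition typical :: "nat \<Rightarrow> nat set \<Rightarrow> nat set \<Rightarrow> nat \<Rightarrow> real \<Rightarrow> real \<Rightarrow> nat set set \<Rightarrow> nat set set \<Rightarrow> bool" where
  "typical n B S Z r \<tau> G H \<longleftrightarrow> card (cut G (majority n B H)) \<le> Z
     \<and> \<tau> \<le> card {x \<in> S \<inter> majority n B H. r \<le> card (neighbours (G - H) x)}"

text \<open>
  For each neighbour \<open>b\<close> outside the component with fewer than \<open>h\<close> neighbours in it, count the edges
  \<open>xy\<close>: there are at least \<open>\<tau> - h\<close> choices of \<open>x\<close> not adjacent to \<open>b\<close>, each with at least
  \<open>r\<close> lost edges. At most \<open>Z\<close>
  of these edges leave the component, and at most \<open>D a\<close> per vertex \<open>x\<close> end in a neighbour of \<open>a\<close>.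
\<close>

lemma many_transfers:
  fixes r \<tau> :: real and n a h Z :: nat and B S :: "nat set" and D :: "nat \<Rightarrow> nat"
  defines "\<Gamma> \<equiv> \<lambda>H. majority n B H"
  assumes G: "G \<in> graphs_with_degrees n D" and H: "H \<subseteq> G" and B: "finite B" and a: "a \<in> {1..n}" "a \<notin> \<Gamma> H"
    and tyG: "typical n B S Z r \<tau> G H" and r: "0 \<le> r"
  shows "card {b. {a, b} \<in> G \<and> ({a, b} \<in> H \<longleftrightarrow> kept) \<and> b \<notin> \<Gamma> H \<and> card (neighbours G b \<inter> \<Gamma> H) < h}
         * ((\<tau> - real h) * r - real Z - real (D a) * real n) \<le> card (transfers kept a n B (G, H))"
proof -
  let ?\<Gamma> = "\<Gamma> H" and ?R = "G - H"
  let ?bs = "{b. {a, b} \<in> G \<and> ({a, b} \<in> H \<longleftrightarrow> kept) \<and> b \<notin> ?\<Gamma> \<and> card (neighbours G b \<inter> ?\<Gamma>) < h}"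
  have sG: "G \<in> simple_graphs n" using graphs_with_degreesD(1)[OF G] .
  have sH: "H \<in> simple_graphs n" and sR: "?R \<in> simple_graphs n"
    using simple_graphs_subset[OF _ sG] H by auto
  have aw: "majority n B (away H a) = ?\<Gamma>" unfolding \<Gamma>_def by (rule majority_away) (use a sH B in \<open>auto simp: \<Gamma>_def\<close>)
  have tr: "transfers kept a n B (G, H) = {(b, x, y). b \<notin> ?\<Gamma> \<and> x \<in> ?\<Gamma> \<and> y \<in> ?\<Gamma> \<and>
      {a, b} \<in> G \<and> ({a, b} \<in> H \<longleftrightarrow> kept) \<and> {x, y} \<in> G - H \<and> {a, y} \<notin> G \<and> {b, x} \<notin> G}"
    unfolding transfers_def by (simp add: aw)
  have fin\<Gamma>: "finite ?\<Gamma>" unfolding \<Gamma>_def by (rule finite_subset[OF majority_subset]) simp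
  define T where "T b = {x \<in> S \<inter> ?\<Gamma>. r \<le> card (neighbours ?R x)} - neighbours G b" for b
  define P where "P b = Sigma (T b) (\<lambda>x. neighbours ?R x \<inter> ?\<Gamma> - neighbours G a)" for b
  have finT: "finite (T b)" for b unfolding T_def using fin\<Gamma> by auto
  have finP: "finite (P b)" for b unfolding P_def using finT finite_neighbours[OF sR] by auto
  have finbs: "finite ?bs" using finite_neighbours[OF sG, of a] by (auto simp: neighbours_def intro: finite_subset[rotated])
  have cP: "(\<tau> - real h) * r - real Z - real (D a) * real n \<le> card (P b)" if b: "b \<in> ?bs" for b
  proof -
    have "card {x \<in> S \<inter> ?\<Gamma>. r \<le> card (neighbours ?R x)} \<le> card (T b) + card (neighbours G b \<inter> ?\<Gamma>)"
      by (rule order_trans[OF card_mono card_Un_le]) (auto simp: T_def fin\<Gamma>)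
    then have "\<tau> - h \<le> card (T b)" using tyG b unfolding typical_def \<Gamma>_def[symmetric] by auto
    then have "(\<tau> - h) * r \<le> card (T b) * r" using r by (rule mult_right_mono)
    also have "\<dots> = (\<Sum>x\<in>T b. r)" by simp
    also have "\<dots> \<le> (\<Sum>x\<in>T b. real (card (neighbours ?R x)))" by (rule sum_mono) (auto simp: T_def)
    also have "\<dots> \<le> (\<Sum>x\<in>T b. real (card (neighbours ?R x \<inter> ?\<Gamma> - neighbours G a)) + real (card (neighbours ?R x - ?\<Gamma>)) + real (D a))"
    proof (rule sum_mono)
      fix x
      have "card (neighbours ?R x) \<le> card (neighbours ?R x \<inter> ?\<Gamma> - neighbours G a) + card (neighbours ?R x - ?\<Gamma>) + card (neighbours G a)"
        by (rule card_le_three_cover) (use finite_neighbours[OF sR] finite_neighbours[OF sG] in auto)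
      then show "real (card (neighbours ?R x)) \<le> real (card (neighbours ?R x \<inter> ?\<Gamma> - neighbours G a)) + real (card (neighbours ?R x - ?\<Gamma>)) + real (D a)"
        using graphs_with_degreesD(2)[OF G a(1)] by simp
    qed
    also have "\<dots> = card (P b) + (\<Sum>x\<in>T b. card (neighbours ?R x - ?\<Gamma>)) + card (T b) * D a"
      unfolding P_def using finT finite_neighbours[OF sR] by (subst card_SigmaI) (auto simp: sum.distrib)
    also have "(\<Sum>x\<in>T b. card (neighbours ?R x - ?\<Gamma>)) \<le> Z"
    proof -
      have "(\<Sum>x\<in>T b. card (neighbours ?R x - ?\<Gamma>)) \<le> card (cut ?R ?\<Gamma>)"
        by (rule sum_card_crossing_le(1)[OF sR finT]) (auto simp: T_def)
      also have "\<dots> \<le> card (cut G ?\<Gamma>)" by (rule card_mono[OF finite_cut[OF sG]]) (auto simp: cut_def)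
      finally show ?thesis using tyG unfolding typical_def \<Gamma>_def by simp
    qed
    also have "card (T b) * D a \<le> n * D a"
    proof -
      have "T b \<subseteq> {1..n}" unfolding T_def \<Gamma>_def using majority_subset by blast
      then have "card (T b) \<le> card {1..n}" by (intro card_mono) auto
      then show ?thesis by simp
    qed
    finally show ?thesis by (simp add: algebra_simps)
  qed
  have "card ?bs * ((\<tau> - real h) * r - real Z - real (D a) * real n) = (\<Sum>b\<in>?bs. (\<tau> - real h) * r - real Z - real (D a) * real n)" by simp
  also have "\<dots> \<le> (\<Sum>b\<in>?bs. real (card (P b)))" by (rule sum_mono) (use cP in auto)
  also have "\<dots> = card (Sigma ?bs P)" using finbs finP by (subst card_SigmaI) auto
  also have "\<dots> \<le> card (transfers kept a n B (G, H))"
  proof (intro of_nat_mono card_mono)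
    have "transfers kept a n B (G, H) \<subseteq> neighbours G a \<times> ?\<Gamma> \<times> ?\<Gamma>"
      unfolding tr neighbours_def by auto
    then show "finite (transfers kept a n B (G, H))"
      by (rule finite_subset) (use finite_neighbours[OF sG] fin\<Gamma> in auto)
    show "Sigma ?bs P \<subseteq> transfers kept a n B (G, H)"
      unfolding tr P_def T_def neighbours_def by auto
  qed
  finally show ?thesis by simp
qed

lemma detachedI:
  assumes "H \<in> simple_graphs n" "finite B" "a \<notin> majority n B H"
  shows "detached a n B H"
proof -
  have aw: "majority n B (away H a) = majority n B H" by (rule majority_away[OF assms])
  have "{a, y} \<notin> H" if "y \<in> majority n B H" for y
    using majority_closed[OF assms(1) that, of a] assms(3) by (auto simp: insert_commute)
  then show ?thesis unfolding detached_def aw using assms by blast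
qed

lemma many_transfers_unlikely:
  fixes t :: real
  assumes feas: "feasible n D" and p: "0 \<le> p" "p \<le> 1" and a: "a \<in> {1..n}" and t: "t > 0"
  shows "measure_pmf.prob (percolated_graph n D p)
      {(G, H). detached a n B H \<and> card (cut G (majority n B (away H a))) \<le> Z \<and> t \<le> card (transfers kept a n B (G, H))}
     \<le> real (if kept then 1 else D a) * (real Z + 2) / t"
proof -
  let ?M = "percolated_graph n D p"
  define A where "A = {(G, H). G \<in> graphs_with_degrees n D \<and> H \<subseteq> G \<and> detached a n B H \<and> card (cut G (majority n B (away H a))) \<le> Z}"
  define X where "X = {s \<in> A. t \<le> card (transfers kept a n B s)}"
  have finA: "finite A"
  proof (rule finite_subset)
    show "A \<subseteq> graphs_with_degrees n D \<times> simple_graphs n"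
      unfolding A_def using graphs_with_degreesD simple_graphs_subset by auto
    show "finite (graphs_with_degrees n D \<times> simple_graphs n)"
      using finite_graphs_with_degrees finite_simple_graphs by auto
  qed
  then have finX: "finite X" unfolding X_def by auto
  have "measure_pmf.prob ?M {(G, H). detached a n B H \<and> card (cut G (majority n B (away H a))) \<le> Z \<and> t \<le> card (transfers kept a n B (G, H))}
    \<le> measure_pmf.prob ?M X"
  proof (rule prob_le_on_support, clarify)
    fix G H assume "(G, H) \<in> set_pmf ?M" "detached a n B H" "card (cut G (majority n B (away H a))) \<le> Z"
      "t \<le> card (transfers kept a n B (G, H))"
    then show "(G, H) \<in> X" using set_percolated_graph[OF feas, of G H p] unfolding X_def A_def by simp
  qed
  moreover have "measure_pmf.prob ?M X * t \<le> real (if kept then 1 else D a) * (real Z + 2)"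
  proof -
    have "measure_pmf.prob ?M X * t = (\<Sum>s\<in>X. pmf ?M s * t)"
      using finX by (simp add: measure_measure_pmf_finite sum_distrib_right)
    also have "\<dots> \<le> (\<Sum>s\<in>X. pmf ?M s * card (transfers kept a n B s))"
      by (rule sum_mono) (auto simp: X_def intro: mult_left_mono)
    also have "\<dots> \<le> (\<Sum>s\<in>A. pmf ?M s * card (transfers kept a n B s))"
      by (rule sum_mono2) (use finA in \<open>auto simp: X_def\<close>)
    also have "\<dots> \<le> real (if kept then 1 else D a) * (real Z + 2)"
      using transfers_bound[OF feas p a, of kept B Z] unfolding A_def
      by (cases kept) (simp_all add: algebra_simps)
    finally show ?thesis .
  qed
  ultimately have "measure_pmf.prob ?M {(G, H). detached a n B H \<and> card (cut G (majority n B (away H a))) \<le> Z \<and> t \<le> card (transfers kept a n B (G, H))} * t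
      \<le> real (if kept then 1 else D a) * (real Z + 2)"
    using mult_right_mono[of _ _ t] t by (meson order_trans less_imp_le)
  then show ?thesis using t by (subst pos_le_divide_eq)
qed

lemma stranded_iff:
  assumes "H \<in> simple_graphs n" "finite B" "b \<notin> majority n B H"
  shows "stranded n B h G H b \<longleftrightarrow> h \<le> card (neighbours G b \<inter> majority n B H)"
  using detachedI[OF assms] majority_away[OF assms] unfolding stranded_def detached_def by auto

text \<open>
  An edge \<open>ab\<close> of \<open>H\<close> at a vertex \<open>a\<close> outside the majority component has \<open>b\<close> outside as well. Either
  \<open>b\<close> is stranded, or the edge admits \<open>m\<close> transfers, each of which can be undone in at most \<open>Z + 2\<close> ways.
\<close>

lemma vertex_outside_majority_isolated:
  fixes r \<tau> :: real
  assumes feas: "feasible n D" and p: "0 \<le> p" "p \<le> 1" and a: "a \<in> {1..n}" and B: "finite B" and r: "0 \<le> r"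
    and m: "0 < m" "m \<le> (\<tau> - real h) * r - real Z - real (D a) * real n"
  shows "measure_pmf.prob (percolated_graph n D p)
      {(G, H). typical n B S Z r \<tau> G H \<and> a \<notin> majority n B H \<and> neighbours H a \<noteq> {}}
    \<le> D a * (p * (1 - p) ^ h) + (real Z + 2) / m"
proof -
  let ?M = "percolated_graph n D p"
  let ?X = "{(G, H). \<exists>b. {a, b} \<in> H \<and> stranded n B h G H b}"
  let ?Y = "{(G, H). detached a n B H \<and> card (cut G (majority n B (away H a))) \<le> Z \<and> m \<le> card (transfers True a n B (G, H))}"
  have "measure_pmf.prob ?M {(G, H). typical n B S Z r \<tau> G H \<and> a \<notin> majority n B H \<and> neighbours H a \<noteq> {}}
    \<le> measure_pmf.prob ?M (?X \<union> ?Y)"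
  proof (rule prob_le_on_support)
    fix s assume s: "s \<in> set_pmf ?M" "s \<in> {(G, H). typical n B S Z r \<tau> G H \<and> a \<notin> majority n B H \<and> neighbours H a \<noteq> {}}"
    obtain G H where sGH: "s = (G, H)" by force
    have G: "G \<in> graphs_with_degrees n D" and H: "H \<subseteq> G" using set_percolated_graph[OF feas] s(1) unfolding sGH by auto
    have tyG: "typical n B S Z r \<tau> G H" and nm: "a \<notin> majority n B H" using s(2) unfolding sGH by auto
    obtain b where b: "{a, b} \<in> H" using s(2) unfolding sGH neighbours_def by auto
    have sH: "H \<in> simple_graphs n" using simple_graphs_subset[OF H] graphs_with_degreesD[OF G] by blast
    have bm: "b \<notin> majority n B H"
      using majority_closed[OF sH, of b B a] b nm by (auto simp: insert_commute)
    show "s \<in> ?X \<union> ?Y"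
    proof (cases "stranded n B h G H b")
      case True
      then show ?thesis using b unfolding sGH by auto
    next
      case False
      let ?bs = "{b. {a, b} \<in> G \<and> ({a, b} \<in> H \<longleftrightarrow> True) \<and> b \<notin> majority n B H \<and> card (neighbours G b \<inter> majority n B H) < h}"
      have "b \<in> ?bs" using False b bm H stranded_iff[OF sH B bm] by auto
      moreover have "finite ?bs" using finite_neighbours[OF sH, of a]
        by (auto simp: neighbours_def intro: finite_subset[rotated])
      ultimately have "1 \<le> card ?bs" using card_gt_0_iff[of ?bs] by (auto simp: Suc_le_eq)
      then have "1 * m \<le> card ?bs * ((\<tau> - real h) * r - real Z - real (D a) * real n)" using m by (intro mult_mono) auto
      also have "\<dots> \<le> card (transfers True a n B (G, H))"
        by (rule many_transfers[OF G H B a nm tyG r])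
      finally show ?thesis
        using detachedI[OF sH B nm] tyG majority_away[OF sH B nm] unfolding sGH typical_def by auto
    qed
  qed
  also have "\<dots> \<le> measure_pmf.prob ?M ?X + measure_pmf.prob ?M ?Y" by (rule prob_Un_le)
  also have "measure_pmf.prob ?M ?Y \<le> (real Z + 2) / m"
    using many_transfers_unlikely[OF feas p a m(1), of B Z True] by simp
  also have "measure_pmf.prob ?M ?X \<le> D a * (p * (1 - p) ^ h)"
  proof (rule prob_percolated_graph_le[OF feas])
    fix G assume G: "G \<in> graphs_with_degrees n D"
    note sG = graphs_with_degreesD(1)[OF G]
    have "measure_pmf.prob (percolate p G) {H. \<exists>b. {a, b} \<in> H \<and> stranded n B h G H b}
      \<le> measure_pmf.prob (percolate p G) {H. 1 \<le> real (card {b \<in> neighbours G a. {a, b} \<in> H \<and> stranded n B h G H b})}"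
    proof (rule prob_le_on_support)
      fix H assume "H \<in> set_pmf (percolate p G)" "H \<in> {H. \<exists>b. {a, b} \<in> H \<and> stranded n B h G H b}"
      then have "{b \<in> neighbours G a. {a, b} \<in> H \<and> stranded n B h G H b} \<noteq> {}"
        using set_percolate unfolding neighbours_def by blast
      then show "H \<in> {H. 1 \<le> real (card {b \<in> neighbours G a. {a, b} \<in> H \<and> stranded n B h G H b})}"
        using finite_neighbours[OF sG] by (simp add: Suc_le_eq card_gt_0_iff)
    qed
    also have "\<dots> \<le> card (neighbours G a) * (p * (1 - p) ^ h) / 1"
      by (rule prob_count_ge_le)
         (use finite_neighbours[OF sG] stranded_unlikely(2)[OF sG p] in \<open>auto simp: neighbours_def\<close>)
    finally show "measure_pmf.prob (percolate p G) {H. \<exists>b. {a, b} \<in> H \<and> stranded n B h G H b} \<le> D a * (p * (1 - p) ^ h)"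
      using graphs_with_degreesD(2)[OF G a] by simp
  qed
  finally show ?thesis by (simp add: add.commute)
qed

text \<open>
  If half of the neighbours of \<open>a\<close> lie outside the majority component, then a quarter of all
  neighbours is stranded or a quarter admits \<open>m\<close> transfers each. The first is handled by Markov's
  inequality. In the second case the \<open>D a * m / 4\<close> transfers are set against the at most
  \<open>D a * (Z + 2)\<close> ways of undoing one, so the degree of \<open>a\<close> cancels.
\<close>

lemma isolated_vertex_sees_majority:
  fixes r \<tau> :: real
  assumes feas: "feasible n D" and p: "0 \<le> p" "p \<le> 1" and a: "a \<in> {1..n}" "D a \<ge> 1" and B: "finite B" and r: "0 \<le> r"
    and m: "0 < m" "m \<le> (\<tau> - real h) * r - real Z - real (D a) * real n"
  shows "measure_pmf.prob (percolated_graph n D p)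
      {(G, H). typical n B S Z r \<tau> G H \<and> a \<notin> majority n B H \<and> neighbours H a = {}
         \<and> D a \<le> 2 * card (neighbours G a - majority n B H)}
    \<le> 4 * (1 - p) ^ h + 4 * (real Z + 2) / m"
proof -
  let ?M = "percolated_graph n D p"
  define t where "t = real (D a) / 4"
  have t: "t > 0" using a unfolding t_def by simp
  let ?X = "{(G, H). t \<le> card {b \<in> neighbours G a. stranded n B h G H b}}"
  let ?Y = "{(G, H). detached a n B H \<and> card (cut G (majority n B (away H a))) \<le> Z \<and> t * m \<le> card (transfers False a n B (G, H))}"
  let ?A = "{(G, H). typical n B S Z r \<tau> G H \<and> a \<notin> majority n B H \<and> neighbours H a = {}
         \<and> D a \<le> 2 * card (neighbours G a - majority n B H)}"
  have "measure_pmf.prob ?M ?A \<le> measure_pmf.prob ?M (?X \<union> ?Y)"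
  proof (rule prob_le_on_support)
    fix s assume s: "s \<in> set_pmf ?M" "s \<in> ?A"
    obtain G H where sGH: "s = (G, H)" by force
    have G: "G \<in> graphs_with_degrees n D" and H: "H \<subseteq> G" using set_percolated_graph[OF feas] s(1) unfolding sGH by auto
    have tyG: "typical n B S Z r \<tau> G H" and nm: "a \<notin> majority n B H" and iso: "neighbours H a = {}"
      and half: "D a \<le> 2 * card (neighbours G a - majority n B H)" using s(2) unfolding sGH by auto
    note sG = graphs_with_degreesD(1)[OF G]
    have sH: "H \<in> simple_graphs n" using simple_graphs_subset[OF H sG] .
    let ?bs = "{b. {a, b} \<in> G \<and> ({a, b} \<in> H \<longleftrightarrow> False) \<and> b \<notin> majority n B H \<and> card (neighbours G b \<inter> majority n B H) < h}"
    have finbs: "finite ?bs" using finite_neighbours[OF sG, of a]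
      by (auto simp: neighbours_def intro: finite_subset[rotated])
    have "card (neighbours G a - majority n B H) \<le> card ({b \<in> neighbours G a. stranded n B h G H b} \<union> ?bs)"
    proof (rule card_mono)
      show "finite ({b \<in> neighbours G a. stranded n B h G H b} \<union> ?bs)" using finbs finite_neighbours[OF sG] by auto
      show "neighbours G a - majority n B H \<subseteq> {b \<in> neighbours G a. stranded n B h G H b} \<union> ?bs"
        using stranded_iff[OF sH B] iso by (auto simp: neighbours_def)
    qed
    also have "\<dots> \<le> card {b \<in> neighbours G a. stranded n B h G H b} + card ?bs" by (rule card_Un_le)
    finally have "t \<le> card {b \<in> neighbours G a. stranded n B h G H b} \<or> t \<le> card ?bs"
      using half unfolding t_def by linarith
    then show "s \<in> ?X \<union> ?Y"
    proof
      assume "t \<le> card ?bs"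
      then have "t * m \<le> card ?bs * ((\<tau> - real h) * r - real Z - real (D a) * real n)" using m by (intro mult_mono) auto
      also have "\<dots> \<le> card (transfers False a n B (G, H))"
        by (rule many_transfers[OF G H B a(1) nm tyG r])
      finally show ?thesis
        using detachedI[OF sH B nm] tyG majority_away[OF sH B nm] unfolding sGH typical_def by auto
    qed (auto simp: sGH)
  qed
  also have "\<dots> \<le> measure_pmf.prob ?M ?X + measure_pmf.prob ?M ?Y" by (rule prob_Un_le)
  also have "measure_pmf.prob ?M ?Y \<le> real (D a) * (real Z + 2) / (t * m)"
    using many_transfers_unlikely[OF feas p a(1), of "t * m" B Z False] t m by simp
  also have "real (D a) * (real Z + 2) / (t * m) = 4 * (real Z + 2) / m"
    using a(2) m(1) unfolding t_def by (simp add: field_simps)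
  also have "measure_pmf.prob ?M ?X \<le> 4 * (1 - p) ^ h"
  proof (rule prob_percolated_graph_le[OF feas])
    fix G assume G: "G \<in> graphs_with_degrees n D"
    note sG = graphs_with_degreesD(1)[OF G]
    have "measure_pmf.prob (percolate p G) {H. t \<le> card {b \<in> neighbours G a. stranded n B h G H b}}
      \<le> card (neighbours G a) * (1 - p) ^ h / t"
      by (rule prob_count_ge_le) (use finite_neighbours[OF sG] stranded_unlikely(1)[OF sG p] t in auto)
    also have "\<dots> = 4 * (1 - p) ^ h"
      using a unfolding graphs_with_degreesD(2)[OF G a(1)] t_def by (simp add: field_simps)
    finally show "measure_pmf.prob (percolate p G) {H. t \<le> card {b \<in> neighbours G a. stranded n B h G H b}} \<le> 4 * (1 - p) ^ h" .
  qed
  finally show ?thesis by (simp add: add.commute)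
qed

section \<open>Second-moment estimates\<close>

text \<open>
  Chebyshev's bound for deviating from the mean \<open>q * x\<close> by half of it, with variance at most \<open>x\<close>.
\<close>

lemma quarter_variance_ratio: "x > 0 \<Longrightarrow> q > 0 \<Longrightarrow> x / (q * x / 2)\<^sup>2 = 4 / (q\<^sup>2 * x)" for x q :: real
  by (simp add: field_simps power2_eq_square)

lemma residual_degree_concentrated:
  assumes G: "G \<in> graphs_with_degrees n D" and v: "v \<in> {1..n}" "D v \<ge> 1" and p: "0 \<le> p" "p < 1"
  shows "measure_pmf.prob (percolate p G) {H. real (card (neighbours (G - H) v)) < (1 - p) * D v / 2}
    \<le> 4 / ((1 - p)\<^sup>2 * D v)"
proof -
  note sG = graphs_with_degreesD(1)[OF G]
  let ?N = "neighbours G v" and ?F = "\<lambda>w. {{v, w}}"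
  have cN: "card ?N = D v" by (rule graphs_with_degreesD(2)[OF G v(1)])
  define t where "t = (1 - p) * D v / 2"
  have t: "t > 0" unfolding t_def using p v by simp
  have eq: "{w \<in> ?N. {v, w} \<notin> H} = neighbours (G - H) v" for H unfolding neighbours_def by auto
  have "measure_pmf.prob (percolate p G) {H. real (card (neighbours (G - H) v)) < t}
    \<le> measure_pmf.prob (percolate p G) {H. \<bar>real (card {w \<in> ?N. H \<inter> ?F w = {}}) - (\<Sum>w\<in>?N. (1 - p) ^ card (?F w))\<bar> \<ge> t}"
    by (rule measure_pmf.finite_measure_mono) (auto simp: eq t_def cN algebra_simps)
  also have "\<dots> \<le> real (card {(i, j) \<in> ?N \<times> ?N. ?F i \<inter> ?F j \<noteq> {}}) / t\<^sup>2"
    by (rule percolate_avoiding_count_concentrated)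
       (use finite_simple_graph[OF sG] finite_neighbours[OF sG] p t in \<open>auto simp: neighbours_def\<close>)
  also have "{(i, j) \<in> ?N \<times> ?N. ?F i \<inter> ?F j \<noteq> {}} = (\<lambda>i. (i, i)) ` ?N"
    by (auto simp: doubleton_eq_iff)
  also have "card \<dots> = D v" using cN by (subst card_image) (auto simp: inj_on_def)
  also have "real (D v) / t\<^sup>2 = 4 / ((1 - p)\<^sup>2 * D v)"
    unfolding t_def by (rule quarter_variance_ratio) (use p v in auto)
  finally show ?thesis unfolding t_def .
qed

text \<open>
  Two vertices have disjoint sets of incident edges unless they are equal or adjacent, so each
  vertex is dependent on at most \<open>1 + \<Delta>\<close> others, itself included.
\<close>

lemma isolated_vertices_concentrated:
  fixes e \<Delta> :: real
  assumes G: "G \<in> graphs_with_degrees n D" and A: "A \<subseteq> {1..n}" and p: "0 \<le> p" "p \<le> 1"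
    and deg: "\<And>a. a \<in> A \<Longrightarrow> D a \<le> \<Delta>" and e: "e > 0" "\<And>a. a \<in> A \<Longrightarrow> e \<le> (1 - p) ^ D a" and ne: "A \<noteq> {}"
  shows "measure_pmf.prob (percolate p G) {H. real (card {a \<in> A. neighbours H a = {}}) < e * card A / 2}
    \<le> 4 * (1 + \<Delta>) / (e\<^sup>2 * card A)"
proof -
  note sG = graphs_with_degreesD(1)[OF G]
  let ?F = "\<lambda>a. {f \<in> G. a \<in> f}"
  have finA: "finite A" using A finite_subset by auto
  have cA: "card A > 0" using finA ne by auto
  have cF: "card (?F a) = D a" if "a \<in> A" for a
    using that A graphs_with_degreesD(2)[OF G, of a] vertex_degree_eq[OF sG, of a] unfolding vertex_degree_def by auto
  define t where "t = e * card A / 2"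
  have t: "t > 0" unfolding t_def using e cA by simp
  have sum: "e * card A \<le> (\<Sum>a\<in>A. (1 - p) ^ card (?F a))"
  proof -
    have "(\<Sum>a\<in>A. e) \<le> (\<Sum>a\<in>A. (1 - p) ^ card (?F a))" by (rule sum_mono) (use e cF in simp)
    then show ?thesis by (simp add: mult.commute)
  qed
  have "measure_pmf.prob (percolate p G) {H. real (card {a \<in> A. neighbours H a = {}}) < t}
    \<le> measure_pmf.prob (percolate p G) {H. \<bar>real (card {a \<in> A. H \<inter> ?F a = {}}) - (\<Sum>a\<in>A. (1 - p) ^ card (?F a))\<bar> \<ge> t}"
  proof (rule prob_le_on_support, clarify)
    fix H assume H: "H \<in> set_pmf (percolate p G)" "real (card {a \<in> A. neighbours H a = {}}) < t"
    have sH: "H \<in> simple_graphs n" and HG: "H \<subseteq> G" using set_percolate[OF H(1)] simple_graphs_subset sG by auto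
    have "H \<inter> ?F a = {e \<in> H. a \<in> e}" for a using HG by auto
    then have "{a \<in> A. H \<inter> ?F a = {}} = {a \<in> A. neighbours H a = {}}"
      by (simp add: star_eq_image_neighbours[OF sH])
    then show "t \<le> \<bar>real (card {a \<in> A. H \<inter> ?F a = {}}) - (\<Sum>a\<in>A. (1 - p) ^ card (?F a))\<bar>"
      using sum H(2) unfolding t_def by simp
  qed
  also have "\<dots> \<le> real (card {(i, j) \<in> A \<times> A. ?F i \<inter> ?F j \<noteq> {}}) / t\<^sup>2"
    by (rule percolate_avoiding_count_concentrated) (use finite_simple_graph[OF sG] finA p t in auto)
  also have "\<dots> \<le> card A * (1 + \<Delta>) / t\<^sup>2"
  proof (rule divide_right_mono)
    have "{(i, j) \<in> A \<times> A. ?F i \<inter> ?F j \<noteq> {}} \<subseteq> Sigma A (\<lambda>i. insert i (neighbours G i))"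
    proof
      fix z assume z: "z \<in> {(i, j) \<in> A \<times> A. ?F i \<inter> ?F j \<noteq> {}}"
      obtain i j where ij: "z = (i, j)" by force
      then obtain f where f: "f \<in> G" "i \<in> f" "j \<in> f" and i: "i \<in> A" using z by blast
      obtain u w where "f = {u, w}" using simple_graph_edge_ex[OF sG f(1)] by blast
      then have "j \<in> insert i (neighbours G i)" using f by (auto simp: neighbours_def insert_commute)
      then show "z \<in> Sigma A (\<lambda>i. insert i (neighbours G i))" using i ij by simp
    qed
    then have "card {(i, j) \<in> A \<times> A. ?F i \<inter> ?F j \<noteq> {}} \<le> card (Sigma A (\<lambda>i. insert i (neighbours G i)))"
      using finA finite_neighbours[OF sG] by (intro card_mono) auto
    also have "\<dots> = (\<Sum>i\<in>A. card (insert i (neighbours G i)))"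
      using finA finite_neighbours[OF sG] by (subst card_SigmaI) auto
    finally have "real (card {(i, j) \<in> A \<times> A. ?F i \<inter> ?F j \<noteq> {}}) \<le> real (\<Sum>i\<in>A. card (insert i (neighbours G i)))"
      by (rule of_nat_mono)
    then have "real (card {(i, j) \<in> A \<times> A. ?F i \<inter> ?F j \<noteq> {}}) \<le> (\<Sum>i\<in>A. real (card (insert i (neighbours G i))))"
      by (simp only: of_nat_sum)
    also have "\<dots> \<le> (\<Sum>i\<in>A. 1 + \<Delta>)"
    proof (rule sum_mono)
      fix i assume i: "i \<in> A"
      have "card (insert i (neighbours G i)) \<le> Suc (card (neighbours G i))" by (rule card_insert_le_m1) auto
      also have "card (neighbours G i) = D i" using graphs_with_degreesD(2)[OF G] i A by auto
      finally show "real (card (insert i (neighbours G i))) \<le> 1 + \<Delta>" using deg[OF i] by simp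
    qed
    finally show "real (card {(i, j) \<in> A \<times> A. ?F i \<inter> ?F j \<noteq> {}}) \<le> card A * (1 + \<Delta>)" by simp
  qed simp
  also have "\<dots> = 4 * (1 + \<Delta>) / (e\<^sup>2 * card A)"
    using quarter_variance_ratio[of "real (card A)" e] cA e(1) unfolding t_def
    by (simp add: field_simps power2_eq_square)
  finally show ?thesis unfolding t_def .
qed

text \<open>
  Vertices outside \<open>\<Gamma>\<close> have disjoint sets of edges into \<open>\<Gamma>\<close>, so being attached to \<open>\<Gamma>\<close> is
  independent for different vertices.
\<close>

lemma attached_vertices_concentrated:
  fixes e :: real
  assumes R: "R \<in> simple_graphs n" and U: "finite U" "U \<noteq> {}" "U \<inter> \<Gamma> = {}" and p: "0 \<le> p" "p \<le> 1"
    and e: "e < 1" "\<And>u. u \<in> U \<Longrightarrow> (1 - p) ^ card (neighbours R u \<inter> \<Gamma>) \<le> e"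
  shows "measure_pmf.prob (percolate p R) {K. real (card {u \<in> U. \<exists>w\<in>\<Gamma>. {u, w} \<in> K}) < (1 - e) * card U / 2}
    \<le> 4 / ((1 - e)\<^sup>2 * card U)"
proof -
  define F where "F u = (\<lambda>w. {u, w}) ` (neighbours R u \<inter> \<Gamma>)" for u
  have cU: "card U > 0" using U by auto
  define t where "t = (1 - e) * card U / 2"
  have t: "t > 0" unfolding t_def using e cU by simp
  have cF: "card (F u) = card (neighbours R u \<inter> \<Gamma>)" for u
    unfolding F_def by (simp add: card_image inj_on_pair)
  have sum: "(\<Sum>u\<in>U. (1 - p) ^ card (F u)) \<le> e * card U"
  proof -
    have "(\<Sum>u\<in>U. (1 - p) ^ card (F u)) \<le> (\<Sum>u\<in>U. e)" by (rule sum_mono) (use e cF in simp)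
    then show ?thesis by (simp add: mult.commute)
  qed
  have "measure_pmf.prob (percolate p R) {K. real (card {u \<in> U. \<exists>w\<in>\<Gamma>. {u, w} \<in> K}) < t}
    \<le> measure_pmf.prob (percolate p R) {K. \<bar>real (card {u \<in> U. K \<inter> F u = {}}) - (\<Sum>u\<in>U. (1 - p) ^ card (F u))\<bar> \<ge> t}"
  proof (rule prob_le_on_support, clarify)
    fix K assume K: "K \<in> set_pmf (percolate p R)" "real (card {u \<in> U. \<exists>w\<in>\<Gamma>. {u, w} \<in> K}) < t"
    have KR: "K \<subseteq> R" using set_percolate[OF K(1)] .
    have "U = {u \<in> U. K \<inter> F u = {}} \<union> {u \<in> U. \<exists>w\<in>\<Gamma>. {u, w} \<in> K}"
      using KR unfolding F_def neighbours_def by auto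
    then have "card U = card ({u \<in> U. K \<inter> F u = {}} \<union> {u \<in> U. \<exists>w\<in>\<Gamma>. {u, w} \<in> K})"
      by (rule arg_cong)
    also have "\<dots> \<le> card {u \<in> U. K \<inter> F u = {}} + card {u \<in> U. \<exists>w\<in>\<Gamma>. {u, w} \<in> K}"
      by (rule card_Un_le)
    finally have "card U \<le> card {u \<in> U. K \<inter> F u = {}} + card {u \<in> U. \<exists>w\<in>\<Gamma>. {u, w} \<in> K}" .
    then have "real (card U) \<le> real (card {u \<in> U. K \<inter> F u = {}}) + t" using K(2) by linarith
    moreover have "real (card U) = e * card U + 2 * t" unfolding t_def by (simp add: field_simps)
    ultimately show "t \<le> \<bar>real (card {u \<in> U. K \<inter> F u = {}}) - (\<Sum>u\<in>U. (1 - p) ^ card (F u))\<bar>"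
      using sum by linarith
  qed
  also have "\<dots> \<le> real (card {(i, j) \<in> U \<times> U. F i \<inter> F j \<noteq> {}}) / t\<^sup>2"
    by (rule percolate_avoiding_count_concentrated)
       (use finite_simple_graph[OF R] U p t in \<open>auto simp: F_def neighbours_def\<close>)
  also have "\<dots> \<le> card U / t\<^sup>2"
  proof (rule divide_right_mono)
    have "{(i, j) \<in> U \<times> U. F i \<inter> F j \<noteq> {}} \<subseteq> (\<lambda>i. (i, i)) ` U"
    proof
      fix z assume z: "z \<in> {(i, j) \<in> U \<times> U. F i \<inter> F j \<noteq> {}}"
      obtain i j where zij: "z = (i, j)" by force
      then obtain f where ij: "i \<in> U" "j \<in> U" "f \<in> F i" "f \<in> F j" using z by blast
      then obtain w w' where "w \<in> \<Gamma>" "w' \<in> \<Gamma>" "{i, w} = {j, w'}" unfolding F_def by auto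
      then have "i = j" using ij U(3) by (auto simp: doubleton_eq_iff)
      then show "z \<in> (\<lambda>i. (i, i)) ` U" using ij zij by blast
    qed
    then have "card {(i, j) \<in> U \<times> U. F i \<inter> F j \<noteq> {}} \<le> card U" using surj_card_le[OF U(1)] by blast
    then show "real (card {(i, j) \<in> U \<times> U. F i \<inter> F j \<noteq> {}}) \<le> real (card U)" by simp
  qed simp
  also have "\<dots> = 4 / ((1 - e)\<^sup>2 * card U)"
    unfolding t_def by (rule quarter_variance_ratio) (use cU e in auto)
  finally show ?thesis unfolding t_def .
qed

section \<open>The jump of the largest component for one degree sequence\<close>

text \<open>
  A lower bound for \<open>1 - 1 / d1\<close> that depends on \<open>c\<close> alone, valid since \<open>d1 \<ge> c * d2 \<ge> c\<close>. The three
  quantities defined here enter the final constant, which must not depend on the degree sequence.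
\<close>

definition degree_margin :: "real \<Rightarrow> real" where
  "degree_margin c = 1 - 1 / c"

text \<open>
  A lower bound for the probability that a vertex of degree at most \<open>d1\<close> is isolated after the first
  stage.
\<close>

definition isolation_bound :: "real \<Rightarrow> real" where
  "isolation_bound c = exp (- (1 / degree_margin c))"

text \<open>
  An upper bound for the probability that none of at least \<open>d2 / 2\<close> edges is kept in the second stage.
\<close>

definition miss_bound :: "real \<Rightarrow> real" where
  "miss_bound c = exp (- (degree_margin c / 2))"

text \<open>
  The situation of the theorem for a single \<open>n\<close>. The last two assumptions hold for all large \<open>n\<close>;
  they say that \<open>n\<close> is large and that \<open>d1 / d\<close> is small compared to constants.
\<close>

locale degree_gap =
  fixes n :: nat and D :: "nat \<Rightarrow> nat" and d d1 d2 c \<delta> \<delta>' :: real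
  assumes feas: "feasible n D" and pos_degrees: "\<And>i. i \<in> {1..n} \<Longrightarrow> D i \<ge> 1"
    and c: "c > 1" and \<delta>: "\<delta> > 0" and \<delta>': "\<delta>' > 0"
    and d2: "1 \<le> d2" "c * d2 \<le> d1" and d: "d > 0"
    and many_middle: "\<delta> * n \<le> card (high_degree n D d2 - high_degree n D d1)"
    and many_high: "\<delta>' * n \<le> card (high_degree n D d)"
    and n_large: "8 \<le> \<delta>' * n"
    and ratio_small: "512 * sqrt (d1 / d) \<le> \<delta>' * (1 - 1 / c)"
begin

abbreviation "q \<equiv> degree_margin c"
abbreviation "e0 \<equiv> isolation_bound c"
abbreviation "e1 \<equiv> miss_bound c"

text \<open>
  The scale \<open>d0\<close> separates low from large degrees: \<open>d1 / d0 = d0 / d = sqrt \<rho>\<close>. The number \<open>s\<close> is the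
  number of exceptional vertices that the argument tolerates, \<open>Z\<close> bounds the edges leaving the giant
  component, \<open>r\<close> is half of the expected number of lost edges at a vertex of degree \<open>d\<close>, \<open>h\<close> is the
  number of neighbours in the component from which on a vertex counts as stranded, and \<open>m\<close> bounds the
  number of available transfers from below.
\<close>

definition "p = 1 / d1"
definition "\<rho> = d1 / d"
definition "d0 = sqrt (d1 * d)"
definition "s = \<delta>' * n / 8"
definition "Z = nat \<lceil>2 * d1 * n\<rceil>"
definition "r = (1 - p) * d / 2"
definition "h = nat \<lfloor>\<delta>' * n / 4\<rfloor>"
definition "m = \<delta>' * q * d * n / 8"
definition "B = high_degree n D d0"
definition "S = high_degree n D d"
definition "A = high_degree n D d2 - high_degree n D d1"

abbreviation "J \<equiv> percolated_graph n D p"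
abbreviation "\<Gamma> H \<equiv> majority n B H"

lemma n_pos: "n \<ge> 1"
  using n_large by (cases n) auto

lemma d1_gt: "c \<le> d1" "1 < d1" "d2 < d1"
proof -
  have "c * 1 \<le> c * d2" using c d2 by (intro mult_left_mono) auto
  then show "c \<le> d1" "1 < d1" using d2 c by linarith+
  have "1 * d2 < c * d2" using c d2 by (intro mult_strict_right_mono) auto
  then show "d2 < d1" using d2 by linarith
qed

lemma p_bounds: "0 < p" "p < 1" "q \<le> 1 - p" "0 < q" "q < 1"
proof -
  have "1 / d1 \<le> 1 / c" using d1_gt c by (intro divide_left_mono) auto
  then show "0 < p" "p < 1" "q \<le> 1 - p" "0 < q" "q < 1"
    using d1_gt c unfolding p_def degree_margin_def by auto
qed

lemma degree_le_n: "v \<in> {1..n} \<Longrightarrow> D v \<le> n"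
proof -
  assume v: "v \<in> {1..n}"
  obtain G where G: "G \<in> graphs_with_degrees n D" using feas unfolding feasible_def by auto
  show "D v \<le> n"
    using graphs_with_degreesD(2)[OF G v] neighbours_subset[OF graphs_with_degreesD(1)[OF G], of v]
      card_mono[of "{1..n}" "neighbours G v"] by auto
qed

lemma S_bounds: "S \<subseteq> {1..n}" "S \<noteq> {}" "\<delta>' \<le> 1" "d \<le> n"
proof -
  show sub: "S \<subseteq> {1..n}" unfolding S_def high_degree_def by auto
  then have "card S \<le> card {1..n}" by (intro card_mono) auto
  then have le: "\<delta>' * n \<le> n" using many_high unfolding S_def by simp
  then show "\<delta>' \<le> 1" using n_pos by simp
  show ne: "S \<noteq> {}" using many_high n_large unfolding S_def by auto
  then obtain v where v: "v \<in> {1..n}" "d \<le> D v" unfolding S_def high_degree_def by auto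
  then show "d \<le> n" using degree_le_n[OF v(1)] by simp
qed

lemma \<rho>_bounds: "0 < \<rho>" "\<rho> \<le> 1" "512 * sqrt \<rho> \<le> \<delta>' * q" "\<rho> \<le> sqrt \<rho>"
proof -
  show pos: "0 < \<rho>" unfolding \<rho>_def using d d1_gt by simp
  show le: "512 * sqrt \<rho> \<le> \<delta>' * q" using ratio_small unfolding \<rho>_def degree_margin_def .
  have "\<delta>' * q \<le> 1 * 1" using S_bounds(3) p_bounds \<delta>' by (intro mult_mono) auto
  then have s1: "sqrt \<rho> \<le> 1" using le by linarith
  then show "\<rho> \<le> 1" by simp
  have "sqrt \<rho> * sqrt \<rho> \<le> 1 * sqrt \<rho>" using s1 pos by (intro mult_right_mono) auto
  then show "\<rho> \<le> sqrt \<rho>" using pos by simp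
qed

lemma d1_eq: "\<rho> * d = d1" and d0_eq: "sqrt \<rho> * d = d0" and d0_d1: "sqrt \<rho> * d0 = d1"
proof -
  show 1: "\<rho> * d = d1" unfolding \<rho>_def using d by simp
  have "d1 * d = \<rho> * d\<^sup>2" using 1 by (metis mult.assoc power2_eq_square)
  then show 2: "sqrt \<rho> * d = d0" unfolding d0_def using d by (simp add: real_sqrt_mult)
  show "sqrt \<rho> * d0 = d1" using \<rho>_bounds(1) 1 2 by (metis mult.assoc real_sqrt_mult_self abs_of_pos)
qed

lemma d0_bounds: "d1 \<le> d0" "d0 \<le> d" "0 < d0"
proof -
  have "\<rho> * d \<le> sqrt \<rho> * d" using \<rho>_bounds d by (intro mult_right_mono) auto
  then show "d1 \<le> d0" unfolding d1_eq d0_eq .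
  then show "0 < d0" using d1_gt by linarith
  have "sqrt \<rho> * d \<le> 1 * d" using \<rho>_bounds(1,2) d by (intro mult_right_mono) auto
  then show "d0 \<le> d" unfolding d0_eq by simp
qed

lemma B_props: "B \<subseteq> {1..n}" "finite B" "S \<subseteq> B" "\<And>v. v \<in> B \<Longrightarrow> d0 \<le> D v" "4 * s \<le> card B" "0 < s"
proof -
  show sub: "B \<subseteq> {1..n}" unfolding B_def high_degree_def by auto
  then show fin: "finite B" by (rule finite_subset) simp
  show SB: "S \<subseteq> B" unfolding S_def B_def high_degree_def using d0_bounds by auto
  show "d0 \<le> D v" if "v \<in> B" for v using that unfolding B_def high_degree_def by auto
  have "card S \<le> card B" using SB fin by (rule card_mono[rotated])
  then show "4 * s \<le> card B" using many_high n_large unfolding s_def S_def by simp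
  show "0 < s" unfolding s_def using n_large by simp
qed

lemma A_props: "A \<subseteq> {1..n}" "finite A" "A \<noteq> {}" "\<And>a. a \<in> A \<Longrightarrow> d2 \<le> D a \<and> D a < d1" "\<delta> * n \<le> card A" "card A \<le> n"
proof -
  show sub: "A \<subseteq> {1..n}" unfolding A_def high_degree_def by auto
  then show "finite A" by (rule finite_subset) simp
  show le: "\<delta> * n \<le> card A" using many_middle unfolding A_def .
  have "0 < \<delta> * n" using \<delta> n_pos by simp
  then show "A \<noteq> {}" using le by auto
  show "d2 \<le> D a \<and> D a < d1" if "a \<in> A" for a using that unfolding A_def high_degree_def by auto
  show "card A \<le> n" using card_mono[OF _ sub] by simp
qed

text \<open>
  The number \<open>j\<close> of switching steps is of order \<open>n * d0\<close>, and \<open>d0 / d1 = 1 / sqrt \<rho>\<close> is so large that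
  \<open>j * p \<ge> n\<close>; this makes both terms of the union bound over \<open>2 ^ n\<close> cuts at most \<open>2 ^ (- n)\<close>.
\<close>

lemma majority_escape_unlikely:
  "measure_pmf.prob J {(G, H). \<not> card (B - \<Gamma> H) < s} \<le> 2 / 2 ^ n"
proof -
  define j where "j = nat \<lfloor>s * d0 / 32\<rfloor>"
  have pos: "0 \<le> s * d0" using B_props d0_bounds by simp
  then have "real j \<le> s * d0 / 32" "s * d0 / 32 - 1 \<le> real j" unfolding j_def by linarith+
  note j = this
  have j4: "real (4 * j) \<le> s * d0 / 8" using j(1) by simp
  have "\<delta>' * q \<le> \<delta>' * 1" using p_bounds \<delta>' by (intro mult_left_mono) auto
  then have sq: "512 * sqrt \<rho> \<le> \<delta>'" using \<rho>_bounds by linarith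
  have "n \<le> j * p"
  proof -
    have "2 * d1 = 2 * (sqrt \<rho> * d0)" using d0_d1 by simp
    also have "\<dots> \<le> \<delta>' / 256 * d0" using mult_right_mono[OF sq, of d0] d0_bounds by simp
    finally have "2 * d1 * n \<le> \<delta>' / 256 * d0 * n" by (intro mult_right_mono) auto
    also have "\<dots> = s * d0 / 32" unfolding s_def by simp
    finally have "2 * d1 * n - 1 \<le> j" using j(2) by linarith
    moreover have "1 * 1 \<le> d1 * n" using d1_gt n_pos by (intro mult_mono) auto
    ultimately have "d1 * n \<le> j" by linarith
    then show ?thesis unfolding p_def using d1_gt by (simp add: field_simps)
  qed
  moreover have "real j * p \<le> real j * 1" using p_bounds by (intro mult_left_mono) auto
  ultimately have nj: "real n \<le> j * p" "n \<le> j" by (linarith, simp) 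
  have "measure_pmf.prob J {(G, H). \<not> card (B - \<Gamma> H) < s}
    \<le> measure_pmf.prob J {(G, H). \<exists>S\<subseteq>{1..n}. s \<le> card (B \<inter> S) \<and> s \<le> card (B - S) \<and> cut H S = {}}"
  proof (rule prob_le_on_support, clarify)
    fix G H assume GH: "(G, H) \<in> set_pmf J" and not: "\<not> card (B - \<Gamma> H) < s"
    have sH: "H \<in> simple_graphs n"
      using set_percolated_graph[OF feas GH] simple_graphs_subset graphs_with_degreesD(1) by blast
    show "\<exists>S\<subseteq>{1..n}. s \<le> card (B \<inter> S) \<and> s \<le> card (B - S) \<and> cut H S = {}"
      using majority_covers[OF sH B_props(1) B_props(6,5)] not by blast
  qed
  also have "\<dots> \<le> 2 ^ n * ((1 / 4) ^ j + (1 - p) ^ (2 * j))"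
    by (rule balanced_cuts_survive[OF feas B_props(1,4,6) d0_bounds(3) j4]) (use p_bounds in auto)
  also have "\<dots> \<le> 2 / 2 ^ n"
  proof -
    have "2 ^ n * (1 / 4) ^ j \<le> 2 ^ n * (1 / 4 :: real) ^ n"
      using nj by (intro mult_left_mono power_decreasing) auto
    also have "\<dots> = 1 / 2 ^ n" by (simp add: power_mult_distrib[symmetric] power_one_over[symmetric])
    finally have 1: "2 ^ n * (1 / 4) ^ j \<le> (1 / 2 ^ n :: real)" .
    have "(1 - p) ^ (2 * j) \<le> exp (- (p * real (2 * j)))" by (rule one_minus_power_le_exp) (use p_bounds in auto)
    also have "\<dots> \<le> exp (- (2 * real n))" using nj by (simp add: mult.commute)
    finally have "2 ^ n * (1 - p) ^ (2 * j) \<le> 2 ^ n * exp (- (2 * real n))" by (intro mult_left_mono) auto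
    then have "2 ^ n * (1 - p) ^ (2 * j) \<le> 1 / 2 ^ n" using exp_minus_two_power[of n] by linarith
    then show ?thesis using 1 by (simp add: distrib_left)
  qed
  finally show ?thesis .
qed

lemma large_boundary_unlikely:
  "measure_pmf.prob J {(G, H). \<not> card (cut G (\<Gamma> H)) \<le> Z} \<le> 1 / 2 ^ n"
proof -
  have "measure_pmf.prob J {(G, H). \<not> card (cut G (\<Gamma> H)) \<le> Z}
    \<le> measure_pmf.prob J {(G, H). \<exists>S\<subseteq>{1..n}. Z \<le> card (cut G S) \<and> cut H S = {}}"
  proof (rule prob_le_on_support, clarify)
    fix G H assume GH: "(G, H) \<in> set_pmf J" and not: "\<not> card (cut G (\<Gamma> H)) \<le> Z"
    have "H \<in> simple_graphs n"
      using set_percolated_graph[OF feas GH] simple_graphs_subset graphs_with_degreesD(1) by blast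
    then show "\<exists>S\<subseteq>{1..n}. Z \<le> card (cut G S) \<and> cut H S = {}"
      using not by (intro exI[of _ "\<Gamma> H"] conjI majority_subset cut_majority) auto
  qed
  also have "\<dots> \<le> 2 ^ n * (1 - p) ^ Z" by (rule large_cuts_survive[OF feas]) (use p_bounds in auto)
  also have "\<dots> \<le> 2 ^ n * exp (- (2 * real n))"
  proof (rule mult_left_mono)
    have "(1 - p) ^ Z \<le> exp (- (p * real Z))" by (rule one_minus_power_le_exp) (use p_bounds in auto)
    also have "\<dots> \<le> exp (- (2 * real n))"
    proof -
      have "2 * d1 * n \<le> Z" unfolding Z_def by linarith
      then have "p * (2 * d1 * n) \<le> p * Z" using p_bounds by (intro mult_left_mono) auto
      then show ?thesis using d1_gt unfolding p_def by simp
    qed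
    finally show "(1 - p) ^ Z \<le> exp (- (2 * real n))" .
  qed simp
  also have "\<dots> \<le> 1 / 2 ^ n" by (rule exp_minus_two_power)
  finally show ?thesis .
qed

lemma inverse_d_le: "1 / d \<le> \<rho>" "d1 / n \<le> \<rho>"
proof -
  show "1 / d \<le> \<rho>" unfolding \<rho>_def using d d1_gt by (intro divide_right_mono) auto
  show "d1 / n \<le> \<rho>" unfolding \<rho>_def using d d1_gt S_bounds(4) n_pos by (intro divide_left_mono) auto
qed

text \<open>
  A vertex of degree at least \<open>d\<close> loses about a fraction \<open>1 - p\<close> of its edges in the first stage,
  and at least half of that except with probability \<open>O(1 / d)\<close>.
\<close>

lemma exhausted_vertices_unlikely:
  "measure_pmf.prob J {(G, H). s \<le> card {v \<in> S. card (neighbours (G - H) v) < r}} \<le> 32 / (\<delta>' * q\<^sup>2) * \<rho>"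
proof (rule prob_percolated_graph_le[OF feas])
  fix G assume G: "G \<in> graphs_with_degrees n D"
  have "measure_pmf.prob (percolate p G) {H. s \<le> card {v \<in> S. card (neighbours (G - H) v) < r}}
    \<le> card S * (4 / (q\<^sup>2 * d)) / s"
  proof (rule prob_count_ge_le)
    show "finite S" using S_bounds finite_subset by auto
    show "s > 0" using B_props by simp
    fix v assume v: "v \<in> S"
    have vn: "v \<in> {1..n}" and dv: "d \<le> D v" using v unfolding S_def high_degree_def by auto
    have "measure_pmf.prob (percolate p G) {H. card (neighbours (G - H) v) < r}
      \<le> measure_pmf.prob (percolate p G) {H. card (neighbours (G - H) v) < (1 - p) * D v / 2}"
    proof (rule measure_pmf.finite_measure_mono)
      have "r \<le> (1 - p) * D v / 2" unfolding r_def using dv p_bounds by (intro divide_right_mono mult_left_mono) auto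
      then show "{H. card (neighbours (G - H) v) < r} \<subseteq> {H. card (neighbours (G - H) v) < (1 - p) * D v / 2}" by auto
    qed simp
    also have "\<dots> \<le> 4 / ((1 - p)\<^sup>2 * D v)"
      by (rule residual_degree_concentrated[OF G vn pos_degrees[OF vn]]) (use p_bounds in auto)
    also have "\<dots> \<le> 4 / (q\<^sup>2 * d)"
      using p_bounds dv d by (intro divide_left_mono mult_mono power_mono) auto
    finally show "measure_pmf.prob (percolate p G) {H. card (neighbours (G - H) v) < r} \<le> 4 / (q\<^sup>2 * d)" .
  qed
  also have "\<dots> \<le> n * (4 / (q\<^sup>2 * d)) / s"
  proof -
    have "card S \<le> card {1..n}" using S_bounds by (intro card_mono) auto
    then show ?thesis using d B_props(6) by (intro divide_right_mono mult_right_mono) auto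
  qed
  also have "\<dots> = 32 / (\<delta>' * q\<^sup>2) * (1 / d)" unfolding s_def using n_pos \<delta>' d p_bounds by (simp add: field_simps)
  also have "\<dots> \<le> 32 / (\<delta>' * q\<^sup>2) * \<rho>" using inverse_d_le \<delta>' by (intro mult_left_mono) auto
  finally show "measure_pmf.prob (percolate p G) {H. s \<le> card {v \<in> S. card (neighbours (G - H) v) < r}} \<le> 32 / (\<delta>' * q\<^sup>2) * \<rho>" .
qed

lemma typicalI:
  assumes "card (B - \<Gamma> H) < s" "card (cut G (\<Gamma> H)) \<le> Z" "card {v \<in> S. card (neighbours (G - H) v) < r} < s"
  shows "typical n B S Z r (6 * s) G H"
proof -
  have finS: "finite S" using S_bounds finite_subset by auto
  have "card S \<le> card {x \<in> S \<inter> \<Gamma> H. r \<le> card (neighbours (G - H) x)} + card (B - \<Gamma> H) + card {v \<in> S. card (neighbours (G - H) v) < r}"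
    by (rule card_le_three_cover) (use finS B_props in auto)
  moreover have "8 * s \<le> card S" using many_high unfolding s_def S_def by simp
  ultimately show ?thesis using assms unfolding typical_def by auto
qed

lemma h_bounds: "real h \<le> 2 * s" "s \<le> h"
proof -
  have "0 \<le> \<delta>' * n / 4" "8 \<le> \<delta>' * n" using n_large by auto
  then show "real h \<le> 2 * s" "s \<le> h" unfolding h_def s_def by linarith+
qed

text \<open>
  The main term \<open>(6 * s - h) * r\<close> has order \<open>n * d\<close>, and the corrections have order \<open>n * d1\<close> and
  \<open>n * d0\<close>.
\<close>

lemma m_bounds: "0 < m" "D a \<le> d0 \<Longrightarrow> m \<le> (6 * s - real h) * r - real Z - real (D a) * real n"
proof -
  show "0 < m" unfolding m_def using \<delta>' p_bounds d n_pos by simp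
  assume "D a \<le> d0"
  have "32 * sqrt \<rho> * d \<le> \<delta>' * q * d" using \<rho>_bounds d by (intro mult_right_mono) auto
  then have d0: "32 * d0 \<le> \<delta>' * q * d" unfolding d0_eq[symmetric] by (simp only: mult.assoc)
  have r: "q * d / 2 \<le> r" unfolding r_def using p_bounds d by (intro divide_right_mono mult_right_mono) auto
  have "4 * s * (q * d / 2) \<le> (6 * s - h) * r"
    using r h_bounds B_props(6) p_bounds d by (intro mult_mono) auto
  moreover have "4 * s * (q * d / 2) = 2 * m" unfolding s_def m_def by simp
  moreover have "Z \<le> 2 * d1 * n + 1"
  proof -
    have "0 \<le> 2 * d1 * n" using d1_gt by simp
    then show ?thesis unfolding Z_def by linarith
  qed
  moreover have "2 * d1 * n \<le> 2 * d0 * n"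
    using d0_bounds by (intro mult_right_mono) auto
  moreover have "1 * 1 \<le> d0 * n"
    using d0_bounds d1_gt n_pos by (intro mult_mono) auto
  moreover have "real (D a) * real n \<le> d0 * n" using \<open>D a \<le> d0\<close> by (intro mult_right_mono) auto
  moreover have "4 * d0 * n \<le> m"
    using mult_right_mono[OF d0, of "real n"] unfolding m_def by simp
  ultimately show "m \<le> (6 * s - real h) * r - real Z - real (D a) * real n" by simp
qed

lemma transfer_ratio_le: "(real Z + 2) / m \<le> 40 / (\<delta>' * q) * \<rho>"
proof -
  have "0 \<le> 2 * d1 * n" using d1_gt by simp
  then have "Z \<le> 2 * d1 * n + 1" unfolding Z_def by linarith
  moreover have "1 * 1 \<le> d1 * n" using d1_gt n_pos by (intro mult_mono) auto
  ultimately have "real Z + 2 \<le> 5 * (d1 * n)" by simp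
  then have "(real Z + 2) / m \<le> 5 * (d1 * n) / m" using m_bounds(1) by (intro divide_right_mono) auto
  also have "\<dots> = 40 / (\<delta>' * q) * \<rho>" unfolding m_def \<rho>_def using \<delta>' p_bounds d n_pos by (simp add: field_simps)
  finally show ?thesis by (simp add: add.commute)
qed

text \<open>
  With \<open>x = n / d1\<close>, which is at least \<open>1 / \<rho>\<close>, both quantities are bounded by \<open>exp (- \<delta>' * x / 8)\<close>,
  up to a factor \<open>x\<close>.
\<close>

lemma strand_prob_le: "(1 - p) ^ h \<le> 8 / \<delta>' * \<rho>" "n * (p * (1 - p) ^ h) \<le> 128 / \<delta>'\<^sup>2 * \<rho>"
proof -
  define x where "x = n / d1"
  have x: "x > 0" "1 / x \<le> \<rho>" "n * p = x" unfolding x_def p_def using d1_gt n_pos inverse_d_le by auto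
  have "(1 - p) ^ h \<le> exp (- (p * real h))" by (rule one_minus_power_le_exp) (use p_bounds in auto)
  also have "\<dots> \<le> exp (- (\<delta>' * x / 8))"
  proof -
    have "p * s \<le> p * h" using h_bounds p_bounds by (intro mult_left_mono) auto
    moreover have "p * s = \<delta>' * x / 8" unfolding s_def x(3)[symmetric] by simp
    ultimately show ?thesis by simp
  qed
  finally have le: "(1 - p) ^ h \<le> exp (- (\<delta>' * x / 8))" .
  have y: "\<delta>' * x / 8 > 0" using x \<delta>' by simp
  have "(1 - p) ^ h \<le> 1 / (\<delta>' * x / 8)" using le exp_minus_le_inverse[OF y] by linarith
  also have "\<dots> = 8 / \<delta>' * (1 / x)" by simp
  also have "\<dots> \<le> 8 / \<delta>' * \<rho>" using x \<delta>' by (intro mult_left_mono) auto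
  finally show "(1 - p) ^ h \<le> 8 / \<delta>' * \<rho>" .
  have "(1 - p) ^ h \<le> 2 / (\<delta>' * x / 8)\<^sup>2" using le exp_minus_le_inverse_square[OF y] by linarith
  then have "x * (1 - p) ^ h \<le> x * (2 / (\<delta>' * x / 8)\<^sup>2)" using x by (intro mult_left_mono) auto
  also have "\<dots> = 128 / \<delta>'\<^sup>2 * (1 / x)" using x \<delta>' by (simp add: field_simps power2_eq_square)
  also have "\<dots> \<le> 128 / \<delta>'\<^sup>2 * \<rho>" using x by (intro mult_left_mono) auto
  finally show "n * (p * (1 - p) ^ h) \<le> 128 / \<delta>'\<^sup>2 * \<rho>" using x(3) by (metis mult.assoc)
qed

definition "K1 = 128 / \<delta>'\<^sup>2 + 40 / (\<delta>' * q)"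
definition "K2 = 32 / \<delta>' + 160 / (\<delta>' * q)"

lemma unabsorbed_vertices_unlikely:
  "measure_pmf.prob J {(G, H). typical n B S Z r (6 * s) G H \<and>
      s \<le> card {a \<in> {1..n} - B. a \<notin> \<Gamma> H \<and> neighbours H a \<noteq> {}}} \<le> 8 * K1 / \<delta>' * \<rho>"
proof -
  let ?Q = "\<lambda>a (G, H). typical n B S Z r (6 * s) G H \<and> a \<notin> \<Gamma> H \<and> neighbours H a \<noteq> {}"
  have K1: "0 \<le> K1" unfolding K1_def using \<delta>' p_bounds by simp
  have "measure_pmf.prob J {(G, H). typical n B S Z r (6 * s) G H \<and>
      s \<le> card {a \<in> {1..n} - B. a \<notin> \<Gamma> H \<and> neighbours H a \<noteq> {}}}
    \<le> measure_pmf.prob J {x. s \<le> card {a \<in> {1..n} - B. ?Q a x}}"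
    by (rule measure_pmf.finite_measure_mono) auto
  also have "\<dots> \<le> card ({1..n} - B) * (K1 * \<rho>) / s"
  proof (rule prob_count_ge_le)
    fix a assume a: "a \<in> {1..n} - B"
    then have an: "a \<in> {1..n}" and da: "D a \<le> d0" unfolding B_def high_degree_def by auto
    have "measure_pmf.prob J {x. ?Q a x} \<le> D a * (p * (1 - p) ^ h) + (real Z + 2) / m"
      by (rule vertex_outside_majority_isolated[OF feas _ _ an B_props(2) _ m_bounds(1)])
         (use p_bounds m_bounds(2)[OF da] d in \<open>auto simp: r_def\<close>)
    also have "\<dots> \<le> 128 / \<delta>'\<^sup>2 * \<rho> + 40 / (\<delta>' * q) * \<rho>"
    proof (rule add_mono[OF _ transfer_ratio_le])
      have "D a * (p * (1 - p) ^ h) \<le> n * (p * (1 - p) ^ h)"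
        using degree_le_n[OF an] p_bounds by (intro mult_right_mono) auto
      then show "D a * (p * (1 - p) ^ h) \<le> 128 / \<delta>'\<^sup>2 * \<rho>" using strand_prob_le(2) by linarith
    qed
    also have "\<dots> = K1 * \<rho>" unfolding K1_def by (simp add: algebra_simps)
    finally show "measure_pmf.prob J {x. ?Q a x} \<le> K1 * \<rho>" .
  qed (use B_props in auto)
  also have "\<dots> \<le> n * (K1 * \<rho>) / s"
  proof -
    have "card ({1..n} - B) \<le> card {1..n}" by (intro card_mono) auto
    then show ?thesis using K1 \<rho>_bounds(1) B_props(6) by (intro divide_right_mono mult_right_mono) auto
  qed
  also have "\<dots> = 8 * K1 / \<delta>' * \<rho>" unfolding s_def using n_pos \<delta>' by (simp add: field_simps)
  finally show ?thesis .
qed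

lemma misdirected_vertices_unlikely:
  "measure_pmf.prob J {(G, H). typical n B S Z r (6 * s) G H \<and>
      e0 * card A / 4 \<le> card {a \<in> A. a \<notin> \<Gamma> H \<and> neighbours H a = {} \<and> D a \<le> 2 * card (neighbours G a - \<Gamma> H)}}
    \<le> 4 * K2 / e0 * \<rho>"
proof -
  let ?Q = "\<lambda>a (G, H). typical n B S Z r (6 * s) G H \<and> a \<notin> \<Gamma> H \<and> neighbours H a = {}
      \<and> D a \<le> 2 * card (neighbours G a - \<Gamma> H)"
  have e0: "e0 > 0" unfolding isolation_bound_def by simp
  have cA: "card A > 0" using A_props by (simp add: card_gt_0_iff)
  have "measure_pmf.prob J {(G, H). typical n B S Z r (6 * s) G H \<and>
      e0 * card A / 4 \<le> card {a \<in> A. a \<notin> \<Gamma> H \<and> neighbours H a = {} \<and> D a \<le> 2 * card (neighbours G a - \<Gamma> H)}}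
    \<le> measure_pmf.prob J {x. e0 * card A / 4 \<le> card {a \<in> A. ?Q a x}}"
    by (rule measure_pmf.finite_measure_mono) auto
  also have "\<dots> \<le> card A * (K2 * \<rho>) / (e0 * card A / 4)"
  proof (rule prob_count_ge_le)
    fix a assume a: "a \<in> A"
    then have an: "a \<in> {1..n}" and da: "D a \<le> d0" using A_props(1,4) d0_bounds by force+
    have "measure_pmf.prob J {x. ?Q a x} \<le> 4 * (1 - p) ^ h + 4 * (real Z + 2) / m"
      by (rule isolated_vertex_sees_majority[OF feas _ _ an pos_degrees[OF an] B_props(2) _ m_bounds(1)])
         (use p_bounds m_bounds(2)[OF da] d in \<open>auto simp: r_def\<close>)
    also have "\<dots> = 4 * (1 - p) ^ h + 4 * ((real Z + 2) / m)" by simp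
    also have "\<dots> \<le> 4 * (8 / \<delta>' * \<rho>) + 4 * (40 / (\<delta>' * q) * \<rho>)"
      by (intro add_mono mult_left_mono transfer_ratio_le strand_prob_le(1)) auto
    also have "\<dots> = K2 * \<rho>" unfolding K2_def by (simp add: algebra_simps)
    finally show "measure_pmf.prob J {x. ?Q a x} \<le> K2 * \<rho>" .
  qed (use A_props(2) e0 cA in auto)
  also have "\<dots> = 4 * K2 / e0 * \<rho>" using cA e0 by (simp add: field_simps)
  finally show ?thesis .
qed

text \<open>
  From \<open>1 - p \<ge> exp (- p / (1 - p))\<close> and \<open>D a * p \<le> 1\<close>.
\<close>

lemma isolation_prob_ge:
  assumes a: "a \<in> A"
  shows "e0 \<le> (1 - p) ^ D a"
proof -
  have q1: "0 < 1 - p" using p_bounds by simp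
  have "1 / (1 - p) = 1 + p / (1 - p)" using q1 by (simp add: field_simps)
  also have "\<dots> \<le> exp (p / (1 - p))" by (rule exp_ge_add_one_self)
  finally have "exp (- (p / (1 - p))) \<le> 1 - p"
    using q1 by (simp add: exp_minus field_simps)
  then have "exp (- (p / (1 - p))) ^ D a \<le> (1 - p) ^ D a" by (intro power_mono) auto
  moreover have "exp (- (p / (1 - p))) ^ D a = exp (- (D a * p / (1 - p)))"
    by (simp add: exp_of_nat_mult[symmetric])
  moreover have "D a * p / (1 - p) \<le> 1 / q"
  proof -
    have "D a * p \<le> 1" using A_props(4)[OF a] d1_gt unfolding p_def by simp
    then show ?thesis using p_bounds by (intro frac_le) auto
  qed
  ultimately show ?thesis unfolding isolation_bound_def by (smt (verit) exp_le_cancel_iff)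
qed

lemma few_isolated_unlikely:
  "measure_pmf.prob J {(G, H). real (card {a \<in> A. neighbours H a = {}}) < e0 * card A / 2} \<le> 8 / (e0\<^sup>2 * \<delta>) * \<rho>"
proof (rule prob_percolated_graph_le[OF feas])
  fix G assume G: "G \<in> graphs_with_degrees n D"
  have e0: "e0 > 0" unfolding isolation_bound_def by simp
  have "measure_pmf.prob (percolate p G) {H. real (card {a \<in> A. neighbours H a = {}}) < e0 * card A / 2}
    \<le> 4 * (1 + d1) / (e0\<^sup>2 * card A)"
  proof (rule isolated_vertices_concentrated[OF G A_props(1)])
    show "D a \<le> d1" if "a \<in> A" for a using A_props(4)[OF that] by simp
  qed (use p_bounds e0 isolation_prob_ge A_props in auto)
  also have "\<dots> \<le> 4 * (2 * d1) / (e0\<^sup>2 * (\<delta> * n))"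
    using A_props(5) d1_gt e0 \<delta> n_pos by (intro frac_le mult_left_mono) auto
  also have "\<dots> = 8 / (e0\<^sup>2 * \<delta>) * (d1 / n)" by simp
  also have "\<dots> \<le> 8 / (e0\<^sup>2 * \<delta>) * \<rho>" using inverse_d_le \<delta> by (intro mult_left_mono) auto
  finally show "measure_pmf.prob (percolate p G) {H. real (card {a \<in> A. neighbours H a = {}}) < e0 * card A / 2} \<le> 8 / (e0\<^sup>2 * \<delta>) * \<rho>" .
qed

text \<open>
  The outcomes of the first stage from which the second stage succeeds: almost all vertices of \<open>B\<close>
  and almost all non-isolated vertices lie in the majority component, and many vertices of \<open>A\<close> are
  isolated, of which only few have half of their neighbours outside the component.
\<close>

definition good :: "(nat set set \<times> nat set set) set" where
  "good = {(G, H). card (B - \<Gamma> H) < s \<and>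
     card {a \<in> {1..n} - B. a \<notin> \<Gamma> H \<and> neighbours H a \<noteq> {}} < s \<and>
     card {a \<in> A. a \<notin> \<Gamma> H \<and> neighbours H a = {} \<and> D a \<le> 2 * card (neighbours G a - \<Gamma> H)} < e0 * card A / 4 \<and>
     e0 * card A / 2 \<le> card {a \<in> A. neighbours H a = {}}}"

definition "failure_rate = 32 / (\<delta>' * q\<^sup>2) + 8 * K1 / \<delta>' + 4 * K2 / e0 + 8 / (e0\<^sup>2 * \<delta>)"

lemma prob_not_good: "measure_pmf.prob J (- good) \<le> 3 / 2 ^ n + failure_rate * \<rho>"
proof -
  let ?E1 = "{(G, H). \<not> card (B - \<Gamma> H) < s}"
  let ?E2 = "{(G, H). \<not> card (cut G (\<Gamma> H)) \<le> Z}"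
  let ?E3 = "{(G, H). s \<le> card {v \<in> S. card (neighbours (G - H) v) < r}}"
  let ?E4 = "{(G, H). typical n B S Z r (6 * s) G H \<and>
      s \<le> card {a \<in> {1..n} - B. a \<notin> \<Gamma> H \<and> neighbours H a \<noteq> {}}}"
  let ?E5 = "{(G, H). typical n B S Z r (6 * s) G H \<and>
      e0 * card A / 4 \<le> card {a \<in> A. a \<notin> \<Gamma> H \<and> neighbours H a = {} \<and> D a \<le> 2 * card (neighbours G a - \<Gamma> H)}}"
  let ?E6 = "{(G, H). real (card {a \<in> A. neighbours H a = {}}) < e0 * card A / 2}"
  have sub: "- good \<subseteq> ?E1 \<union> (?E2 \<union> (?E3 \<union> (?E4 \<union> (?E5 \<union> ?E6))))"
  proof
    fix x assume x: "x \<in> - good"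
    obtain G H where GH: "x = (G, H)" by force
    show "x \<in> ?E1 \<union> (?E2 \<union> (?E3 \<union> (?E4 \<union> (?E5 \<union> ?E6))))"
    proof (cases "typical n B S Z r (6 * s) G H")
      case True
      then show ?thesis using x unfolding GH good_def by (auto simp: not_less not_le)
    next
      case False
      then have "\<not> (card (B - \<Gamma> H) < s \<and> card (cut G (\<Gamma> H)) \<le> Z \<and> card {v \<in> S. card (neighbours (G - H) v) < r} < s)"
        using typicalI[of H G] by blast
      then show ?thesis unfolding GH not_less by auto
    qed
  qed
  have "measure_pmf.prob J (- good) \<le> measure_pmf.prob J (?E1 \<union> (?E2 \<union> (?E3 \<union> (?E4 \<union> (?E5 \<union> ?E6)))))"
    by (rule measure_pmf.finite_measure_mono[OF sub]) simp
  also have "\<dots> \<le> measure_pmf.prob J ?E1 + (measure_pmf.prob J ?E2 + (measure_pmf.prob J ?E3 + (measure_pmf.prob J ?E4 + (measure_pmf.prob J ?E5 + measure_pmf.prob J ?E6))))"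
    by (intro order_trans[OF prob_Un_le] add_left_mono order_refl)
  also have "\<dots> \<le> 2 / 2 ^ n + (1 / 2 ^ n + (32 / (\<delta>' * q\<^sup>2) * \<rho> + (8 * K1 / \<delta>' * \<rho> + (4 * K2 / e0 * \<rho> + 8 / (e0\<^sup>2 * \<delta>) * \<rho>))))"
    by (intro add_mono majority_escape_unlikely large_boundary_unlikely exhausted_vertices_unlikely
        unabsorbed_vertices_unlikely misdirected_vertices_unlikely few_isolated_unlikely)
  also have "\<dots> = 3 / 2 ^ n + failure_rate * \<rho>" unfolding failure_rate_def by (simp add: algebra_simps add_divide_distrib[symmetric])
  finally show ?thesis .
qed

text \<open>
  The conditional probability to be kept in the second stage for an edge lost in the first.
\<close>

definition "p' = (1 / d2 - 1 / d1) / (1 - 1 / d1)"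

lemma p'_bounds: "0 \<le> p'" "p' \<le> 1" "q / d2 \<le> p'"
proof -
  have i: "1 / d1 \<le> 1 / d2" "1 / d2 \<le> 1" using d1_gt d2 by (auto simp: field_simps)
  have q1: "0 < 1 - 1 / d1" "1 - 1 / d1 \<le> 1" using d1_gt by auto
  show "0 \<le> p'" unfolding p'_def using i q1 by (intro divide_nonneg_nonneg) auto
  show "p' \<le> 1" unfolding p'_def using i q1 by (subst pos_divide_le_eq) auto
  have "1 / d1 \<le> 1 / (c * d2)" using d2 c d1_gt by (intro divide_left_mono) auto
  then have "q / d2 \<le> 1 / d2 - 1 / d1" unfolding degree_margin_def using d2 c by (simp add: diff_divide_distrib)
  also have "\<dots> \<le> p'"
    unfolding p'_def using i q1 by (subst pos_le_divide_eq) (auto intro: mult_left_le)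
  finally show "q / d2 \<le> p'" .
qed

text \<open>
  In a good outcome the majority component is the largest one, since fewer than \<open>2 * s\<close>
  non-isolated vertices lie outside while it has more than \<open>3 * s\<close> vertices. At least
  \<open>e0 * card A / 4\<close> vertices of \<open>A\<close> are isolated in \<open>H\<close> and have at least \<open>d2 / 2\<close> edges into it, and
  each of them is attached in the second stage with probability at least \<open>1 - e1\<close>.
\<close>

lemma giant_gains:
  assumes GH: "(G, H) \<in> set_pmf J" and gd: "(G, H) \<in> good"
  shows "measure_pmf.prob (map_pmf (\<lambda>K. (H, H \<union> K)) (percolate p' (G - H)))
      {(H1, H2). \<not> real (L1 n H2) - real (L1 n H1) \<ge> (1 - e1) * e0 * \<delta> / 8 * n}
    \<le> 16 / ((1 - e1)\<^sup>2 * e0 * \<delta>) / n"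
proof -
  note pg = set_percolated_graph[OF feas GH]
  note sG = graphs_with_degreesD(1)[OF pg(1)]
  have sH: "H \<in> simple_graphs n" and sR: "G - H \<in> simple_graphs n"
    using simple_graphs_subset[OF _ sG] pg(2) by auto
  have e01: "e0 > 0" "0 < e1" "e1 < 1" unfolding isolation_bound_def miss_bound_def using p_bounds by auto
  have g1: "card (B - \<Gamma> H) < s"
    and g4: "card {a \<in> {1..n} - B. a \<notin> \<Gamma> H \<and> neighbours H a \<noteq> {}} < s"
    and g5: "card {a \<in> A. a \<notin> \<Gamma> H \<and> neighbours H a = {} \<and> D a \<le> 2 * card (neighbours G a - \<Gamma> H)} < e0 * card A / 4"
    and g6: "e0 * card A / 2 \<le> card {a \<in> A. neighbours H a = {}}"
    using gd unfolding good_def by auto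
  have fin\<Gamma>: "finite (\<Gamma> H)" by (rule finite_subset[OF majority_subset]) simp
  have s1: "1 \<le> s" unfolding s_def using n_large by simp
  have big: "3 * s < card (\<Gamma> H)"
  proof -
    have "card B \<le> card (\<Gamma> H \<union> (B - \<Gamma> H))" using fin\<Gamma> B_props(2) by (intro card_mono) auto
    also have "\<dots> \<le> card (\<Gamma> H) + card (B - \<Gamma> H)" by (rule card_Un_le)
    finally show ?thesis using B_props(5) g1 by linarith
  qed
  then have ne: "\<Gamma> H \<noteq> {}" using s1 by auto
  have L1H: "L1 n H = card (\<Gamma> H)"
  proof (rule L1_eq_majority[OF sH B_props(2) ne])
    have "card {v \<in> {1..n}. v \<notin> \<Gamma> H \<and> neighbours H v \<noteq> {}}
      \<le> card ((B - \<Gamma> H) \<union> {a \<in> {1..n} - B. a \<notin> \<Gamma> H \<and> neighbours H a \<noteq> {}})"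
      using B_props(2) by (intro card_mono) auto
    also have "\<dots> \<le> card (B - \<Gamma> H) + card {a \<in> {1..n} - B. a \<notin> \<Gamma> H \<and> neighbours H a \<noteq> {}}"
      by (rule card_Un_le)
    finally show "card {v \<in> {1..n}. v \<notin> \<Gamma> H \<and> neighbours H v \<noteq> {}} \<le> card (\<Gamma> H)"
      using g1 g4 big s1 by linarith
  qed
  \<comment> \<open>The component of an isolated vertex is a singleton, but \<open>\<Gamma> H\<close> has more than \<open>3 * s \<ge> 3\<close> vertices.\<close>
  have out: "a \<notin> \<Gamma> H" if a: "a \<in> A" "neighbours H a = {}" for a
  proof
    assume aG: "a \<in> \<Gamma> H"
    have "\<Gamma> H = {a}"
      using majority_eq_component[OF B_props(2) aG] component_isolated[OF _ a(2)] a(1) A_props(1) by blast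
    then show False using big s1 by simp
  qed
  define U where "U = {a \<in> A. neighbours H a = {} \<and> 2 * card (neighbours G a - \<Gamma> H) < D a}"
  have finU: "finite U" unfolding U_def using A_props(2) by auto
  have cardU: "e0 * card A / 4 \<le> card U"
  proof -
    have "card {a \<in> A. neighbours H a = {}} \<le>
      card (U \<union> {a \<in> A. a \<notin> \<Gamma> H \<and> neighbours H a = {} \<and> D a \<le> 2 * card (neighbours G a - \<Gamma> H)})"
      using A_props(2) finU out by (intro card_mono) (auto simp: U_def)
    also have "\<dots> \<le> card U + card {a \<in> A. a \<notin> \<Gamma> H \<and> neighbours H a = {} \<and> D a \<le> 2 * card (neighbours G a - \<Gamma> H)}"
      by (rule card_Un_le)
    finally show ?thesis using g5 g6 by linarith
  qed
  have cU: "e0 * \<delta> * n / 4 \<le> card U"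
  proof -
    have "e0 * (\<delta> * n) \<le> e0 * card A" using A_props(5) e01 by (intro mult_left_mono) auto
    then show ?thesis using cardU by (simp add: mult.assoc)
  qed
  have Upos: "0 < e0 * \<delta> * n / 4" using e01 \<delta> n_pos by simp
  then have Une: "U \<noteq> {}" using cU by auto
  have dis: "U \<inter> \<Gamma> H = {}" using out unfolding U_def by auto
  let ?U' = "\<lambda>K. {u \<in> U. \<exists>w\<in>\<Gamma> H. {u, w} \<in> K}"
  have "measure_pmf.prob (map_pmf (\<lambda>K. (H, H \<union> K)) (percolate p' (G - H)))
      {(H1, H2). \<not> real (L1 n H2) - real (L1 n H1) \<ge> (1 - e1) * e0 * \<delta> / 8 * n}
    = measure_pmf.prob (percolate p' (G - H)) {K. \<not> real (L1 n (H \<union> K)) - real (L1 n H) \<ge> (1 - e1) * e0 * \<delta> / 8 * n}"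
    by (simp add: vimage_def)
  also have "\<dots> \<le> measure_pmf.prob (percolate p' (G - H)) {K. real (card (?U' K)) < (1 - e1) * card U / 2}"
  proof (rule prob_le_on_support, clarify)
    fix K assume K: "K \<in> set_pmf (percolate p' (G - H))"
      and small: "\<not> real (L1 n (H \<union> K)) - real (L1 n H) \<ge> (1 - e1) * e0 * \<delta> / 8 * n"
    have "H \<union> K \<subseteq> G" using set_percolate[OF K] pg(2) by auto
    then have "card (\<Gamma> H) + card (?U' K) \<le> L1 n (H \<union> K)"
      by (intro L1_ge_attached[OF simple_graphs_subset[OF _ sG] B_props(2) ne]) (use dis in auto)
    then have "real (card (?U' K)) < (1 - e1) * e0 * \<delta> / 8 * n" using small unfolding L1H by linarith
    also have "\<dots> = (1 - e1) / 2 * (e0 * \<delta> * n / 4)" by simp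
    also have "\<dots> \<le> (1 - e1) / 2 * card U" using cU e01 by (intro mult_left_mono) auto
    finally show "real (card (?U' K)) < (1 - e1) * card U / 2" by simp
  qed
  also have "\<dots> \<le> 4 / ((1 - e1)\<^sup>2 * card U)"
  proof (rule attached_vertices_concentrated[OF sR finU Une dis p'_bounds(1,2) e01(3)])
    fix u assume u: "u \<in> U"
    then have uA: "u \<in> A" and iso: "neighbours H u = {}" and few: "2 * card (neighbours G u - \<Gamma> H) < D u"
      unfolding U_def by auto
    have un: "u \<in> {1..n}" using uA A_props by auto
    have nR: "neighbours (G - H) u = neighbours G u" using iso unfolding neighbours_def by auto
    have "D u = card ((neighbours G u \<inter> \<Gamma> H) \<union> (neighbours G u - \<Gamma> H))"
      using graphs_with_degreesD(2)[OF pg(1) un] by (simp add: Int_Diff_Un)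
    also have "\<dots> \<le> card (neighbours G u \<inter> \<Gamma> H) + card (neighbours G u - \<Gamma> H)" by (rule card_Un_le)
    finally have "real (D u) \<le> 2 * card (neighbours (G - H) u \<inter> \<Gamma> H)" unfolding nR using few by linarith
    then have half: "d2 / 2 \<le> card (neighbours (G - H) u \<inter> \<Gamma> H)" using A_props(4)[OF uA] by linarith
    have "q / 2 = q / d2 * (d2 / 2)" using d2 by simp
    also have "\<dots> \<le> p' * card (neighbours (G - H) u \<inter> \<Gamma> H)"
      using p'_bounds p_bounds half d2 by (intro mult_mono) auto
    finally have "exp (- (p' * card (neighbours (G - H) u \<inter> \<Gamma> H))) \<le> e1" unfolding miss_bound_def by simp
    then show "(1 - p') ^ card (neighbours (G - H) u \<inter> \<Gamma> H) \<le> e1"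
      using one_minus_power_le_exp[OF p'_bounds(1,2)] order_trans by blast
  qed
  also have "\<dots> \<le> 4 / ((1 - e1)\<^sup>2 * (e0 * \<delta> * n / 4))"
    using cU Upos e01 by (intro divide_left_mono mult_left_mono mult_pos_pos) auto
  also have "\<dots> = 16 / ((1 - e1)\<^sup>2 * e0 * \<delta>) / n" by simp
  finally show ?thesis .
qed

theorem gap_failure_prob:
  "measure_pmf.prob (coupled_percolation n D (1 / d1) (1 / d2))
      {(H1, H2). real (L1 n H2) - real (L1 n H1) \<ge> (1 - e1) * e0 * \<delta> / 8 * n}
   \<ge> 1 - (3 / 2 ^ n + failure_rate * \<rho> + 16 / ((1 - e1)\<^sup>2 * e0 * \<delta>) / n)"
proof -
  let ?M = "coupled_percolation n D (1 / d1) (1 / d2)"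
  let ?E = "{(H1, H2). real (L1 n H2) - real (L1 n H1) \<ge> (1 - e1) * e0 * \<delta> / 8 * n}"
  have M: "?M = bind_pmf J (\<lambda>(G, H). map_pmf (\<lambda>K. (H, H \<union> K)) (percolate p' (G - H)))"
    unfolding coupled_percolation_def percolated_graph_def p_def p'_def
    by (simp add: bind_assoc_pmf bind_map_pmf)
  have compl: "- ?E = {(H1, H2). \<not> real (L1 n H2) - real (L1 n H1) \<ge> (1 - e1) * e0 * \<delta> / 8 * n}" by auto
  have "measure_pmf.prob ?M (- ?E) \<le> measure_pmf.prob J (- good) + 16 / ((1 - e1)\<^sup>2 * e0 * \<delta>) / n"
    unfolding M compl
  proof (rule prob_bind_le_except)
    show "0 \<le> 16 / ((1 - e1)\<^sup>2 * e0 * \<delta>) / n" using \<delta> unfolding isolation_bound_def by simp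
    fix x assume "x \<in> set_pmf J" "x \<in> good"
    then show "measure_pmf.prob ((\<lambda>(G, H). map_pmf (\<lambda>K. (H, H \<union> K)) (percolate p' (G - H))) x)
      {(H1, H2). \<not> real (L1 n H2) - real (L1 n H1) \<ge> (1 - e1) * e0 * \<delta> / 8 * n} \<le> 16 / ((1 - e1)\<^sup>2 * e0 * \<delta>) / n"
      using giant_gains by (cases x) simp
  qed
  moreover have "measure_pmf.prob ?M (- ?E) = 1 - measure_pmf.prob ?M ?E"
    using measure_pmf.prob_compl[of ?E ?M] by (simp add: Compl_eq_Diff_UNIV)
  ultimately show ?thesis using prob_not_good by linarith
qed

end

section \<open>Asymptotics\<close>

theorem theorem1p7:
  fixes \<delta> \<delta>' c :: real
  assumes "\<delta> > 0" and "\<delta>' > 0" and "c > 1"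
  shows "\<exists>C::real. C > 0 \<and>
    (\<forall>(D :: nat \<Rightarrow> nat \<Rightarrow> nat) (d1 :: nat \<Rightarrow> real) (d2 :: nat \<Rightarrow> real) (d :: nat \<Rightarrow> real).
      (\<forall>n\<ge>2. feasible n (D n) \<and> (\<forall>i\<in>{1..n}. D n i \<ge> 1)) \<longrightarrow>
      (\<forall>n\<ge>2. 1 \<le> d2 n \<and> d2 n < d1 n \<and> d1 n / d2 n \<ge> c) \<longrightarrow>
      (\<forall>n\<ge>2. real (card (high_degree n (D n) (d2 n) - high_degree n (D n) (d1 n))) \<ge> \<delta> * real n) \<longrightarrow>
      (\<forall>n\<ge>2. d n > 0) \<longrightarrow>
      (\<lambda>n. d1 n / d n) \<longlonglongrightarrow> 0 \<longrightarrow>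
      (\<forall>n\<ge>2. real (card (high_degree n (D n) (d n))) \<ge> \<delta>' * real n) \<longrightarrow>
      (\<lambda>n. measure_pmf.prob (coupled_percolation n (D n) (1 / d1 n) (1 / d2 n))
             {(H1, H2). real (L1 n H2) - real (L1 n H1) \<ge> C * real n}) \<longlonglongrightarrow> 1)"
proof (intro exI conjI allI impI)
  let ?C = "(1 - miss_bound c) * isolation_bound c * \<delta> / 8"
  have q: "0 < degree_margin c" using assms by (simp add: degree_margin_def)
  then show "?C > 0" using assms by (simp add: miss_bound_def isolation_bound_def)
  fix D :: "nat \<Rightarrow> nat \<Rightarrow> nat" and d1 d2 d :: "nat \<Rightarrow> real"
  assume D: "\<forall>n\<ge>2. feasible n (D n) \<and> (\<forall>i\<in>{1..n}. D n i \<ge> 1)"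
    and d12: "\<forall>n\<ge>2. 1 \<le> d2 n \<and> d2 n < d1 n \<and> d1 n / d2 n \<ge> c"
    and mid: "\<forall>n\<ge>2. real (card (high_degree n (D n) (d2 n) - high_degree n (D n) (d1 n))) \<ge> \<delta> * real n"
    and d: "\<forall>n\<ge>2. d n > 0" and lim: "(\<lambda>n. d1 n / d n) \<longlonglongrightarrow> 0"
    and high: "\<forall>n\<ge>2. real (card (high_degree n (D n) (d n))) \<ge> \<delta>' * real n"
  let ?P = "\<lambda>n. measure_pmf.prob (coupled_percolation n (D n) (1 / d1 n) (1 / d2 n))
             {(H1, H2). real (L1 n H2) - real (L1 n H1) \<ge> ?C * real n}"
  let ?F = "\<lambda>n. 3 * (1 / 2) ^ n + degree_gap.failure_rate c \<delta> \<delta>' * (d1 n / d n)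
      + 16 / ((1 - miss_bound c)\<^sup>2 * isolation_bound c * \<delta>) * inverse (real n)"
  have "(\<lambda>n. 512 * sqrt (d1 n / d n)) \<longlonglongrightarrow> 512 * sqrt 0" by (intro tendsto_intros lim)
  moreover have "512 * sqrt 0 < \<delta>' * (1 - 1 / c)" using assms by simp
  ultimately have "\<forall>\<^sub>F n in sequentially. 512 * sqrt (d1 n / d n) < \<delta>' * (1 - 1 / c)"
    by (rule order_tendstoD)
  moreover have "\<forall>\<^sub>F n in sequentially. 8 / \<delta>' \<le> real n"
    using filterlim_real_sequentially unfolding filterlim_at_top by blast
  moreover have "\<forall>\<^sub>F n in sequentially. 2 \<le> (n::nat)" by (rule eventually_ge_at_top)
  \<comment> \<open>From some \<open>n\<close> on, the assumptions of the locale for a single \<open>n\<close> hold.\<close>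
  ultimately have ev: "\<forall>\<^sub>F n in sequentially. 1 - ?F n \<le> ?P n"
  proof eventually_elim
    case (elim n)
    interpret degree_gap n "D n" "d n" "d1 n" "d2 n" c \<delta> \<delta>'
    proof
      have "c \<le> d1 n / d2 n" "0 < d2 n" using d12 elim(3) by force+
      then show "c * d2 n \<le> d1 n" by (simp add: pos_le_divide_eq)
      show "8 \<le> \<delta>' * n" using elim(2) assms by (simp add: field_simps)
      show "512 * sqrt (d1 n / d n) \<le> \<delta>' * (1 - 1 / c)" using elim(1) by simp
    qed (use D d12 mid d high assms elim in auto)
    have "3 * (1 / 2) ^ n = (3 / 2 ^ n :: real)" by (simp add: power_divide)
    then show ?case using gap_failure_prob unfolding \<rho>_def divide_inverse[symmetric] by simp
  qed
  have powers_vanish: "(\<lambda>n. (1 / 2 :: real) ^ n) \<longlonglongrightarrow> 0" by (rule LIMSEQ_power_zero) simp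
  have "(\<lambda>n. 1 - ?F n) \<longlonglongrightarrow> 1 - (3 * 0 + degree_gap.failure_rate c \<delta> \<delta>' * 0 + 16 / ((1 - miss_bound c)\<^sup>2 * isolation_bound c * \<delta>) * 0)"
    by (intro tendsto_diff tendsto_add tendsto_mult tendsto_const lim powers_vanish lim_inverse_n)
  then have lo: "(\<lambda>n. 1 - ?F n) \<longlonglongrightarrow> 1" by simp
  show "?P \<longlonglongrightarrow> 1"
    by (rule tendsto_sandwich[OF ev _ lo tendsto_const]) simp
qed

end
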